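(* Let $t\in\{1,2,4\}$ and let $\sigma=\sigma_t$, $\tau=\tau_t$, $\delta=\delta_t$, with the Rauzy fractals $X_\sigma$, $X_\sigma^{(i^{\epsilon_i})}$, $X_\tau^{(i)}$ and the domain exchange transformation $T_\sigma$ as defined in the context. The measurable dynamical system $(X_\sigma,T_\sigma,\mu)$ with Lebesgue measure $\mu$ has $\delta^{-1}$-structure with respect to the pair of partitions $\{X_\sigma^{(i^{\epsilon_i})}\mid i\in\{1,2\}\}$, $\{A_\delta^{-1}X_\tau^{(i)}\mid i\in\{1,2\}\}$. Moreover, for any positive integer $n$: $(X_{\sigma_1},T_{\sigma_1},\mu)$ has $\delta_1^{-1}\tau_1^n$-structure with respect to the pair of partitions $\{X_{\sigma_1}^{(i^{\epsilon_i})}\mid i\in\{1,2\}\}$, $\{A_{\delta_1}^{-1}A_{\tau_1}^nX_{\tau_1}^{(i)}\mid i\in\{1,2\}\}$; and for $t=2,4$, $(X_{\sigma_t},T_{\sigma_t},\mu)$ has $\delta_t^{-1}\tau_t^{2n}$-structure with respect to the pair of partitions $\{X_{\sigma_t}^{(i^{\epsilon_i})}\mid i\in\{1,2\}\}$, $\{A_{\delta_t}^{-1}A_{\tau_t}^{2n}X_{\tau_t}^{(i)}\mid i\in\{1,2\}\}$.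
   Context: Let $F_2$ be the free group on the letters $1,2$, and let $f:F_2\to\mathbb Z^2$ be the homomorphism with $f(i^{\pm1})=\pm e_i$ ($e_1,e_2$ the standard basis). For an endomorphism $\sigma$ of $F_2$, $A_\sigma$ is the $2\times2$ matrix with columns $f(\sigma(1)),f(\sigma(2))$. The automorphisms ($2^{k}$ with $k<0$ means $(2^{-1})^{|k|}$; $a$ is an integer): - $t=1$, $a\ge3$: $\sigma_1:1\mapsto2,\ 2\mapsto2^{a-2}1^{-1}22$; $\tau_1:1\mapsto2^{a-3}12,\ 2\mapsto2^{a-2}12$; $\delta_1:1\mapsto21^{-1},\ 2\mapsto2$; $\delta_1^{-1}:1\mapsto1^{-1}2,\ 2\mapsto2$. - $t=2$, $a\le-3$: $\sigma_2:1\mapsto2,\ 2\mapsto1^{-1}2^{a}$; $\tau_2:1\mapsto1^{-1}2^{a+2},\ 2\mapsto1^{-1}2^{a+1}$; $\delta_2:1\mapsto2^{-1}1,\ 2\mapsto2$; $\delta_2^{-1}:1\mapsto21,\ 2\mapsto2$. - $t=4$, $a\le-1$: $\sigma_4:1\mapsto2,\ 2\mapsto12^{a}$; $\tau_4:1\mapsto2^{-1},\ 2\mapsto1^{-1}2^{a}$; $\delta_4=\delta_4^{-1}:1\mapsto1^{-1},\ 2\mapsto2$. In each case $\sigma_t=\delta_t^{-1}\circ\tau_t\circ\delta_t$. The matrices $A_{\sigma_t}$ and $A_{\tau_t}$ have the same eigenvalues $\lambda_t,\lambda_t'$ with $|\lambda_t|>1>|\lambda_t'|$. Signs: $\epsilon_1=-1$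 for $t=1,4$, $\epsilon_1=1$ for $t=2$, and $\epsilon_2=1$ always. The words $\delta_t^{-1}(i)$, $\delta_1^{-1}\tau_1^n(i)$, and $\delta_t^{-1}\tau_t^{2n}(i)$ ($t=2,4$) are words in the two letters $1^{\epsilon_1},2^{\epsilon_2}$ only. $\mathcal G^*$ is the free $\mathbb Z$-module with basis the symbols $(x,i^* )$, $x\in\mathbb Z^2$, $i\in\{1,2\}$. The symbol $(x,1^* )$ is identified with the unit segment $\{x+se_2:0\le s\le1\}$ and $(x,2^* )$ with $\{x+se_1:0\le s\le1\}$; an element of $\mathcal G^*$ is identified, as a subset of $\mathbb R^2$, with the union of the segments occurring with nonzero coefficient. For an endomorphism $\sigma$ of $F_2$ with $\det A_\sigma=\pm1$ and $\sigma(j)=w^{(j)}_1\cdots w^{(j)}_{l^{(j)}}$ (reduced word), put $S^{(j)}_k=w^{(j)}_{k+1}\cdots w^{(j)}_{l^{(j)}}$. The tiling substitution $\sigma^*:\mathcal G^*\to\mathcal G^*$ is the $\mathbb Z$-linear map $$\sigma^*(x,i^* )=\sum_{j\in\{1,2\}}\Big\{\sum_{k:\,w^{(j)}_k=i}\big(A_\sigma^{-1}(x+f(S^{(j)}_k)),j^*\big)-\sum_{k:\,w^{(j)}_k=i^{-1}}\big(A_\sigma^{-1}(x+f(w^{(j)}_kS^{(j)}_k)),j^*\big)\Big\},$$ and $\sigma^{*\,n}$ is its $n$-th iterate. For $\rho\in\{\sigma_t,\tau_t\}$, $P_\rho\subset\mathbb R^2$ is the eigenline of $A_\rho$ for $\lambda_t'$,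 and $\pi_\rho:\mathbb R^2\to P_\rho$ is the projection along the eigenline of $A_\rho$ for $\lambda_t$. Lebesgue measure is one-dimensional Lebesgue measure on $P_\rho$. Rauzy fractals (limits of compact sets in the Hausdorff metric; these limits exist). For $\tau=\tau_t$: $X_\tau^{(i)}=\lim_n A_\tau^n\pi_\tau\tau^{*\,n}(e_i,i^* )$, $i\in\{1,2\}$. For $\sigma=\sigma_t$: $X_\sigma=\lim_n A_\sigma^n\pi_\sigma\sigma^{*\,n}(\overline{\mathcal U})$, where $\overline{\mathcal U}=(e_1,1^* )+(e_2,2^* )$ if $t=2$ and $\overline{\mathcal U}=(0,1^* )+(e_2,2^* )$ if $t=1,4$. For $t=2$: $X_{\sigma}^{(i)}=\lim_n A_{\sigma}^n\pi_{\sigma}\sigma^{*\,n}(e_i,i^* )$. For $t=1,4$: $X_{\sigma}^{(1^{-1})}=\lim_n A_{\sigma}^n\pi_{\sigma}\sigma^{*\,n}(0,1^* )$, $X_{\sigma}^{(2)}=\lim_n A_{\sigma}^n\pi_{\sigma}\sigma^{*\,n}(e_2,2^* )$. Domain exchange transformation: $T_\sigma:X_\sigma\to X_\sigma$, $T_\sigma(x)=x-\pi_\sigma f(i^{\epsilon_i})$ if $x\in X_\sigma^{(i^{\epsilon_i})}$ (defined up to a set of measure $0$). $\theta$-structure: let $(X,T,\mu)$ be a measurable dynamical system, let $\theta$ assign to each $i\in\{1,2\}$ a word $\theta(i)=w_1^{(i)}\cdots w_{l^{(i)}}^{(i)}$ in two letters ($1^{\epsilon_1},2^{\epsilon_2}$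 here), let $\{X^{(w)}\}$ be a measurable partition of $X$ indexed by these two letters, and let $\{A^{(i)}\mid i\in\{1,2\}\}$ be a measurable partition of a subset $A\subset X$. (Partitions are understood up to measure $0$.) $T$ has $\theta$-structure with respect to the pair of partitions $\{X^{(w)}\},\{A^{(i)}\}$ if, up to sets of measure $0$: $T^kA^{(i)}\subset X^{(w^{(i)}_{k+1})}$ for all $i$ and $k=0,1,\dots,l^{(i)}-1$; $T^kA^{(i)}\cap A=\emptyset$ for all $i$ and $0<k<l^{(i)}$; $T^{l^{(i)}}A^{(i)}\subset A$ for all $i$; and $X=\bigcup_{i}\bigcup_{0\le k\le l^{(i)}-1}T^kA^{(i)}$ with non-overlapping union. *)

theory Defs
  imports
    "HOL-Analysis.Analysis"
    "HOL-Algebra.Group"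
    "HOL-Library.Poly_Mapping"
begin

section \<open>The free group on two letters\<close>

text \<open>
  Letters are indexed by the type \<^typ>\<open>2\<close>, whose elements are written \<open>1\<close> and \<open>2\<close> (this \<open>2\<close> is also \<open>0\<close>).
  The pair \<open>(i, True)\<close> is the letter \<open>i\<close> and \<open>(i, False)\<close> is \<open>i\<close> inverse.
\<close>

type_synonym letter = "2 \<times> bool"
type_synonym word = "letter list"

abbreviation pos :: "2 \<Rightarrow> letter" where "pos i \<equiv> (i, True)"
abbreviation neg :: "2 \<Rightarrow> letter" where "neg i \<equiv> (i, False)"

definition inv_letter :: "letter \<Rightarrow> letter" where
  "inv_letter x = (fst x, \<not> snd x)"

definition inv_word :: "word \<Rightarrow> word" where
  "inv_word w = rev (map inv_letter w)"

fun push :: "letter \<Rightarrow> word \<Rightarrow> word" where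
  "push x [] = [x]"
| "push x (y # w) = (if y = inv_letter x then w else x # y # w)"

definition reduce :: "word \<Rightarrow> word" where
  "reduce w = foldr push w []"

definition reduced :: "word \<Rightarrow> bool" where
  "reduced w \<longleftrightarrow> successively (\<lambda>x y. y \<noteq> inv_letter x) w"

definition F2 :: "word monoid" where
  "F2 = \<lparr>carrier = {w. reduced w}, mult = (\<lambda>u v. reduce (u @ v)), one = []\<rparr>"

definition endo :: "(2 \<Rightarrow> word) \<Rightarrow> word \<Rightarrow> word" where
  "endo g w = reduce (concat (map (\<lambda>(i, s). if s then g i else inv_word (g i)) w))"

lemma inv_letter_inv_letter [simp]: "inv_letter (inv_letter x) = x"
  by (simp add: inv_letter_def)

lemma inv_letter_neq [simp]: "inv_letter x \<noteq> x"
  by (simp add: inv_letter_def prod_eq_iff)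

lemma reduced_push: "reduced w \<Longrightarrow> reduced (push x w)"
  by (cases w) (auto simp: reduced_def successively_Cons)

lemma reduced_foldr_push: "reduced v \<Longrightarrow> reduced (foldr push u v)"
  by (induction u) (auto intro: reduced_push)

lemma reduced_Nil [simp]: "reduced []"
  by (simp add: reduced_def)

lemma reduced_reduce [simp]: "reduced (reduce w)"
  by (simp add: reduce_def reduced_foldr_push)

lemma push_inv_push:
  assumes "reduced w" shows "push x (push (inv_letter x) w) = w"
proof (cases w)
  case (Cons y v)
  with assms show ?thesis
    by (cases v) (auto simp: reduced_def)
qed simp

lemma reduce_reduced: "reduced w \<Longrightarrow> reduce w = w"
proof (induction w)
  case (Cons x w)
  then have "reduce w = w" by (auto simp: reduced_def successively_Cons)
  with Cons.prems show ?case
    by (cases w) (auto simp: reduce_def reduced_def)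
qed (simp add: reduce_def)

lemma foldr_push_push:
  assumes "reduced w"
  shows "foldr push (push x r) w = push x (foldr push r w)"
proof (cases r)
  case (Cons y ys)
  with assms show ?thesis
    using push_inv_push[OF reduced_foldr_push[OF assms, of ys], of x] by auto
qed simp

lemma foldr_push_reduce:
  assumes "reduced w"
  shows "foldr push (reduce u) w = foldr push u w"
  by (induction u) (auto simp: reduce_def foldr_push_push[OF assms])

lemma reduce_append_reduce [simp]:
  "reduce (reduce u @ v) = reduce (u @ v)" "reduce (u @ reduce v) = reduce (u @ v)"
proof -
  show "reduce (reduce u @ v) = reduce (u @ v)"
    using foldr_push_reduce[of "reduce v" u] by (simp add: reduce_def[of "_ @ _"] flip: reduce_def)
  show "reduce (u @ reduce v) = reduce (u @ v)"
    using reduce_reduced[OF reduced_reduce, of v] by (simp add: reduce_def)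
qed

lemma reduce_inv_word: "reduce (inv_word w @ w) = []"
proof (induction w)
  case (Cons x w)
  have "reduce (inv_word (x # w) @ x # w) = reduce (inv_word w @ reduce (inv_letter x # x # w))"
    by (simp add: inv_word_def)
  also have "reduce (inv_letter x # x # w) = reduce w"
    using push_inv_push[OF reduced_reduce, of "inv_letter x" w] by (simp add: reduce_def)
  finally show ?case using Cons by simp
qed (simp add: inv_word_def reduce_def)

lemma inv_word_inv_word [simp]: "inv_word (inv_word w) = w"
  by (simp add: inv_word_def rev_map comp_def)

lemma group_F2: "group F2"
proof (rule groupI)
  fix u assume "u \<in> carrier F2"
  have "reduce (reduce (inv_word u) @ u) = []" by (simp add: reduce_inv_word)
  then show "\<exists>v \<in> carrier F2. v \<otimes>\<^bsub>F2\<^esub> u = \<one>\<^bsub>F2\<^esub>"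
    by (auto simp: F2_def intro!: exI[of _ "reduce (inv_word u)"])
qed (auto simp: F2_def reduce_reduced)

lemma endo_append: "endo g (u @ v) = reduce (endo g u @ endo g v)"
  by (simp add: endo_def)

lemma endo_push: "endo g (push x w) = endo g (x # w)"
proof (cases w)
  case (Cons y v)
  let ?h = "\<lambda>(i, s). if s then g i else inv_word (g i)"
  show ?thesis
  proof (cases "y = inv_letter x")
    case True
    have "?h (inv_letter x) = inv_word (?h x)"
      by (cases x) (auto simp: inv_letter_def)
    then have "reduce (?h x @ ?h (inv_letter x)) = []"
      using reduce_inv_word[of "inv_word (?h x)"] by simp
    then have "reduce (reduce (?h x @ ?h (inv_letter x)) @ concat (map ?h v)) = endo g v"
      by (simp add: endo_def)
    then show ?thesis
      unfolding reduce_append_reduce using True Cons by (simp add: endo_def)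
  qed (use Cons in auto)
qed simp

lemma endo_reduce: "endo g (reduce w) = endo g w"
proof (induction w)
  case (Cons x w)
  have "endo g (reduce (x # w)) = endo g ([x] @ reduce w)"
    by (simp add: reduce_def endo_push)
  also have "\<dots> = endo g ([x] @ w)"
    unfolding endo_append Cons ..
  finally show ?case by simp
qed (simp add: reduce_def)

lemma endo_hom: "endo g \<in> hom F2 F2"
  by (auto simp: hom_def F2_def endo_reduce endo_append) (simp add: endo_def)

definition abelianize :: "word \<Rightarrow> int ^ 2" where
  "abelianize w = (\<Sum>(i, s) \<leftarrow> w. axis i (if s then 1 else - 1))"

definition incidence_matrix :: "(word \<Rightarrow> word) \<Rightarrow> int ^ 2 ^ 2" where
  "incidence_matrix \<rho> = (\<chi> r j. abelianize (\<rho> [pos j]) $ r)"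

definition real_vec :: "int ^ 2 \<Rightarrow> real ^ 2" where
  "real_vec v = (\<chi> r. real_of_int (v $ r))"

definition real_incidence_matrix :: "(word \<Rightarrow> word) \<Rightarrow> real ^ 2 ^ 2" where
  "real_incidence_matrix \<rho> = (\<chi> r j. real_of_int (incidence_matrix \<rho> $ r $ j))"


section \<open>The automorphisms\<close>

datatype family = T1 | T2 | T4

fun admissible :: "family \<Rightarrow> int \<Rightarrow> bool" where
  "admissible T1 a \<longleftrightarrow> a \<ge> 3"
| "admissible T2 a \<longleftrightarrow> a \<le> - 3"
| "admissible T4 a \<longleftrightarrow> a \<le> - 1"

definition letter_power :: "2 \<Rightarrow> int \<Rightarrow> word" where
  "letter_power i k = replicate (nat \<bar>k\<bar>) (i, k \<ge> 0)"

definition subst :: "word \<Rightarrow> word \<Rightarrow> word \<Rightarrow> word" where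
  "subst u v = endo (\<lambda>i. if i = 1 then u else v)"

fun sigma :: "family \<Rightarrow> int \<Rightarrow> word \<Rightarrow> word" where
  "sigma T1 a = subst [pos 2] (letter_power 2 (a - 2) @ [neg 1, pos 2, pos 2])"
| "sigma T2 a = subst [pos 2] (neg 1 # letter_power 2 a)"
| "sigma T4 a = subst [pos 2] (pos 1 # letter_power 2 a)"

fun tau :: "family \<Rightarrow> int \<Rightarrow> word \<Rightarrow> word" where
  "tau T1 a = subst (letter_power 2 (a - 3) @ [pos 1, pos 2]) (letter_power 2 (a - 2) @ [pos 1, pos 2])"
| "tau T2 a = subst (neg 1 # letter_power 2 (a + 2)) (neg 1 # letter_power 2 (a + 1))"
| "tau T4 a = subst [neg 2] (neg 1 # letter_power 2 a)"

fun delta :: "family \<Rightarrow> word \<Rightarrow> word" where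
  "delta T1 = subst [pos 2, neg 1] [pos 2]"
| "delta T2 = subst [neg 2, pos 1] [pos 2]"
| "delta T4 = subst [neg 1] [pos 2]"

fun delta_inv :: "family \<Rightarrow> word \<Rightarrow> word" where
  "delta_inv T1 = subst [neg 1, pos 2] [pos 2]"
| "delta_inv T2 = subst [pos 2, pos 1] [pos 2]"
| "delta_inv T4 = subst [neg 1] [pos 2]"

lemma delta_inv_delta: "delta_inv t (delta t [pos i]) = [pos i]" "delta t (delta_inv t [pos i]) = [pos i]"
  using exhaust_2[of i]
  by (cases t; auto simp: subst_def endo_def reduce_def inv_word_def inv_letter_def)+

text \<open>The letter \<open>i\<close> raised to the sign \<open>\<epsilon>\<^sub>i\<close>; its second component says whether that sign is \<open>+1\<close>.\<close>

definition signed_letter :: "family \<Rightarrow> 2 \<Rightarrow> letter" where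
  "signed_letter t i = (i, t = T2 \<or> i = 2)"


section \<open>Tiling substitutions\<close>

text \<open>
  The frag type is the free abelian group on a type; the basis element \<open>frag_of (x, i)\<close>
  is the symbol \<open>(x, i\<^sup>*)\<close>.
\<close>

type_synonym chain = "((int ^ 2) \<times> 2) \<Rightarrow>\<^sub>0 int"

fun segment :: "(int ^ 2) \<times> 2 \<Rightarrow> (real ^ 2) set" where
  "segment (x, i) = closed_segment (real_vec x) (real_vec x + axis (if i = 1 then 2 else 1) 1)"

definition geometric :: "chain \<Rightarrow> (real ^ 2) set" where
  "geometric c = (\<Union>s \<in> Poly_Mapping.keys c. segment s)"

text \<open>Positions are counted from 0, so \<open>drop (Suc k) w\<close> is the suffix strictly after \<open>w ! k\<close>.\<close>

definition tiling_subst :: "(word \<Rightarrow> word) \<Rightarrow> chain \<Rightarrow> chain" where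
  "tiling_subst \<rho> = frag_extend (\<lambda>(x, i).
     \<Sum>j\<in>UNIV. let w = \<rho> [pos j]; B = matrix_inv (incidence_matrix \<rho>) in
       (\<Sum>k | k < length w \<and> w ! k = pos i. frag_of (B *v (x + abelianize (drop (Suc k) w)), j))
     - (\<Sum>k | k < length w \<and> w ! k = neg i. frag_of (B *v (x + abelianize (drop k w)), j)))"


section \<open>The contracting line and its Lebesgue measure\<close>

definition eigenspace :: "real ^ 2 ^ 2 \<Rightarrow> real \<Rightarrow> (real ^ 2) set" where
  "eigenspace A l = {v. A *v v = l *\<^sub>R v}"

definition is_eigenvalue :: "real ^ 2 ^ 2 \<Rightarrow> real \<Rightarrow> bool" where
  "is_eigenvalue A l \<longleftrightarrow> (\<exists>v. v \<noteq> 0 \<and> A *v v = l *\<^sub>R v)"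

definition expanding_line :: "real ^ 2 ^ 2 \<Rightarrow> (real ^ 2) set" where
  "expanding_line A = eigenspace A (THE l. is_eigenvalue A l \<and> \<bar>l\<bar> > 1)"

definition contracting_line :: "real ^ 2 ^ 2 \<Rightarrow> (real ^ 2) set" where
  "contracting_line A = eigenspace A (THE l. is_eigenvalue A l \<and> \<bar>l\<bar> < 1)"

definition eigenprojection :: "real ^ 2 ^ 2 \<Rightarrow> real ^ 2 \<Rightarrow> real ^ 2" where
  "eigenprojection A v = (THE p. p \<in> contracting_line A \<and> v - p \<in> expanding_line A)"

text \<open>
  One-dimensional Lebesgue measure on a line \<open>P\<close> through the origin, transported by the isometry
  \<open>s \<mapsto> s u\<close>; the result does not depend on which of the two unit vectors \<open>u\<close> of \<open>P\<close> is chosen.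
\<close>

definition line_lebesgue :: "(real ^ 2) set \<Rightarrow> (real ^ 2) measure" where
  "line_lebesgue P =
     completion (distr lborel (restrict_space borel P) (\<lambda>s. s *\<^sub>R (SOME u. u \<in> P \<and> norm u = 1)))"


section \<open>Rauzy fractals\<close>

definition hausdorff_dist :: "'a::metric_space set \<Rightarrow> 'a set \<Rightarrow> real" where
  "hausdorff_dist A B = max (SUP x\<in>A. infdist x B) (SUP y\<in>B. infdist y A)"

definition hausdorff_lim :: "(nat \<Rightarrow> 'a::metric_space set) \<Rightarrow> 'a set" where
  "hausdorff_lim S = (THE K. compact K \<and> K \<noteq> {} \<and> (\<lambda>n. hausdorff_dist (S n) K) \<longlonglongrightarrow> 0)"

definition rauzy_limit :: "(word \<Rightarrow> word) \<Rightarrow> chain \<Rightarrow> (real ^ 2) set" where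
  "rauzy_limit \<rho> c = (let A = real_incidence_matrix \<rho> in
     hausdorff_lim (\<lambda>n. ((*v) A ^^ n) ` eigenprojection A ` geometric ((tiling_subst \<rho> ^^ n) c)))"

definition X_tau :: "family \<Rightarrow> int \<Rightarrow> 2 \<Rightarrow> (real ^ 2) set" where
  "X_tau t a i = rauzy_limit (tau t a) (frag_of (axis i 1, i))"

text \<open>The symbol attached to a letter: \<open>(e\<^sub>i, i\<^sup>*)\<close> for \<open>i\<close> and \<open>(0, i\<^sup>*)\<close> for \<open>i\<close> inverse.\<close>

definition base_symbol :: "letter \<Rightarrow> chain" where
  "base_symbol x = frag_of (if snd x then axis (fst x) 1 else 0, fst x)"

definition X_sigma_part :: "family \<Rightarrow> int \<Rightarrow> letter \<Rightarrow> (real ^ 2) set" where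
  "X_sigma_part t a x = rauzy_limit (sigma t a) (base_symbol x)"

definition X_sigma :: "family \<Rightarrow> int \<Rightarrow> (real ^ 2) set" where
  "X_sigma t a = rauzy_limit (sigma t a) (\<Sum>i\<in>UNIV. base_symbol (signed_letter t i))"

definition X_sigma_measure :: "family \<Rightarrow> int \<Rightarrow> (real ^ 2) measure" where
  "X_sigma_measure t a =
     restrict_space (line_lebesgue (contracting_line (real_incidence_matrix (sigma t a)))) (X_sigma t a)"

text \<open>
  The domain exchange is only determined almost everywhere: at a point lying in both pieces
  either of the two translations may be used.  The predicate describes all such versions.
\<close>

definition is_domain_exchange :: "family \<Rightarrow> int \<Rightarrow> (real ^ 2 \<Rightarrow> real ^ 2) \<Rightarrow> bool" where
  "is_domain_exchange t a T \<longleftrightarrow>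
     (\<forall>x \<in> (\<Union>i. X_sigma_part t a (signed_letter t i)).
        \<exists>i. x \<in> X_sigma_part t a (signed_letter t i) \<and>
            T x = x - eigenprojection (real_incidence_matrix (sigma t a))
                        (real_vec (abelianize [signed_letter t i])))"


section \<open>Induced structure\<close>

definition measurable_dynamical_system :: "'a measure \<Rightarrow> ('a \<Rightarrow> 'a) \<Rightarrow> bool" where
  "measurable_dynamical_system M T \<longleftrightarrow> T \<in> measurable M M \<and> distr M M T = M"

definition measurable_partition :: "'a measure \<Rightarrow> 'a set \<Rightarrow> 'i set \<Rightarrow> ('i \<Rightarrow> 'a set) \<Rightarrow> bool" where
  "measurable_partition M B I F \<longleftrightarrow>
     (\<forall>i\<in>I. F i \<in> sets M) \<and>
     (\<forall>i\<in>I. \<forall>j\<in>I. i \<noteq> j \<longrightarrow> F i \<inter> F j \<in> null_sets M) \<and>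
     B - (\<Union>i\<in>I. F i) \<in> null_sets M \<and> (\<Union>i\<in>I. F i) - B \<in> null_sets M"

text \<open>
  The phase space is \<open>space M\<close>, \<open>W\<close> is the two-letter alphabet of \<open>\<theta>\<close>, and the words are indexed
  from 0.  The set partitioned by the family \<open>A\<close> is its union.
\<close>

definition has_theta_structure ::
  "'a measure \<Rightarrow> ('a \<Rightarrow> 'a) \<Rightarrow> (2 \<Rightarrow> 'l list) \<Rightarrow> 'l set \<Rightarrow> ('l \<Rightarrow> 'a set) \<Rightarrow> (2 \<Rightarrow> 'a set) \<Rightarrow> bool" where
  "has_theta_structure M T \<theta> W XP A \<longleftrightarrow>
     measurable_dynamical_system M T \<and>
     (\<forall>i. set (\<theta> i) \<subseteq> W) \<and>
     measurable_partition M (space M) W XP \<and>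
     measurable_partition M (\<Union>i. A i) UNIV A \<and>
     (\<forall>i. \<forall>k < length (\<theta> i). (T ^^ k) ` A i - XP (\<theta> i ! k) \<in> null_sets M) \<and>
     (\<forall>i k. 0 < k \<and> k < length (\<theta> i) \<longrightarrow> (T ^^ k) ` A i \<inter> (\<Union>j. A j) \<in> null_sets M) \<and>
     (\<forall>i. (T ^^ length (\<theta> i)) ` A i - (\<Union>j. A j) \<in> null_sets M) \<and>
     space M - (\<Union>i. \<Union>k < length (\<theta> i). (T ^^ k) ` A i) \<in> null_sets M \<and>
     (\<forall>i j k l. k < length (\<theta> i) \<and> l < length (\<theta> j) \<and> (i, k) \<noteq> (j, l) \<longrightarrow>
        (T ^^ k) ` A i \<inter> (T ^^ l) ` A j \<in> null_sets M)"

definition sigma_has_structure ::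
  "family \<Rightarrow> int \<Rightarrow> (real ^ 2 \<Rightarrow> real ^ 2) \<Rightarrow> (word \<Rightarrow> word) \<Rightarrow> (2 \<Rightarrow> (real ^ 2) set) \<Rightarrow> bool" where
  "sigma_has_structure t a T \<theta> A \<longleftrightarrow>
     has_theta_structure (X_sigma_measure t a) T (\<lambda>i. \<theta> [pos i])
       (range (signed_letter t)) (X_sigma_part t a) A"

end

theory Submission
  imports Defs
begin

text \<open>
  In suitable coordinates on the contracting line all the fractals are intervals. A left eigenvector
  of \<open>A\<^sub>\<rho>\<close> turns the projection into a linear functional \<open>\<phi>\<close>. The tiling substitution maps a path of
  segments to a path whose end points move by an affine map, and a flux argument shows that the
  projected path covers the whole interval between the projected end points, cancellations
  notwithstanding. As the path also stays within bounded distance of that interval, the renormalised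
  limit is a translate of the original interval. So \<open>T\<^sub>\<sigma>\<close> is an exchange of two intervals.

  Inducing such an exchange on the complement of an end interval gives an exchange again, with
  structure \<open>i \<mapsto> i j, j \<mapsto> j\<close> or \<open>i \<mapsto> j i, j \<mapsto> j\<close>. The automorphisms \<open>\<delta>\<^sup>-\<^sup>1\<close>, \<open>\<tau>\<^sub>1\<close>, \<open>\<tau>\<^sub>2\<^sup>2\<close> and \<open>\<tau>\<^sub>4\<^sup>2\<close> are
  products of these elementary substitutions, and the corresponding inductions lead from the exchange
  on \<open>X\<^sub>\<sigma>\<close> to \<open>A\<^sub>\<delta>\<^sup>-\<^sup>1 X\<^sub>\<tau>\<close> and from there to its images under powers of \<open>A\<^sub>\<tau>\<close>.
\<close>

section \<open>Exchanges of two intervals\<close>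

text \<open>The structures are required only up to null sets, but inductions have to be composed
  arbitrarily often. All end points lie in the quadratic field of the contracting eigenvalue
  \<open>l\<close>, which is countable; off this field every inclusion is exact, so compositions
  need no bookkeeping, and null sets reappear only in the translation to
  \<open>has_theta_structure\<close>. On the geometric side covering and containment are separate:
  flux is additive, which gives covering, while containment may lose a constant because
  renormalisation multiplies it by \<open>l^n\<close>. For \<open>t = 2\<close> the dual of
  \<open>sigma\<close> overshoots the interval; the relation \<open>delta sigma = tau delta\<close>,
  dualised, moves the containment estimate to \<open>tau\<close>. End points drift under an affine
  map \<open>x -> (x + k) / l\<close>; after renormalisation the drift sums to
  \<open>k / (1 - l)\<close>, the source of the fractions in the cuts. Squares appear for
  \<open>t = 2, 4\<close> because the words of \<open>tau\<close> then consist of inverse letters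
  only, and a second application restores positive letters.\<close>

text \<open>
  The exact (no null sets) version of a \<open>\<theta>\<close>-structure; \<open>S\<close> is the map that \<open>T\<close> induces on the
  union of the \<open>A i\<close>.
\<close>

definition induces ::
  "('x \<Rightarrow> 'x) \<Rightarrow> ('l \<Rightarrow> 'x set) \<Rightarrow> ('i \<Rightarrow> 'l list) \<Rightarrow> ('x \<Rightarrow> 'x) \<Rightarrow> ('i \<Rightarrow> 'x set) \<Rightarrow> bool" where
  "induces T X \<theta> S A \<longleftrightarrow>
     (\<forall>i. A i \<subseteq> (\<Union>l. X l)) \<and>
     (\<forall>i. \<forall>x\<in>A i. (\<forall>k<length (\<theta> i). (T ^^ k) x \<in> X (\<theta> i ! k)) \<and>
        (\<forall>k. 0 < k \<and> k < length (\<theta> i) \<longrightarrow> (T ^^ k) x \<notin> (\<Union>j. A j)) \<and>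
        (T ^^ length (\<theta> i)) x = S x \<and> S x \<in> (\<Union>j. A j)) \<and>
     (\<forall>y\<in>(\<Union>l. X l). \<exists>i. \<exists>x\<in>A i. \<exists>k<length (\<theta> i). y = (T ^^ k) x)"

lemma inducesD:
  assumes "induces T X \<theta> S A"
  shows "A i \<subseteq> (\<Union>l. X l)"
    and "x \<in> A i \<Longrightarrow> k < length (\<theta> i) \<Longrightarrow> (T ^^ k) x \<in> X (\<theta> i ! k)"
    and "x \<in> A i \<Longrightarrow> 0 < k \<Longrightarrow> k < length (\<theta> i) \<Longrightarrow> (T ^^ k) x \<notin> (\<Union>j. A j)"
    and "x \<in> A i \<Longrightarrow> (T ^^ length (\<theta> i)) x = S x"
    and "x \<in> A i \<Longrightarrow> S x \<in> (\<Union>j. A j)"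
    and "y \<in> X l \<Longrightarrow> \<exists>i. \<exists>x\<in>A i. \<exists>k<length (\<theta> i). y = (T ^^ k) x"
proof -
  note * = assms[unfolded induces_def]
  show "A i \<subseteq> (\<Union>l. X l)" using * by simp
  show "x \<in> A i \<Longrightarrow> k < length (\<theta> i) \<Longrightarrow> (T ^^ k) x \<in> X (\<theta> i ! k)"
    and "x \<in> A i \<Longrightarrow> 0 < k \<Longrightarrow> k < length (\<theta> i) \<Longrightarrow> (T ^^ k) x \<notin> (\<Union>j. A j)"
    and "x \<in> A i \<Longrightarrow> (T ^^ length (\<theta> i)) x = S x"
    and "x \<in> A i \<Longrightarrow> S x \<in> (\<Union>j. A j)"
    using *[THEN conjunct2, THEN conjunct1] by auto
  show "y \<in> X l \<Longrightarrow> \<exists>i. \<exists>x\<in>A i. \<exists>k<length (\<theta> i). y = (T ^^ k) x"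
    using *[THEN conjunct2, THEN conjunct2] by blast
qed

text \<open>One \<open>S\<close>-step from \<open>A j\<close> spends \<open>length (theta j)\<close>
  steps of \<open>T\<close>, so an \<open>S\<close>-itinerary \<open>js\<close> unrolls into the
  concatenated word. A time \<open>k\<close> splits into a pair \<open>(p, r)\<close>, the number of
  completed returns and the time since the last one; the clause on \<open>0 < k\<close> excludes
  \<open>(0, 0)\<close> for proper intermediate times.\<close>

lemma induces_concat:
  assumes "induces T X \<theta> S A" and "\<And>p. p < length js \<Longrightarrow> (S ^^ p) x \<in> A (js ! p)"
  defines "w \<equiv> concat (map \<theta> js)"
  shows "(T ^^ length w) x = (S ^^ length js) x"
    and "k < length w \<Longrightarrow> \<exists>p<length js. \<exists>r<length (\<theta> (js ! p)).
      w ! k = \<theta> (js ! p) ! r \<and> (T ^^ k) x = (T ^^ r) ((S ^^ p) x) \<and> (0 < k \<longrightarrow> 0 < p \<or> 0 < r)"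
    and "p < length js \<Longrightarrow> r < length (\<theta> (js ! p)) \<Longrightarrow>
      \<exists>k<length w. (T ^^ k) x = (T ^^ r) ((S ^^ p) x)"
proof -
  have "(T ^^ length (concat (map \<theta> js))) x = (S ^^ length js) x \<and>
     (\<forall>k<length (concat (map \<theta> js)). \<exists>p<length js. \<exists>r<length (\<theta> (js ! p)).
      concat (map \<theta> js) ! k = \<theta> (js ! p) ! r \<and> (T ^^ k) x = (T ^^ r) ((S ^^ p) x) \<and> (0 < k \<longrightarrow> 0 < p \<or> 0 < r)) \<and>
     (\<forall>p<length js. \<forall>r<length (\<theta> (js ! p)).
      \<exists>k<length (concat (map \<theta> js)). (T ^^ k) x = (T ^^ r) ((S ^^ p) x))"
    using assms(2)
  proof (induction js arbitrary: x)
    case Nil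
    then show ?case by simp
  next
    case (Cons j js)
    define u where "u = concat (map \<theta> js)"
    have xj: "x \<in> A j" using Cons.prems[of 0] by simp
    have first: "(T ^^ length (\<theta> j)) x = S x"
      by (rule inducesD(4)[OF assms(1) xj])
    have split: "(T ^^ (length (\<theta> j) + k)) x = (T ^^ k) (S x)" for k
      using first by (metis add.commute comp_apply funpow_add)
    have "(S ^^ p) (S x) \<in> A (js ! p)" if "p < length js" for p
      using Cons.prems[of "Suc p"] that by (simp add: funpow_swap1)
    note IH = Cons.IH[OF this, folded u_def]
    have IH1: "(T ^^ length u) (S x) = (S ^^ length js) (S x)"
      and IH2: "\<And>k. k < length u \<Longrightarrow> \<exists>p<length js. \<exists>r<length (\<theta> (js ! p)).
        u ! k = \<theta> (js ! p) ! r \<and> (T ^^ k) (S x) = (T ^^ r) ((S ^^ p) (S x))"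
      and IH3: "\<And>p r. p < length js \<Longrightarrow> r < length (\<theta> (js ! p)) \<Longrightarrow>
        \<exists>k<length u. (T ^^ k) (S x) = (T ^^ r) ((S ^^ p) (S x))"
      using IH by blast+
    show ?case
    proof (intro conjI allI impI)
      show "(T ^^ length (concat (map \<theta> (j # js)))) x = (S ^^ length (j # js)) x"
        using IH1 by (simp add: split funpow_swap1 u_def)
    next
      fix k assume k: "k < length (concat (map \<theta> (j # js)))"
      show "\<exists>p<length (j # js). \<exists>r<length (\<theta> ((j # js) ! p)).
        concat (map \<theta> (j # js)) ! k = \<theta> ((j # js) ! p) ! r \<and>
        (T ^^ k) x = (T ^^ r) ((S ^^ p) x) \<and> (0 < k \<longrightarrow> 0 < p \<or> 0 < r)"
      proof (cases "k < length (\<theta> j)")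
        case True
        then show ?thesis
          by (intro exI[of _ 0] conjI exI[of _ k]) (auto simp: nth_append)
      next
        case False
        define m where "m = k - length (\<theta> j)"
        have km: "k = length (\<theta> j) + m" using False by (simp add: m_def)
        have "m < length u" using k km by (simp add: u_def)
        from IH2[OF this] obtain p r where "p < length js" "r < length (\<theta> (js ! p))"
          "u ! m = \<theta> (js ! p) ! r" "(T ^^ m) (S x) = (T ^^ r) ((S ^^ p) (S x))" by blast
        then show ?thesis
          using split[of m]
          by (intro exI[of _ "Suc p"] conjI exI[of _ r]) (auto simp: nth_append km u_def funpow_swap1)
      qed
    next
      fix p r assume p: "p < length (j # js)" and r: "r < length (\<theta> ((j # js) ! p))"
      show "\<exists>k<length (concat (map \<theta> (j # js))). (T ^^ k) x = (T ^^ r) ((S ^^ p) x)"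
      proof (cases p)
        case 0
        then show ?thesis using r by (intro exI[of _ r]) auto
      next
        case (Suc q)
        then obtain k where "k < length u" "(T ^^ k) (S x) = (T ^^ r) ((S ^^ q) (S x))"
          using IH3[of q r] p r by auto
        then show ?thesis
          using Suc split[of k]
          by (intro exI[of _ "length (\<theta> j) + k"]) (auto simp: u_def funpow_swap1)
      qed
    qed
  qed
  then show "(T ^^ length w) x = (S ^^ length js) x"
    and "k < length w \<Longrightarrow> \<exists>p<length js. \<exists>r<length (\<theta> (js ! p)).
      w ! k = \<theta> (js ! p) ! r \<and> (T ^^ k) x = (T ^^ r) ((S ^^ p) x) \<and> (0 < k \<longrightarrow> 0 < p \<or> 0 < r)"
    and "p < length js \<Longrightarrow> r < length (\<theta> (js ! p)) \<Longrightarrow>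
      \<exists>k<length w. (T ^^ k) x = (T ^^ r) ((S ^^ p) x)"
    unfolding w_def by blast+
qed

text \<open>Towers over towers: \<open>B\<close> lies inside the union of the \<open>A j\<close>, so
  the \<open>T\<close>-return to \<open>B\<close> is the \<open>S\<close>-return with every letter
  of \<open>eta\<close> expanded by \<open>theta\<close>. Disjointness of the \<open>A j\<close>
  makes the letter of a point unique, which the covering clause needs.\<close>

lemma induces_comp:
  assumes TA: "induces T X \<theta> S A" and SB: "induces S A \<eta> R B"
    and disj: "\<And>i j. i \<noteq> j \<Longrightarrow> A i \<inter> A j = {}"
  shows "induces T X (\<lambda>i. concat (map \<theta> (\<eta> i))) R B"
proof -
  have BA: "(\<Union>j. B j) \<subseteq> (\<Union>j. A j)" using inducesD(1)[OF SB] by blast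
  have AX: "(\<Union>j. A j) \<subseteq> (\<Union>j. X j)" using inducesD(1)[OF TA] by blast
  have js: "(S ^^ p) x \<in> A (\<eta> i ! p)" if "x \<in> B i" "p < length (\<eta> i)" for x i p
    using inducesD(2)[OF SB that] .
  note walk = induces_concat[OF TA js]
  have avoid: "(T ^^ r) z \<notin> (\<Union>j. A j)" if "z \<in> A l" "0 < r" "r < length (\<theta> l)" for z l r
    using inducesD(3)[OF TA that] .
  have SBavoid: "(S ^^ p) x \<notin> (\<Union>j. B j)" if "x \<in> B i" "0 < p" "p < length (\<eta> i)" for x i p
    using inducesD(3)[OF SB that] .
  have inX: "(T ^^ r) z \<in> X (\<theta> l ! r)" if "z \<in> A l" "r < length (\<theta> l)" for z l r
    using inducesD(2)[OF TA that] .
  show ?thesis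
    unfolding induces_def
  proof (intro conjI allI ballI impI)
    fix i show "B i \<subseteq> (\<Union>l. X l)" using BA AX by blast
  next
    fix i x k assume x: "x \<in> B i" and k: "k < length (concat (map \<theta> (\<eta> i)))"
    then show "(T ^^ k) x \<in> X (concat (map \<theta> (\<eta> i)) ! k)"
      using walk(2)[OF x _ k] js[OF x] inX by metis
  next
    fix i x k assume x: "x \<in> B i" and k: "0 < k \<and> k < length (concat (map \<theta> (\<eta> i)))"
    then obtain p r where pr: "p < length (\<eta> i)" "r < length (\<theta> (\<eta> i ! p))"
        "(T ^^ k) x = (T ^^ r) ((S ^^ p) x)" "0 < p \<or> 0 < r"
      using walk(2)[OF x, of k] by blast
    show "(T ^^ k) x \<notin> (\<Union>j. B j)"
    proof (cases "r = 0")
      \<comment> \<open>At a return time to the union of the \<open>A j\<close> the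
        \<open>S\<close>-structure keeps the point out of \<open>B\<close>; at any other time it is
        outside that union altogether.\<close>
      case True then show ?thesis using pr SBavoid[OF x] by auto
    next
      case False then show ?thesis using pr avoid[OF js[OF x pr(1)], of r] BA by auto
    qed
  next
    fix i x assume x: "x \<in> B i"
    show "(T ^^ length (concat (map \<theta> (\<eta> i)))) x = R x"
      using walk(1)[OF x] inducesD(4)[OF SB x] by simp
    show "R x \<in> (\<Union>j. B j)" by (rule inducesD(5)[OF SB x])
  next
    fix y assume "y \<in> (\<Union>l. X l)"
    then obtain j z r where z: "z \<in> A j" and r: "r < length (\<theta> j)" "y = (T ^^ r) z"
      using inducesD(6)[OF TA] by blast
    obtain i x p where x: "x \<in> B i" "p < length (\<eta> i)" "z = (S ^^ p) x"
      using inducesD(6)[OF SB z] by blast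
    have "j = \<eta> i ! p" using disj z js[OF x(1,2)] x(3) by blast
    then show "\<exists>i. \<exists>x\<in>B i. \<exists>k<length (concat (map \<theta> (\<eta> i))). y = (T ^^ k) x"
      using walk(3)[OF x(1) _ x(2), of r] r x by metis
  qed
qed

section \<open>Rauzy induction for exchanges of two intervals\<close>

definition flip :: "2 \<Rightarrow> 2" where "flip i = (if i = 1 then 2 else 1)"

lemma flip_simps [simp]: "flip 1 = 2" "flip 2 = 1"
  by (simp_all add: flip_def)

text \<open>
  The exchange of two adjacent intervals meeting in \<open>c\<close>, where interval \<open>i\<close> is translated by \<open>- v i\<close>
  and \<open>v 1\<close>, \<open>v 2\<close> have opposite signs: its length then is the modulus of the other translation,
  and the formulas are the same whichever interval lies on the left.
\<close>

definition piece :: "real \<Rightarrow> (2 \<Rightarrow> real) \<Rightarrow> 2 \<Rightarrow> real set" where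
  "piece c v i = closed_segment c (c - v (flip i))"

definition exchange :: "real \<Rightarrow> (2 \<Rightarrow> real) \<Rightarrow> real \<Rightarrow> real" where
  "exchange c v x = (if x \<in> piece c v 1 then x - v 1 else x - v 2)"

definition opposite :: "(2 \<Rightarrow> real) \<Rightarrow> bool" where
  "opposite v \<longleftrightarrow> v 1 < 0 \<and> 0 < v 2 \<or> v 2 < 0 \<and> 0 < v 1"

text \<open>Removing a shift-invariant set \<open>K\<close> that contains all end points makes every statement exact.\<close>

definition generic_piece :: "real set \<Rightarrow> real \<Rightarrow> (2 \<Rightarrow> real) \<Rightarrow> 2 \<Rightarrow> real set" where
  "generic_piece K c v i = piece c v i - K"

text \<open>The flag records which end is cut off in the corresponding induction: inserting after
  \<open>i\<close> removes the outer end of piece \<open>flip i\<close> and keeps the cut, inserting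
  before \<open>i\<close> removes piece \<open>i\<close> and moves the cut to
  \<open>c + v (flip i)\<close>.\<close>

definition inserting :: "bool \<Rightarrow> 2 \<Rightarrow> 2 \<Rightarrow> 2 list" where
  "inserting left i = (\<lambda>l. if l = i then (if left then [flip i, i] else [i, flip i]) else [l])"

definition subst_lists :: "(2 \<Rightarrow> 'l list) \<Rightarrow> (2 \<Rightarrow> 2 list) \<Rightarrow> 2 \<Rightarrow> 'l list" where
  "subst_lists \<theta> \<eta> i = concat (map \<theta> (\<eta> i))"

definition inserts :: "bool \<Rightarrow> nat \<Rightarrow> 2 \<Rightarrow> 2 \<Rightarrow> 2 list" where
  "inserts left m i = (\<lambda>l. if l = i then
     (if left then replicate m (flip i) @ [i] else i # replicate m (flip i)) else [l])"

lemma inserts_0: "inserts left 0 i = (\<lambda>l. [l])"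
  by (auto simp: inserts_def)

lemma inserts_Suc: "inserts left (Suc m) i = subst_lists (inserting left i) (inserts left m i)"
proof
  fix l
  have *: "concat (replicate m [flip i]) = replicate m (flip i)" by (induction m) auto
  have "flip i \<noteq> i" using exhaust_2[of i] by auto
  then show "inserts left (Suc m) i l = subst_lists (inserting left i) (inserts left m i) l"
    by (auto simp: inserts_def inserting_def subst_lists_def * replicate_append_same)
qed

text \<open>Bundles the side conditions, so that chains of inductions compose directly. Inclusion of
  the closed pieces is stated separately because \<open>induces\<close> only sees generic
  points.\<close>

definition exchange_induces ::
  "real set \<Rightarrow> real \<Rightarrow> (2 \<Rightarrow> real) \<Rightarrow> (2 \<Rightarrow> 2 list) \<Rightarrow> real \<Rightarrow> (2 \<Rightarrow> real) \<Rightarrow> bool" where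
  "exchange_induces K c v \<theta> c' v' \<longleftrightarrow>
     c \<in> K \<and> (\<forall>i. v i \<in> K) \<and> opposite v \<and> c' \<in> K \<and> (\<forall>i. v' i \<in> K) \<and> opposite v' \<and>
     (\<forall>i. piece c' v' i \<subseteq> piece c v 1 \<union> piece c v 2) \<and>
     induces (exchange c v) (generic_piece K c v) \<theta> (exchange c' v') (generic_piece K c' v')"

locale additive_set =
  fixes K :: "real set"
  assumes diff_mem: "x \<in> K \<Longrightarrow> y \<in> K \<Longrightarrow> x - y \<in> K"
begin

lemma add_mem: "x \<in> K \<Longrightarrow> y \<in> K \<Longrightarrow> x + y \<in> K"
  using diff_mem[of x "(x - x) - y"] diff_mem[of x x] diff_mem[of "x - x" y] by simp

lemma diff_mem_iff: "y \<in> K \<Longrightarrow> x - y \<in> K \<longleftrightarrow> x \<in> K"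
  using diff_mem[of x y] add_mem[of "x - y" y] by auto

lemma add_mem_iff: "y \<in> K \<Longrightarrow> x + y \<in> K \<longleftrightarrow> x \<in> K"
  using diff_mem[of "x + y" y] add_mem[of x y] by auto

lemma mem_generic_piece:
  assumes "c \<in> K" "\<And>i. v i \<in> K" 
  shows "x \<in> generic_piece K c v i \<longleftrightarrow>
     x \<notin> K \<and> (c - v (flip i) < x \<and> x < c \<or> c < x \<and> x < c - v (flip i))"
proof -
  have "c - v (flip i) \<in> K" using assms diff_mem by simp
  then show ?thesis
    using assms(1)
    by (auto simp: generic_piece_def piece_def closed_segment_eq_real_ivl less_le split: if_splits)
qed

lemma exchange_generic:
  assumes "c \<in> K" "\<And>i. v i \<in> K" "opposite v" "x \<in> generic_piece K c v i"
  shows "exchange c v x = x - v i"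
  using assms(4) exhaust_2[of i] assms(3) mem_generic_piece[OF assms(1,2)]
  unfolding exchange_def piece_def opposite_def
  by (auto simp: closed_segment_eq_real_ivl)

lemma generic_disjoint:
  assumes "c \<in> K" "\<And>i. v i \<in> K" "opposite v" "i \<noteq> j"
  shows "generic_piece K c v i \<inter> generic_piece K c v j = {}"
  using assms(3,4) exhaust_2[of i] exhaust_2[of j] mem_generic_piece[OF assms(1,2)]
  by (auto simp: opposite_def)

text \<open>One step of Rauzy induction. The signs of \<open>v'\<close> mean
  \<open>|v (flip i)| < |v i|\<close>, so piece \<open>flip i\<close> is the longer one. The removed
  part is the translate of the new piece \<open>i\<close> under one step of the exchange; hence
  points of the new piece \<open>i\<close> return after two steps and those of the other piece after
  one.\<close>

lemma induces_inserting:
  assumes c: "c \<in> K" and v: "\<And>i. v i \<in> K" and opp: "opposite v"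
    and v': "v' = v(i := v i + v (flip i))" and opp': "opposite v'"
    and c': "c' = (if left then c + v (flip i) else c)"
  shows "induces (exchange c v) (generic_piece K c v) (inserting left i)
           (exchange c' v') (generic_piece K c' v')"
proof -
  have v'K: "\<And>i. v' i \<in> K" and c'K: "c' \<in> K" using v c by (auto simp: v' c' intro: add_mem)
  note memv = mem_generic_piece[of c v, OF c v]
  note memv' = mem_generic_piece[of c' v', OF c'K v'K]
  note ev = exchange_generic[of c v, OF c v opp]
  note ev' = exchange_generic[of c' v', OF c'K v'K opp']
  define j where "j = flip i"
  have ij: "i \<noteq> j" "flip j = i" "l = i \<or> l = j" for l
    using exhaust_2[of i] exhaust_2[of l] unfolding j_def by auto
  have ijdef: "flip i = j" by (simp add: j_def)
  have U: "(\<Union>l. F l) = F i \<union> F j" for F :: "2 \<Rightarrow> real set"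
  proof -
    have "UNIV = {i, j}" using ij(3) by auto
    then show ?thesis by auto
  qed
  have sgn: "v i < 0 \<and> 0 < v j \<or> v j < 0 \<and> 0 < v i"
    using opp exhaust_2[of i] by (auto simp: opposite_def j_def)
  have sgn': "v i + v j < 0 \<and> 0 < v j \<or> v j < 0 \<and> 0 < v i + v j"
    using opp' exhaust_2[of i] by (auto simp: opposite_def j_def v')
  have v's: "v' i = v i + v j" "v' j = v j" using ij by (simp_all add: v' j_def)
  note m = memv[of _ i, unfolded ijdef] memv[of _ j, unfolded ij(2)]
  note m' = memv'[of _ i, unfolded ijdef v's] memv'[of _ j, unfolded ij(2) v's]
  note shift = diff_mem_iff[OF v] add_mem_iff[OF v]
  let ?G = "generic_piece K c v" and ?A = "generic_piece K c' v'"
  let ?T = "exchange c v" and ?S = "exchange c' v'"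
  \<comment> \<open>Both flags reduce to five facts: the itinerary of the new piece
    \<open>i\<close>, the inclusion of the new piece \<open>j\<close>, covering, and the two return
    inclusions. The first displacement is \<open>v i\<close> or \<open>v j\<close>, but the total is
    the same.\<close>
  have fin: ?thesis
    if w: "w = (if left then [j, i] else [i, j])"
      and 1: "\<And>x. x \<in> ?A i \<Longrightarrow> x \<in> ?G (w ! 0) \<and> ?T x \<in> ?G (w ! 1) \<and> ?T x \<notin> ?A i \<union> ?A j"
      and 2: "\<And>x. x \<in> ?A j \<Longrightarrow> x \<in> ?G j"
      and 3: "\<And>l y. y \<in> ?G l \<Longrightarrow> y \<in> ?A i \<or> y \<in> ?A j \<or> (\<exists>x\<in>?A i. y = ?T x)"
      and 4: "\<And>x. x \<in> ?A i \<Longrightarrow> x - (v i + v j) \<in> ?A i \<union> ?A j"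
      and 5: "\<And>x. x \<in> ?A j \<Longrightarrow> x - v j \<in> ?A i \<union> ?A j" for w
  proof -
    have word: "inserting left i i = w" "inserting left i j = [j]"
      using ij by (auto simp: inserting_def w j_def)
    have len: "length w = 2" and nth: "{w ! 0, w ! 1} = {i, j}" by (auto simp: w)
    have vv: "v (w ! 0) + v (w ! 1) = v i + v j" by (auto simp: w)
    have S1: "?T (?T x) = ?S x" "?S x \<in> ?A i \<union> ?A j" if "x \<in> ?A i" for x
    proof -
      have "?T (?T x) = x - (v (w ! 0) + v (w ! 1))"
        using ev[of x "w ! 0"] ev[of "?T x" "w ! 1"] 1[OF that] by simp
      moreover have "?S x = x - (v i + v j)" using ev'[OF that] v's by simp
      ultimately show "?T (?T x) = ?S x" "?S x \<in> ?A i \<union> ?A j" using 4[OF that] vv by simp_all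
    qed
    have S2: "?T x = ?S x" "?S x \<in> ?A i \<union> ?A j" if "x \<in> ?A j" for x
      using ev[OF 2[OF that]] 5[OF that] ev'[OF that] v's by auto
    have "?A l \<subseteq> (\<Union>l. ?G l)" for l
      using ij(3)[of l] 1 2 by blast
    moreover have "(\<forall>k<length (inserting left i l). (?T ^^ k) x \<in> ?G (inserting left i l ! k)) \<and>
        (\<forall>k. 0 < k \<and> k < length (inserting left i l) \<longrightarrow> (?T ^^ k) x \<notin> (\<Union>j. ?A j)) \<and>
        (?T ^^ length (inserting left i l)) x = ?S x \<and> ?S x \<in> (\<Union>j. ?A j)"
      if x: "x \<in> ?A l" for x l
    proof (cases "l = i")
      case True
      then show ?thesis using 1[of x] S1[of x] x
        unfolding U by (auto simp: word len less_2_cases_iff numeral_2_eq_2 less_Suc_eq)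
    next
      case False
      then have "l = j" using ij(3) by auto
      then show ?thesis using 2[of x] S2[of x] x unfolding U by (auto simp: word)
    qed
    moreover have "\<exists>l. \<exists>x\<in>?A l. \<exists>k<length (inserting left i l). y = (?T ^^ k) x" if "y \<in> ?G l" for y l
      using 3[OF that]
    proof (elim disjE bexE)
      fix x assume "x \<in> ?A i" "y = ?T x"
      then show ?thesis by (intro exI[of _ i] bexI[of _ x] exI[of _ 1]) (auto simp: word len)
    next
      assume "y \<in> ?A i"
      then show ?thesis by (intro exI[of _ i] bexI[of _ y] exI[of _ 0]) (auto simp: word len)
    next
      assume "y \<in> ?A j"
      then show ?thesis by (intro exI[of _ j] bexI[of _ y] exI[of _ 0]) (auto simp: word)
    qed
    ultimately show ?thesis unfolding induces_def by blast
  qed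
  show ?thesis
  proof (cases left)
    case False
    have c'c: "c' = c" using False c' by simp
    note mm = m m'[unfolded c'c]
    show ?thesis
    proof (rule fin[OF refl], unfold c'c)
      fix x assume x: "x \<in> generic_piece K c v' i"
      have "x \<in> ?G i" using x by (auto simp: mm)
      moreover from ev[OF this] have Tx: "?T x = x - v i" .
      moreover have "x - v i \<in> ?G j" using x sgn sgn' by (auto simp: mm shift)
      moreover have "x - v i \<notin> generic_piece K c v' i \<union> generic_piece K c v' j"
        using x sgn sgn' by (auto simp: mm shift)
      ultimately show "x \<in> ?G ((if left then [j, i] else [i, j]) ! 0) \<and>
         ?T x \<in> ?G ((if left then [j, i] else [i, j]) ! 1) \<and>
         ?T x \<notin> generic_piece K c v' i \<union> generic_piece K c v' j"
        using False by simp
    next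
      fix x assume "x \<in> generic_piece K c v' j"
      then show "x \<in> ?G j" using sgn sgn' by (auto simp: mm)
    next
      fix x assume x: "x \<in> generic_piece K c v' i"
      \<comment> \<open>Only the cut could spoil a strict inequality, and it lies in
        \<open>K\<close>, unlike the image of a generic point.\<close>
      have "x - (v i + v j) \<noteq> c"
        using x c add_mem[OF c add_mem[OF v v], of i j] by (auto simp: mm algebra_simps)
      moreover have "x - (v i + v j) \<notin> K"
        using x diff_mem_iff[OF add_mem[OF v v], of x i j] by (simp add: mm)
      ultimately show "x - (v i + v j) \<in> generic_piece K c v' i \<union> generic_piece K c v' j"
        using x sgn sgn' unfolding Un_iff mm by linarith
    next
      fix x assume x: "x \<in> generic_piece K c v' j"
      have "x - v j \<noteq> c" using x c add_mem[of c "v j"] v by (auto simp: mm algebra_simps)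
      moreover have "x - v j \<notin> K" using x by (simp add: mm shift)
      ultimately show "x - v j \<in> generic_piece K c v' i \<union> generic_piece K c v' j"
        using x sgn sgn' unfolding Un_iff mm by linarith
    next
      fix l y assume y: "y \<in> ?G l"
      show "y \<in> generic_piece K c v' i \<or> y \<in> generic_piece K c v' j \<or>
        (\<exists>x\<in>generic_piece K c v' i. y = ?T x)"
      proof (cases "l = i \<or> y \<in> generic_piece K c v' j")
        case True then show ?thesis using y by (auto simp: mm)
      next
        \<comment> \<open>Now \<open>y\<close> lies in the removed outer end of piece
          \<open>j\<close>, which one step reaches from the new piece \<open>i\<close>.\<close>
        case l: False
        then have yj: "y \<in> ?G j" using y ij(3) by metis
        have "y \<noteq> c - (v i + v j)" using yj v c by (auto simp: mm diff_mem add_mem)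
        moreover have "y + v i \<notin> K" using yj by (simp add: mm shift)
        ultimately have *: "y + v i \<in> generic_piece K c v' i"
          using yj l sgn sgn' unfolding mm by linarith
        then have "y + v i \<in> ?G i" by (simp add: mm)
        from ev[OF this] * show ?thesis by force
      qed
    qed
  next
    case True
    have c'c: "c' = c + v j" using True c' by (simp add: j_def)
    note mm = m m'[unfolded c'c]
    have cj: "c + v j \<in> K" using c v by (rule add_mem)
    show ?thesis
    proof (rule fin[OF refl], unfold c'c)
      fix x assume x: "x \<in> generic_piece K (c + v j) v' i"
      have "x \<in> ?G j" using x sgn sgn' by (auto simp: mm)
      moreover from ev[OF this] have Tx: "?T x = x - v j" .
      moreover have "x - v j \<in> ?G i" using x sgn sgn' by (auto simp: mm shift)
      moreover have "x - v j \<notin> generic_piece K (c + v j) v' i \<union> generic_piece K (c + v j) v' j"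
        using x sgn sgn' by (auto simp: mm shift)
      ultimately show "x \<in> ?G ((if left then [j, i] else [i, j]) ! 0) \<and>
         ?T x \<in> ?G ((if left then [j, i] else [i, j]) ! 1) \<and>
         ?T x \<notin> generic_piece K (c + v j) v' i \<union> generic_piece K (c + v j) v' j"
        using True by simp
    next
      fix x assume "x \<in> generic_piece K (c + v j) v' j"
      then show "x \<in> ?G j" using sgn sgn' by (auto simp: mm)
    next
      fix x assume x: "x \<in> generic_piece K (c + v j) v' i"
      have "x - (v i + v j) \<noteq> c + v j"
        using x add_mem[OF cj add_mem[OF v v], of i j] by (auto simp: mm algebra_simps)
      moreover have "x - (v i + v j) \<notin> K"
        using x diff_mem_iff[OF add_mem[OF v v], of x i j] by (simp add: mm)
      ultimately show "x - (v i + v j) \<in> generic_piece K (c + v j) v' i \<union> generic_piece K (c + v j) v' j"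
        using x sgn sgn' unfolding Un_iff mm by linarith
    next
      fix x assume x: "x \<in> generic_piece K (c + v j) v' j"
      have "x - v j \<noteq> c + v j" using x add_mem[OF cj v, of j] by (auto simp: mm algebra_simps)
      moreover have "x - v j \<notin> K" using x by (simp add: mm shift)
      ultimately show "x - v j \<in> generic_piece K (c + v j) v' i \<union> generic_piece K (c + v j) v' j"
        using x sgn sgn' unfolding Un_iff mm by linarith
    next
      fix l y assume y: "y \<in> ?G l"
      show "y \<in> generic_piece K (c + v j) v' i \<or> y \<in> generic_piece K (c + v j) v' j \<or>
        (\<exists>x\<in>generic_piece K (c + v j) v' i. y = ?T x)"
      proof (cases "l = j")
        case True
        with y have "y \<in> ?G j" by simp
        moreover from this have "y \<noteq> c + v j" using cj by (auto simp: mm)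
        ultimately have "y \<in> generic_piece K (c + v j) v' i \<or> y \<in> generic_piece K (c + v j) v' j"
          using sgn sgn' unfolding mm by linarith
        then show ?thesis by blast
      next
        \<comment> \<open>Here the removed part is the whole old piece \<open>i\<close>; its points
          come from the new piece \<open>i\<close> by the translation \<open>- v j\<close>.\<close>
        case l: False
        then have yi: "y \<in> ?G i" using y ij(3) by metis
        moreover have "y + v j \<notin> K" using yi by (simp add: mm shift)
        ultimately have *: "y + v j \<in> generic_piece K (c + v j) v' i"
          using sgn sgn' unfolding mm by linarith
        then have "y + v j \<in> ?G j" using sgn sgn' by (auto simp: mm)
        from ev[OF this] * show ?thesis by force
      qed
    qed
  qed
qed

lemma exchange_induces_comp:
  assumes "exchange_induces K c v \<theta> c' v'" "exchange_induces K c' v' \<eta> c'' v''"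
  shows "exchange_induces K c v (subst_lists \<theta> \<eta>) c'' v''"
  using assms induces_comp[of "exchange c v" "generic_piece K c v" \<theta> "exchange c' v'" "generic_piece K c' v'"
      \<eta> "exchange c'' v''" "generic_piece K c'' v''"] generic_disjoint[of c' v']
  unfolding exchange_induces_def subst_lists_def[abs_def] by (simp add: subset_eq) blast

text \<open>The content is that an exchange maps generic points to generic points: the translated
  pieces tile the same interval, and translations by elements of \<open>K\<close> preserve the
  complement of \<open>K\<close>.\<close>

lemma exchange_induces_id:
  assumes "c \<in> K" "\<And>i. v i \<in> K" "opposite v"
  shows "exchange_induces K c v (\<lambda>i. [i]) c v"
proof -
  have *: "x - v i \<in> (\<Union>l. generic_piece K c v l)" if x: "x \<in> generic_piece K c v i" for x i
  proof -
    have "x - v i \<notin> K" "x - v i \<noteq> c"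
      using x assms(1,2) add_mem[of c "v i"]
      by (auto simp: generic_piece_def diff_mem_iff algebra_simps)
    then have "x - v i \<in> generic_piece K c v 1 \<or> x - v i \<in> generic_piece K c v 2"
      using x assms(3) exhaust_2[of i] unfolding mem_generic_piece[OF assms(1,2)] opposite_def
      by (elim disjE) (simp_all, linarith+)
    then show ?thesis by blast
  qed
  have "piece c v i \<subseteq> piece c v 1 \<union> piece c v 2" for i
    using exhaust_2[of i] by auto
  moreover have "induces (exchange c v) (generic_piece K c v) (\<lambda>i. [i]) (exchange c v) (generic_piece K c v)"
    using * exchange_generic[OF assms] unfolding induces_def by (auto 0 3)
  ultimately show ?thesis
    using assms unfolding exchange_induces_def by simp
qed

lemma piece_inserting_subset:
  assumes "opposite v" "v' = v(i := v i + v (flip i))" "opposite v'" "c' = (if left then c + v (flip i) else c)"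
  shows "piece c' v' k \<subseteq> piece c v 1 \<union> piece c v 2"
proof -
  have "i = 1 \<or> i = 2" "k = 1 \<or> k = 2" using exhaust_2 by auto
  then show ?thesis
    using assms(1,3) unfolding assms(2,4)
    by (elim disjE; cases left) (auto simp: opposite_def piece_def closed_segment_eq_real_ivl)
qed

lemma exchange_induces_inserting:
  assumes "c \<in> K" "\<And>i. v i \<in> K" "opposite v"
    and "v' = v(i := v i + v (flip i))" "opposite v'" "c' = (if left then c + v (flip i) else c)"
  shows "exchange_induces K c v (inserting left i) c' v'"
proof -
  have "c' \<in> K" "\<And>j. v' j \<in> K" using assms(1,2) by (auto simp: assms(4,6) intro: add_mem)
  then show ?thesis
    using induces_inserting[OF assms] assms(1-3,5) piece_inserting_subset[OF assms(3-6)]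
    unfolding exchange_induces_def by simp
qed

text \<open>A run of \<open>m\<close> equal steps, the analogue of a partial quotient of a continued
  fraction. The sign condition has to be known only at both ends of the run.\<close>

lemma exchange_induces_inserts:
  assumes "c \<in> K" "\<And>i. v i \<in> K" "opposite v"
    and "v' = v(i := v i + real m * v (flip i))" "opposite v'"
    and "c' = (if left then c + real m * v (flip i) else c)"
  shows "exchange_induces K c v (inserts left m i) c' v'"
  using assms
proof (induction m arbitrary: c v)
  case 0
  then show ?case using exchange_induces_id[of c v] by (simp add: inserts_0)
next
  case (Suc m)
  define v1 c1 where "v1 = v(i := v i + v (flip i))" and "c1 = (if left then c + v (flip i) else c)"
  have ne: "flip i \<noteq> i" using exhaust_2[of i] by auto
  \<comment> \<open>The remaining change \<open>d\<close> has the sign of \<open>v (flip i)\<close>,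
    and \<open>v' i\<close> still has the other sign after it; hence so has the intermediate
    value.\<close>
  have opp1: "opposite v1"
  proof -
    define d where "d = real m * v (flip i)"
    have "0 \<le> d" if "0 < v (flip i)" using that by (simp add: d_def)
    moreover have "d \<le> 0" if "v (flip i) < 0" using that by (simp add: d_def mult_nonneg_nonpos)
    moreover have "v' i = v i + v (flip i) + d" by (simp add: Suc.prems(4) d_def algebra_simps)
    moreover have "v' (flip i) = v (flip i)" using ne by (simp add: Suc.prems(4))
    ultimately show ?thesis using Suc.prems(3,5) exhaust_2[of i]
      by (elim disjE) (auto simp: opposite_def v1_def)
  qed
  have K1: "c1 \<in> K" "\<And>i. v1 i \<in> K" using Suc.prems(1,2) by (auto simp: c1_def v1_def add_mem)
  have first: "exchange_induces K c v (inserting left i) c1 v1"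
    using Suc.prems(1-3) opp1 by (intro exchange_induces_inserting) (auto simp: v1_def c1_def)
  moreover have "exchange_induces K c1 v1 (inserts left m i) c' v'"
    using ne by (intro Suc.IH K1 opp1 Suc.prems(5)) (auto simp: Suc.prems v1_def c1_def algebra_simps)
  ultimately show ?case unfolding inserts_Suc by (rule exchange_induces_comp)
qed

end

text \<open>The characteristic equation common to \<open>A_sigma\<close> and \<open>A_tau\<close>,
  with determinant \<open>1\<close> for \<open>T1\<close>, \<open>T2\<close> and \<open>-1\<close>
  for \<open>T4\<close>. The bounds single out the eigenvalue of modulus below \<open>1\<close> and
  fix its sign, on which the later sign arguments depend.\<close>

fun contracting_root :: "family \<Rightarrow> int \<Rightarrow> real \<Rightarrow> bool" where
  "contracting_root T1 a l \<longleftrightarrow> l * l = a * l - 1 \<and> 0 < l \<and> l < 1"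
| "contracting_root T2 a l \<longleftrightarrow> l * l = a * l - 1 \<and> - 1 < l \<and> l < 0"
| "contracting_root T4 a l \<longleftrightarrow> l * l = a * l + 1 \<and> 0 < l \<and> l < 1"

text \<open>The field \<open>\<rat>(l)\<close>, which is countable and contains all end points that occur.\<close>

definition root_span :: "real \<Rightarrow> real set" where
  "root_span l = {p + q * l | p q. p \<in> \<rat> \<and> q \<in> \<rat>}"

lemma countable_root_span: "countable (root_span l)"
proof -
  have "root_span l = (\<lambda>(p, q). p + q * l) ` (\<rat> \<times> \<rat>)"
    by (auto simp: root_span_def)
  then show ?thesis using countable_rat by auto
qed

lemma rat_mem_root_span: "p \<in> \<rat> \<Longrightarrow> p \<in> root_span l"
  unfolding root_span_def by (force intro: exI[of _ p] exI[of _ 0])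

lemma root_mem_root_span: "l \<in> root_span l"
  unfolding root_span_def by (force intro: exI[of _ 0] exI[of _ 1])

lemma additive_root_span: "additive_set (root_span l)"
proof
  fix x y assume "x \<in> root_span l" "y \<in> root_span l"
  then obtain p q p' q' where "x = p + q * l" "y = p' + q' * l" "p \<in> \<rat>" "q \<in> \<rat>" "p' \<in> \<rat>" "q' \<in> \<rat>"
    by (auto simp: root_span_def)
  then show "x - y \<in> root_span l"
    unfolding root_span_def by (intro CollectI exI[of _ "p - p'"] exI[of _ "q - q'"]) (auto simp: algebra_simps)
qed

lemma mult_mem_root_span:
  assumes "contracting_root t a l" "x \<in> root_span l" "y \<in> root_span l"
  shows "x * y \<in> root_span l"
proof -
  obtain e :: real where e: "e \<in> \<rat>" "l * l = a * l + e"
    using assms(1) by (cases t) (auto intro: that[of "-1"] that[of 1])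
  obtain p q p' q' where *: "x = p + q * l" "y = p' + q' * l" "p \<in> \<rat>" "q \<in> \<rat>" "p' \<in> \<rat>" "q' \<in> \<rat>"
    using assms(2,3) by (auto simp: root_span_def)
  have "x * y = p * p' + (p * q' + q * p') * l + q * q' * (l * l)"
    by (simp add: * algebra_simps)
  also have "\<dots> = (p * p' + q * q' * e) + (p * q' + q * p' + q * q' * a) * l"
    unfolding e by (simp add: algebra_simps)
  finally show ?thesis unfolding root_span_def using *(3-6) e(1)
    by (intro CollectI exI[of _ "p * p' + q * q' * e"] exI[of _ "p * q' + q * p' + q * q' * a"]) simp
qed

lemma contracting_root_norm: "contracting_root t a l \<Longrightarrow> l \<noteq> 0 \<and> \<bar>l\<bar> < 1"
  by (cases t) auto

section \<open>Translations, cuts and words of the successive exchanges\<close>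

fun sigma_steps :: "family \<Rightarrow> real \<Rightarrow> 2 \<Rightarrow> real" where
  "sigma_steps T1 l = (\<lambda>i. if i = 1 then - 1 else l)"
| "sigma_steps T2 l = (\<lambda>i. if i = 1 then 1 else l)"
| "sigma_steps T4 l = (\<lambda>i. if i = 1 then - 1 else l)"

text \<open>A left eigenvector of \<open>A_tau\<close> for \<open>l\<close>: the left eigenvector
  \<open>(1, l)\<close> of \<open>A_sigma\<close> composed with the inverse of
  \<open>A_delta\<close>. In contrast, \<open>sigma_steps\<close> evaluates \<open>(1, l)\<close> on
  the signed letters.\<close>

fun tau_steps :: "family \<Rightarrow> real \<Rightarrow> 2 \<Rightarrow> real" where
  "tau_steps T1 l = (\<lambda>i. if i = 1 then l - 1 else l)"
| "tau_steps T2 l = (\<lambda>i. if i = 1 then l + 1 else l)"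
| "tau_steps T4 l = (\<lambda>i. if i = 1 then - 1 else l)"

text \<open>The coordinate of the vertex shared by the two initial segments (\<open>e2\<close> for
  \<open>T1\<close> and \<open>T4\<close>, \<open>e1 + e2\<close> for \<open>T2\<close>) plus the
  drift \<open>k / (1 - l)\<close>; for \<open>T4\<close> the sum simplifies to \<open>-1\<close>.
  In \<open>tau_cut\<close> the shared vertex is \<open>e1 + e2\<close> throughout.\<close>

fun sigma_cut :: "family \<Rightarrow> real \<Rightarrow> real" where
  "sigma_cut T1 l = l + (2 * l - 1) / (1 - l)"
| "sigma_cut T2 l = 1 + l + l * l / (1 - l)"
| "sigma_cut T4 l = - 1"

fun tau_cut :: "family \<Rightarrow> real \<Rightarrow> real" where
  "tau_cut T1 l = 2 * l - 1 + l * l / (1 - l)"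
| "tau_cut T2 l = 1 + 2 * l + l * l / (1 - l)"
| "tau_cut T4 l = - 1"

fun delta_list :: "family \<Rightarrow> 2 \<Rightarrow> 2 list" where
  "delta_list T1 = inserts False 1 1"
| "delta_list T2 = inserts True 1 1"
| "delta_list T4 = (\<lambda>i. [i])"

text \<open>For \<open>T2\<close> and \<open>T4\<close> the words of \<open>tau\<close> contain
  inverse letters only, so it is the even powers that have words in positive letters.\<close>

fun tau_period :: "family \<Rightarrow> nat" where
  "tau_period T1 = 1" | "tau_period T2 = 2" | "tau_period T4 = 2"

text \<open>A factorisation of \<open>tau\<close>, or of its square, into elementary substitutions:
  the outermost factor of \<open>subst_lists\<close> is the induction step performed first.
  Agreement with the words in the free group is \<open>tau_list_word\<close>.\<close>

fun tau_list :: "family \<Rightarrow> int \<Rightarrow> 2 \<Rightarrow> 2 list" where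
  "tau_list T1 a = subst_lists (inserts False 1 1) (subst_lists (inserts True (nat (a - 3)) 1) (inserts False 1 2))"
| "tau_list T2 a = subst_lists (inserts True (nat (- a - 2)) 1) (subst_lists (inserts False 1 2)
     (subst_lists (inserts False (nat (- a - 2)) 1) (inserts True 1 2)))"
| "tau_list T4 a = subst_lists (inserts True (nat (- a)) 1) (inserts False (nat (- a)) 2)"

lemma opposite_scale: "s \<noteq> 0 \<Longrightarrow> x * y < 0 \<Longrightarrow> opposite (\<lambda>i. s * (if i = 1 then x else y))"
  by (cases "s > 0") (auto simp: opposite_def mult_less_0_iff zero_less_mult_iff)

context
  fixes t :: family and a :: int and l :: real
  assumes adm: "admissible t a" and root: "contracting_root t a l"
begin

interpretation additive_set "root_span l" by (rule additive_root_span)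

lemma inverse_one_minus_root: "1 / (1 - l) \<in> root_span l"
proof -
  obtain e :: real where e: "e \<in> \<rat>" "l * l = a * l + e" "1 - a - e \<noteq> 0"
  proof (cases t)
    case T1 then show ?thesis using that[of "-1"] adm root by auto
  next
    case T2 then show ?thesis using that[of "-1"] adm root by auto
  next
    case T4
    have "a \<noteq> 0" using adm T4 by auto
    then show ?thesis using that[of 1] T4 root by auto
  qed
  have "l \<noteq> 1" using contracting_root_norm[OF root] by auto
  \<comment> \<open>Here \<open>1 + l - a\<close> is \<open>1\<close> minus the conjugate root
    \<open>a - l\<close>, so the product is the norm of \<open>1 - l\<close>.\<close>
  have "(1 - l) * (1 + l - a) = 1 - a - e" using e(2) by (simp add: algebra_simps)
  then have "1 / (1 - l) = (1 + l - a) / (1 - a - e)"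
    using \<open>l \<noteq> 1\<close> e(3) by (simp add: frac_eq_eq mult.commute)
  then have "1 / (1 - l) = (1 - a) / (1 - a - e) + 1 / (1 - a - e) * l"
    by (simp add: add_divide_distrib[symmetric] algebra_simps)
  moreover have "(1 - a) / (1 - a - e) \<in> \<rat>" "1 / (1 - a - e) \<in> \<rat>" using e(1) by auto
  ultimately show ?thesis unfolding root_span_def by blast
qed

lemma cuts_mem_root_span: "sigma_cut t l \<in> root_span l" "tau_cut t l \<in> root_span l"
proof -
  have *: "x / (1 - l) \<in> root_span l" if "x \<in> root_span l" for x
    using mult_mem_root_span[OF root that inverse_one_minus_root] by simp
  have num: "1 \<in> root_span l" "2 \<in> root_span l" "- 1 \<in> root_span l"
    by (auto intro: rat_mem_root_span)
  note mem = add_mem diff_mem mult_mem_root_span[OF root] root_mem_root_span * num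
  show "sigma_cut t l \<in> root_span l" by (cases t; simp only: sigma_cut.simps; intro mem)
  show "tau_cut t l \<in> root_span l" by (cases t; simp only: tau_cut.simps; intro mem)
qed

text \<open>For \<open>T1\<close> and \<open>T2\<close> this is a single elementary step. For
  \<open>T4\<close> nothing is induced: \<open>delta\<close> only inverts the letter
  \<open>1\<close>, which \<open>signed_letter\<close> already accounts for.\<close>

lemma exchange_induces_delta:
  "exchange_induces (root_span l) (sigma_cut t l) (sigma_steps t l) (delta_list t) (tau_cut t l) (tau_steps t l)"
proof -
  have l1: "1 - l \<noteq> 0" "1 - l > 0" using contracting_root_norm[OF root] by auto
  have K: "sigma_steps t l i \<in> root_span l" for i
    by (cases t) (auto intro!: rat_mem_root_span root_mem_root_span)
  note ins = exchange_induces_inserts[where m = 1, OF cuts_mem_root_span(1) K]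
  show ?thesis
  proof (cases t)
    case T1
    then have "0 < l" "l < 1" using root by auto
    moreover have "tau_cut T1 l = sigma_cut T1 l" using l1 by (simp add: field_simps)
    ultimately show ?thesis
      using ins[where v' = "tau_steps t l" and i = 1 and c' = "tau_cut t l" and left = False] T1
      by (auto simp: opposite_def fun_eq_iff forall_2)
  next
    case T2
    then have "l < 0" "-1 < l" using root by auto
    then show ?thesis
      using ins[where v' = "tau_steps t l" and i = 1 and c' = "tau_cut t l" and left = True] T2
      by (auto simp: opposite_def fun_eq_iff forall_2)
  next
    case T4
    then have "0 < l" using root by auto
    then show ?thesis
      using exchange_induces_id[OF cuts_mem_root_span(1) K] T4
      by (auto simp: opposite_def)
  qed
qed

text \<open>Self-similarity: after the factors of \<open>tau_list\<close> the exchange is the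
  original one scaled by \<open>l ^ tau_period t\<close>. The free factor \<open>s\<close> lets the
  argument be repeated at every scale.\<close>

lemma exchange_induces_tau:
  assumes s: "s \<noteq> 0" "s \<in> root_span l"
  shows "exchange_induces (root_span l) (s * tau_cut t l) (\<lambda>i. s * tau_steps t l i) (tau_list t a)
    (s * l ^ tau_period t * tau_cut t l) (\<lambda>i. s * l ^ tau_period t * tau_steps t l i)"
proof -
  have l1: "1 - l \<noteq> 0" "1 - l > 0" using contracting_root_norm[OF root] by auto
  define v where "v x y = (\<lambda>i. s * (if i = (1::2) then x else y))" for x y
  have v_eq: "(\<lambda>i. r * (if i = (1::2) then x else y)) = v x' y'"
    if "r * x = s * x'" "r * y = s * y'" for r x y x' y'
    using that by (auto simp: v_def)
  have step: "exchange_induces (root_span l) (s * c) (v x y) (inserts left m i) (s * c') (v x' y')"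
    if "c \<in> root_span l" "x \<in> root_span l" "y \<in> root_span l" "x * y < 0" "x' * y' < 0"
      "i = 1 \<and> x' = x + real m * y \<and> y' = y \<and> c' = (if left then c + real m * y else c) \<or>
       i = 2 \<and> x' = x \<and> y' = y + real m * x \<and> c' = (if left then c + real m * x else c)"
    for c x y x' y' c' i left m
  proof (rule exchange_induces_inserts)
    show "s * c \<in> root_span l" "v x y j \<in> root_span l" for j
      using that s mult_mem_root_span[OF root] by (auto simp: v_def)
    show "opposite (v x y)" "opposite (v x' y')"
      unfolding v_def using that s by (auto intro!: opposite_scale)
    show "v x' y' = (v x y)(i := v x y i + real m * v x y (flip i))"
      using that(6) by (auto simp: v_def fun_eq_iff forall_2 algebra_simps)
    show "s * c' = (if left then s * c + real m * v x y (flip i) else s * c)"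
      using that(6) by (auto simp: v_def algebra_simps)
  qed
  have int: "numeral k \<in> root_span l" "real n \<in> root_span l" "real_of_int m \<in> root_span l" "1 \<in> root_span l" "0 \<in> root_span l" for k m n
    by (auto intro: rat_mem_root_span)
  have neg: "- x \<in> root_span l" if "x \<in> root_span l" for x
    using diff_mem[OF int(5) that] by simp
  note mem = add_mem diff_mem mult_mem_root_span[OF root] root_mem_root_span int neg
    cuts_mem_root_span(2)
  show ?thesis
  proof (cases t)
    case T1
    define n where "n = nat (a - 3)"
    have a: "a \<ge> 3" and l: "0 < l" "l < 1" and ll: "l * l = a * l - 1" using adm root T1 by auto
    have n: "real n = a - 3" using a by (simp add: n_def)
    define c where "c = tau_cut T1 l"
    have cK: "c \<in> root_span l" using cuts_mem_root_span(2) T1 by (simp add: c_def)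
    \<comment> \<open>The middle factor moves the cut by \<open>(a - 3) * l\<close>; this identity
      says that it arrives at the renormalised cut \<open>l * c\<close>.\<close>
    have "(1 - l) * (c + (a - 3) * l) = (1 - l) * (l * c)"
    proof -
      have "(1 - l) * c = 3 * l - l * l - 1" using l1 by (simp add: c_def field_simps)
      moreover have "(1 - l) * (l * c) = l * ((1 - l) * c)"
        "(1 - l) * (c + (a - 3) * l) = (1 - l) * c + (1 - l) * ((a - 3) * l)"
        by (simp_all add: algebra_simps)
      ultimately have "(1 - l) * (l * c) = l * (3 * l - l * l - 1)"
        "(1 - l) * (c + (a - 3) * l) = (3 * l - l * l - 1) + (1 - l) * ((a - 3) * l)"
        by simp_all
      moreover have "a * l = l * l + 1" using ll by simp
      then have "(1 - l) * ((a - 3) * l) = (1 - l) * (l * l + 1 - 3 * l)" by (simp add: algebra_simps)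
      ultimately show ?thesis by (simp add: algebra_simps)
    qed
    then have c': "c + (a - 3) * l = l * c" using l1 by simp
    \<comment> \<open>From \<open>a >= 3\<close>: \<open>3 l <= a l = l^2 + 1 < l + 1\<close>, so
      the first translation stays negative after adding \<open>l\<close>.\<close>
    have "3 * l \<le> a * l" using a l by simp
    moreover have l3: "l * l - l < 0" using l mult_strict_right_mono[of l 1 l] by simp
    ultimately have l2: "2 * l - 1 < 0" using ll by linarith
    have nl: "real n * l = a * l - 3 * l" by (simp add: n algebra_simps)
    have "exchange_induces (root_span l) (s * c) (v (l - 1) l) (inserts False 1 1) (s * c) (v (2 * l - 1) l)"
      by (rule step) (use l l2 cK in \<open>auto intro!: mem simp: mult_less_0_iff\<close>)
    moreover have "exchange_induces (root_span l) (s * c) (v (2 * l - 1) l) (inserts True n 1) (s * (l * c)) (v (l * l - l) l)"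
      by (rule step) (use l l2 l3 cK ll c' nl in \<open>auto intro!: mem simp: mult_less_0_iff algebra_simps\<close>)
    moreover have "exchange_induces (root_span l) (s * (l * c)) (v (l * l - l) l) (inserts False 1 2) (s * (l * c)) (v (l * l - l) (l * l))"
      by (rule step) (use l l3 cK in \<open>auto intro!: mem simp: mult_less_0_iff\<close>)
    ultimately have "exchange_induces (root_span l) (s * c) (v (l - 1) l) (tau_list T1 a) (s * (l * c)) (v (l * l - l) (l * l))"
      unfolding tau_list.simps n_def by (blast intro: exchange_induces_comp)
    moreover have "(\<lambda>i. s * tau_steps t l i) = v (l - 1) l"
      "(\<lambda>i. s * l ^ tau_period t * tau_steps t l i) = v (l * l - l) (l * l)"
      unfolding T1 tau_steps.simps tau_period.simps by (rule v_eq; simp add: algebra_simps)+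
    ultimately show ?thesis by (simp add: T1 c_def mult.assoc)
  next
    case T2
    define n where "n = nat (- a - 2)"
    have a: "a \<le> -3" and l: "- 1 < l" "l < 0" and ll: "l * l = a * l - 1" using adm root T2 by auto
    have n: "real n = - a - 2" using a by (simp add: n_def)
    define c where "c = tau_cut T2 l"
    have cK: "c \<in> root_span l" using cuts_mem_root_span(2) T2 by (simp add: c_def)
    have al: "a * l = l * l + 1" using ll by simp
    have lll: "a * (l * l) = l * (l * l) + l" using arg_cong[OF al, of "\<lambda>x. x * l"] by (simp add: algebra_simps)
    \<comment> \<open>The cut after the first factor. The second and third factors leave it in
      place, and the fourth moves it by \<open>l * l + l * (l * l)\<close>.\<close>
    define c1 where "c1 = c + real n * l"
    have "(1 - l) * (c1 + l * l + l * (l * l)) = (1 - l) * (l * l * c)"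
    proof -
      have c0: "(1 - l) * c = 1 + l - l * l" using l1 by (simp add: c_def field_simps)
      have "c1 = c - l * l - 1 - 2 * l" using al by (simp add: c1_def n algebra_simps)
      then have "c1 + l * l + l * (l * l) = c + (l * (l * l) - 1 - 2 * l)" by linarith
      then have "(1 - l) * (c1 + l * l + l * (l * l)) = (1 - l) * c + (1 - l) * (l * (l * l) - 1 - 2 * l)"
        by (simp only: distrib_left)
      moreover have "(1 - l) * (l * l * c) = l * l * ((1 - l) * c)" by simp
      ultimately show ?thesis unfolding c0 by (simp add: algebra_simps)
    qed
    then have c': "c1 + l * l + l * (l * l) = l * l * c" using l1 by simp
    \<comment> \<open>These signs make the two translations opposite at each of the four
      stages.\<close>
    have p1: "0 < - l - l * l" using l mult_strict_right_mono_neg[of "-1" l l] by simp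
    have p2: "0 < l * l" using l by (simp add: mult_neg_neg)
    have p3: "0 < l * l + l * (l * l)" using mult_strict_right_mono[OF l(1) p2] by linarith
    have p4: "l * (l * l) < 0" using l(2) p2 by (rule mult_neg_pos)
    have p5: "- (l * l) < 0" using p2 by linarith
    note neg_products = mult_pos_neg[OF p1 l(2)] mult_pos_neg[OF p1 p5] mult_pos_neg[OF p3 p5]
    have "exchange_induces (root_span l) (s * c) (v (l + 1) l) (inserts True n 1) (s * c1) (v (- l - l * l) l)"
      by (rule step) (use l p1 cK al neg_products in \<open>auto intro!: mem mult_pos_neg simp: c1_def n algebra_simps\<close>)
    moreover have "exchange_induces (root_span l) (s * c1) (v (- l - l * l) l) (inserts False 1 2) (s * c1) (v (- l - l * l) (- (l * l)))"
      by (rule step) (use cK neg_products in \<open>auto intro!: mem simp: c1_def\<close>)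
    moreover have "exchange_induces (root_span l) (s * c1) (v (- l - l * l) (- (l * l))) (inserts False n 1) (s * c1) (v (l * l + l * (l * l)) (- (l * l)))"
    proof (rule step)
      have "real n * - (l * l) = l * (l * l) + l + 2 * (l * l)" using lll by (simp add: n algebra_simps)
      then show "1 = (1::2) \<and> l * l + l * (l * l) = - l - l * l + real n * - (l * l) \<and> - (l * l) = - (l * l) \<and>
          c1 = (if False then c1 + real n * - (l * l) else c1) \<or>
        1 = (2::2) \<and> l * l + l * (l * l) = - l - l * l \<and> - (l * l) = - (l * l) + real n * (- l - l * l) \<and>
          c1 = (if False then c1 + real n * (- l - l * l) else c1)" by simp
    qed (use cK neg_products in \<open>auto intro!: mem simp: c1_def\<close>)
    moreover have "exchange_induces (root_span l) (s * c1) (v (l * l + l * (l * l)) (- (l * l))) (inserts True 1 2) (s * (l * l * c)) (v (l * l + l * (l * l)) (l * (l * l)))"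
    proof (rule step)
      show "(l * l + l * (l * l)) * (l * (l * l)) < 0" using p3 p4 by (rule mult_pos_neg)
    qed (use cK c' neg_products in \<open>auto intro!: mem simp: c1_def\<close>)
    ultimately have "exchange_induces (root_span l) (s * c) (v (l + 1) l) (tau_list T2 a) (s * (l * l * c)) (v (l * l + l * (l * l)) (l * (l * l)))"
      unfolding tau_list.simps n_def by (blast intro: exchange_induces_comp)
    moreover have "(\<lambda>i. s * tau_steps t l i) = v (l + 1) l"
      "(\<lambda>i. s * l ^ tau_period t * tau_steps t l i) = v (l * l + l * (l * l)) (l * (l * l))"
      unfolding T2 tau_steps.simps tau_period.simps by (rule v_eq; simp add: algebra_simps power2_eq_square)+
    ultimately show ?thesis by (simp add: T2 c_def mult.assoc power2_eq_square)
  next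
    case T4
    define n where "n = nat (- a)"
    have a: "a \<le> -1" and l: "0 < l" "l < 1" and ll: "l * l = a * l + 1" using adm root T4 by auto
    have n: "real n = - a" using a by (simp add: n_def)
    have al: "a * l = l * l - 1" using ll by simp
    have lll: "a * (l * l) = l * (l * l) - l" using arg_cong[OF al, of "\<lambda>x. x * l"] by (simp add: algebra_simps)
    have p: "0 < l * l" "0 < l * (l * l)" using l by auto
    have "exchange_induces (root_span l) (s * - 1) (v (- 1) l) (inserts True n 1) (s * - (l * l)) (v (- (l * l)) l)"
      by (rule step) (use l p al in \<open>auto intro!: mem simp: mult_less_0_iff n algebra_simps\<close>)
    moreover have "exchange_induces (root_span l) (s * - (l * l)) (v (- (l * l)) l) (inserts False n 2) (s * - (l * l)) (v (- (l * l)) (l * (l * l)))"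
      by (rule step) (use l p lll in \<open>auto intro!: mem simp: mult_less_0_iff n algebra_simps\<close>)
    ultimately have "exchange_induces (root_span l) (s * - 1) (v (- 1) l) (tau_list T4 a) (s * - (l * l)) (v (- (l * l)) (l * (l * l)))"
      unfolding tau_list.simps n_def by (blast intro: exchange_induces_comp)
    moreover have "(\<lambda>i. s * tau_steps t l i) = v (- 1) l"
      "(\<lambda>i. s * l ^ tau_period t * tau_steps t l i) = v (- (l * l)) (l * (l * l))"
      unfolding T4 tau_steps.simps tau_period.simps by (rule v_eq; simp add: algebra_simps power2_eq_square)+
    ultimately show ?thesis by (simp add: T4 mult.assoc power2_eq_square)
  qed
qed

lemma exchange_induces_tau_power:
  "exchange_induces (root_span l) (l ^ (k * tau_period t) * tau_cut t l) (\<lambda>i. l ^ (k * tau_period t) * tau_steps t l i)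
    ((subst_lists (tau_list t a) ^^ n) (\<lambda>i. [i]))
    (l ^ ((k + n) * tau_period t) * tau_cut t l) (\<lambda>i. l ^ ((k + n) * tau_period t) * tau_steps t l i)"
proof (induction n arbitrary: k)
  case 0
  have mem: "l ^ m \<in> root_span l" for m
    by (induction m) (auto intro: rat_mem_root_span mult_mem_root_span[OF root] root_mem_root_span)
  have "l \<noteq> 0" using contracting_root_norm[OF root] by auto
  then have "exchange_induces (root_span l) (l ^ (k * tau_period t) * tau_cut t l) (\<lambda>i. l ^ (k * tau_period t) * tau_steps t l i)
    (tau_list t a) (l ^ (k * tau_period t) * l ^ tau_period t * tau_cut t l)
    (\<lambda>i. l ^ (k * tau_period t) * l ^ tau_period t * tau_steps t l i)"
    by (intro exchange_induces_tau mem) simp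
  \<comment> \<open>One step at this scale is invoked just to read off the membership and sign
    conditions of its starting data.\<close>
  then show ?case unfolding exchange_induces_def[of _ _ _ "tau_list t a"]
    by (auto intro!: exchange_induces_id)
next
  case (Suc n)
  have mem: "l ^ m \<in> root_span l" for m
    by (induction m) (auto intro: rat_mem_root_span mult_mem_root_span[OF root] root_mem_root_span)
  have "l \<noteq> 0" using contracting_root_norm[OF root] by auto
  then have "exchange_induces (root_span l) (l ^ (k * tau_period t) * tau_cut t l) (\<lambda>i. l ^ (k * tau_period t) * tau_steps t l i)
    (tau_list t a) (l ^ (Suc k * tau_period t) * tau_cut t l) (\<lambda>i. l ^ (Suc k * tau_period t) * tau_steps t l i)"
    using exchange_induces_tau[OF _ mem, of "k * tau_period t"] by (simp add: power_add mult.commute mult.left_commute)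
  from exchange_induces_comp[OF this Suc.IH[of "Suc k"]] show ?case by simp
qed

lemma exchange_induces_delta_tau:
  "exchange_induces (root_span l) (sigma_cut t l) (sigma_steps t l)
    (subst_lists (delta_list t) ((subst_lists (tau_list t a) ^^ n) (\<lambda>i. [i])))
    (l ^ (n * tau_period t) * tau_cut t l) (\<lambda>i. l ^ (n * tau_period t) * tau_steps t l i)"
  using exchange_induces_comp[OF exchange_induces_delta, of _ _ _] exchange_induces_tau_power[of 0 n] by simp

end

section \<open>Words and incidence matrices\<close>

lemma endo_generator: "reduced (g i) \<Longrightarrow> endo g [pos i] = g i"
  by (simp add: endo_def reduce_reduced)

lemma subst_generator:
  assumes "reduced u" "reduced v"
  shows "subst u v [pos 1] = u" "subst u v [pos 2] = v"
  using assms by (simp_all add: subst_def endo_generator)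

lemma reduced_replicate_append:
  assumes "reduced w" "w = [] \<or> hd w \<noteq> inv_letter x"
  shows "reduced (replicate n x @ w)"
  using assms
proof (induction n)
  case (Suc n)
  then show ?case
    by (cases n; cases w) (auto simp: reduced_def successively_Cons inv_letter_neq[symmetric])
qed simp

text \<open>A letter and its inverse never both occur, so nothing can cancel.\<close>

lemma reduced_uniform: "set w \<subseteq> range (\<lambda>i. (i, s i)) \<Longrightarrow> reduced w"
proof (induction w)
  case (Cons x w)
  then show ?case
    by (cases w) (auto simp: reduced_def inv_letter_def)
qed simp

lemma sigma_words:
  assumes "admissible t a"
  shows "sigma t a [pos 1] = [pos 2]"
    and "t = T1 \<Longrightarrow> sigma t a [pos 2] = replicate (nat (a - 2)) (pos 2) @ [neg 1, pos 2, pos 2]"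
    and "t = T2 \<Longrightarrow> sigma t a [pos 2] = neg 1 # replicate (nat (- a)) (neg 2)"
    and "t = T4 \<Longrightarrow> sigma t a [pos 2] = pos 1 # replicate (nat (- a)) (neg 2)"
proof -
  have red: "reduced [pos 2]" "reduced [neg 1, pos 2, pos 2]" "reduced (replicate n (pos 2) @ [neg 1, pos 2, pos 2])"
    "reduced (neg 1 # replicate n (neg 2))" "reduced (pos 1 # replicate n (neg 2))" for n
  proof -
    show "reduced [pos 2]" "reduced [neg 1, pos 2, pos 2]"
      by (simp_all add: reduced_def inv_letter_def)
    show "reduced (replicate n (pos 2) @ [neg 1, pos 2, pos 2])"
      by (rule reduced_replicate_append) (simp_all add: reduced_def inv_letter_def)
    show "reduced (neg 1 # replicate n (neg 2))"
      by (rule reduced_uniform[of _ "\<lambda>i. False"]) auto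
    show "reduced (pos 1 # replicate n (neg 2))"
      by (rule reduced_uniform[of _ "\<lambda>i. i = 1"]) auto
  qed
  show "sigma t a [pos 1] = [pos 2]"
    and "t = T1 \<Longrightarrow> sigma t a [pos 2] = replicate (nat (a - 2)) (pos 2) @ [neg 1, pos 2, pos 2]"
    and "t = T2 \<Longrightarrow> sigma t a [pos 2] = neg 1 # replicate (nat (- a)) (neg 2)"
    and "t = T4 \<Longrightarrow> sigma t a [pos 2] = pos 1 # replicate (nat (- a)) (neg 2)"
    using assms by (cases t; simp add: letter_power_def subst_generator red)+
qed

lemma tau_words:
  assumes "admissible t a"
  shows "t = T1 \<Longrightarrow> tau t a [pos 1] = replicate (nat (a - 3)) (pos 2) @ [pos 1, pos 2]"
    and "t = T1 \<Longrightarrow> tau t a [pos 2] = replicate (nat (a - 2)) (pos 2) @ [pos 1, pos 2]"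
    and "t = T2 \<Longrightarrow> tau t a [pos 1] = neg 1 # replicate (nat (- a - 2)) (neg 2)"
    and "t = T2 \<Longrightarrow> tau t a [pos 2] = neg 1 # replicate (nat (- a - 1)) (neg 2)"
    and "t = T4 \<Longrightarrow> tau t a [pos 1] = [neg 2]"
    and "t = T4 \<Longrightarrow> tau t a [pos 2] = neg 1 # replicate (nat (- a)) (neg 2)"
proof -
  have red: "reduced (replicate n (pos 2) @ [pos 1, pos 2])" for n
    by (rule reduced_uniform[of _ "\<lambda>i. True"]) auto
  have red': "reduced [neg 2]" "reduced (neg 1 # replicate n (neg 2))" for n
    by (rule reduced_uniform[of _ "\<lambda>i. False"]; auto)+
  show "t = T1 \<Longrightarrow> tau t a [pos 1] = replicate (nat (a - 3)) (pos 2) @ [pos 1, pos 2]"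
    and "t = T1 \<Longrightarrow> tau t a [pos 2] = replicate (nat (a - 2)) (pos 2) @ [pos 1, pos 2]"
    and "t = T2 \<Longrightarrow> tau t a [pos 1] = neg 1 # replicate (nat (- a - 2)) (neg 2)"
    and "t = T2 \<Longrightarrow> tau t a [pos 2] = neg 1 # replicate (nat (- a - 1)) (neg 2)"
    and "t = T4 \<Longrightarrow> tau t a [pos 1] = [neg 2]"
    and "t = T4 \<Longrightarrow> tau t a [pos 2] = neg 1 # replicate (nat (- a)) (neg 2)"
    using assms
    by (simp_all add: letter_power_def subst_generator red red' add.commute minus_diff_eq)
qed

lemma delta_words:
  "delta T1 [pos 1] = [pos 2, neg 1]" "delta T2 [pos 1] = [neg 2, pos 1]" "delta T4 [pos 1] = [neg 1]"
  "delta t [pos 2] = [pos 2]"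
  by (cases t; simp add: subst_generator reduced_def inv_letter_def)+

lemma matrix_inv_eqI:
  fixes A B :: "'a::semiring_1 ^ 'n ^ 'n"
  assumes "A ** B = mat 1" "B ** A = mat 1"
  shows "matrix_inv A = B"
proof -
  have "A ** matrix_inv A = mat 1"
    unfolding matrix_inv_def using assms by (metis (mono_tags, lifting) someI_ex)
  then have "B ** (A ** matrix_inv A) = B" by simp
  then show ?thesis using assms(2) by (simp add: matrix_mul_assoc)
qed

definition pt :: "int \<Rightarrow> int \<Rightarrow> int ^ 2" where
  "pt p q = (\<chi> i. if i = 1 then p else q)"

lemma pt_nth [simp]: "pt p q $ 1 = p" "pt p q $ 2 = q"
  by (simp_all add: pt_def)

lemma pt_cases: obtains p q where "x = pt p q"
  by (rule that[of "x $ 1" "x $ 2"]) (simp add: vec_eq_iff forall_2)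

lemma pt_add [simp]: "pt p q + pt p' q' = pt (p + p') (q + q')"
  by (simp add: vec_eq_iff forall_2)

lemma axis_pt: "axis 1 k = pt k 0" "axis 2 k = pt 0 k" "0 = pt 0 0"
  by (simp_all add: vec_eq_iff forall_2 axis_def)

lemma abelianize_simps [simp]:
  "abelianize [] = pt 0 0"
  "abelianize ((i, s) # w) = (if i = 1 then pt (if s then 1 else - 1) 0 else pt 0 (if s then 1 else - 1)) + abelianize w"
  using exhaust_2[of i] by (auto simp: abelianize_def axis_pt)

lemma abelianize_replicate:
  "abelianize (replicate n (1, s) @ w) = pt (if s then int n else - int n) 0 + abelianize w"
  "abelianize (replicate n (2, s) @ w) = pt 0 (if s then int n else - int n) + abelianize w"
  by (induction n) (auto simp: vec_eq_iff forall_2)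

definition mat2 :: "'a \<Rightarrow> 'a \<Rightarrow> 'a \<Rightarrow> 'a \<Rightarrow> 'a ^ 2 ^ 2" where
  "mat2 p q r s = (\<chi> i j. if i = 1 then if j = 1 then p else q else if j = 1 then r else s)"

lemma mat2_nth [simp]: "mat2 p q r s $ 1 $ 1 = p" "mat2 p q r s $ 1 $ 2 = q"
  "mat2 p q r s $ 2 $ 1 = r" "mat2 p q r s $ 2 $ 2 = s"
  by (simp_all add: mat2_def)

lemma mat2_mult: "mat2 p q r s ** mat2 p' q' r' s' =
    mat2 (p * p' + q * r') (p * q' + q * s') (r * p' + s * r') (r * q' + s * (s'::'a::semiring_1))"
  by (simp add: vec_eq_iff forall_2 matrix_matrix_mult_def sum_2)

lemma mat2_pt: "mat2 p q r s *v pt x y = pt (p * x + q * y) (r * x + s * y)"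
  by (simp add: vec_eq_iff forall_2 matrix_vector_mult_def sum_2)

lemma mat2_one: "mat 1 = mat2 1 0 0 1"
  by (simp add: vec_eq_iff forall_2 mat_def)

lemma incidence_mat2:
  assumes "abelianize (\<rho> [pos 1]) = pt p r" "abelianize (\<rho> [pos 2]) = pt q s"
  shows "incidence_matrix \<rho> = mat2 p q r s"
    and "real_incidence_matrix \<rho> = mat2 (real_of_int p) q r s"
  using assms by (simp_all add: incidence_matrix_def real_incidence_matrix_def vec_eq_iff forall_2)

lemma incidence_sigma:
  assumes "admissible t a" and "d = (if t = T4 then - 1 else 1)"
  shows "incidence_matrix (sigma t a) = mat2 0 (- d) 1 a"
    and "real_incidence_matrix (sigma t a) = mat2 0 (- real_of_int d) 1 a"
proof -
  have *: "abelianize (sigma t a [pos 1]) = pt 0 1" "abelianize (sigma t a [pos 2]) = pt (- d) a"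
  proof -
    show "abelianize (sigma t a [pos 1]) = pt 0 1"
      unfolding sigma_words(1)[OF assms(1)] by simp
    have "abelianize (sigma T1 a [pos 2]) = pt (- 1) a" if "admissible T1 a"
      unfolding sigma_words(2)[OF that refl] using that by (simp add: abelianize_replicate)
    moreover have "abelianize (sigma T2 a [pos 2]) = pt (- 1) a" if "admissible T2 a"
      unfolding sigma_words(3)[OF that refl] using that
      by (simp add: abelianize_replicate(2)[of _ _ "[]", simplified])
    moreover have "abelianize (sigma T4 a [pos 2]) = pt 1 a" if "admissible T4 a"
      unfolding sigma_words(4)[OF that refl] using that
      by (simp add: abelianize_replicate(2)[of _ _ "[]", simplified])
    ultimately show "abelianize (sigma t a [pos 2]) = pt (- d) a"
      using assms by (cases t) (simp_all del: sigma.simps)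
  qed
  show "incidence_matrix (sigma t a) = mat2 0 (- d) 1 a"
    "real_incidence_matrix (sigma t a) = mat2 0 (- real_of_int d) 1 a"
    using incidence_mat2[OF *] by simp_all
qed

lemma incidence_tau:
  assumes "admissible t a"
  shows "t = T1 \<Longrightarrow> incidence_matrix (tau t a) = mat2 1 1 (a - 2) (a - 1)"
    and "t = T2 \<Longrightarrow> incidence_matrix (tau t a) = mat2 (- 1) (- 1) (a + 2) (a + 1)"
    and "t = T4 \<Longrightarrow> incidence_matrix (tau t a) = mat2 0 (- 1) (- 1) a"
    and "t = T1 \<Longrightarrow> real_incidence_matrix (tau t a) = mat2 1 1 (real_of_int a - 2) (real_of_int a - 1)"
    and "t = T2 \<Longrightarrow> real_incidence_matrix (tau t a) = mat2 (- 1) (- 1) (real_of_int a + 2) (real_of_int a + 1)"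
    and "t = T4 \<Longrightarrow> real_incidence_matrix (tau t a) = mat2 0 (- 1) (- 1) (real_of_int a)"
proof -
  have *: "abelianize (tau t a [pos 1]) = (case t of T1 \<Rightarrow> pt 1 (a - 2) | T2 \<Rightarrow> pt (- 1) (a + 2) | T4 \<Rightarrow> pt 0 (- 1))"
    "abelianize (tau t a [pos 2]) = (case t of T1 \<Rightarrow> pt 1 (a - 1) | T2 \<Rightarrow> pt (- 1) (a + 1) | T4 \<Rightarrow> pt (- 1) a)"
  proof -
    note rep = abelianize_replicate abelianize_replicate(2)[of _ _ "[]", simplified]
    have "abelianize (tau T1 a [pos 1]) = pt 1 (a - 2)" "abelianize (tau T1 a [pos 2]) = pt 1 (a - 1)"
      if "admissible T1 a"
      unfolding tau_words(1,2)[OF that refl] using that by (simp_all add: rep add.commute)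
    moreover have "abelianize (tau T2 a [pos 1]) = pt (- 1) (a + 2)" "abelianize (tau T2 a [pos 2]) = pt (- 1) (a + 1)"
      if "admissible T2 a"
      unfolding tau_words(3,4)[OF that refl] using that by (simp_all add: rep add.commute)
    moreover have "abelianize (tau T4 a [pos 1]) = pt 0 (- 1)" "abelianize (tau T4 a [pos 2]) = pt (- 1) a"
      if "admissible T4 a"
      unfolding tau_words(5,6)[OF that refl] using that by (simp_all add: rep add.commute)
    ultimately show "abelianize (tau t a [pos 1]) = (case t of T1 \<Rightarrow> pt 1 (a - 2) | T2 \<Rightarrow> pt (- 1) (a + 2) | T4 \<Rightarrow> pt 0 (- 1))"
      "abelianize (tau t a [pos 2]) = (case t of T1 \<Rightarrow> pt 1 (a - 1) | T2 \<Rightarrow> pt (- 1) (a + 1) | T4 \<Rightarrow> pt (- 1) a)"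
      using assms by (cases t; simp del: tau.simps)+
  qed
  show "t = T1 \<Longrightarrow> incidence_matrix (tau t a) = mat2 1 1 (a - 2) (a - 1)"
    and "t = T2 \<Longrightarrow> incidence_matrix (tau t a) = mat2 (- 1) (- 1) (a + 2) (a + 1)"
    and "t = T4 \<Longrightarrow> incidence_matrix (tau t a) = mat2 0 (- 1) (- 1) a"
    and "t = T1 \<Longrightarrow> real_incidence_matrix (tau t a) = mat2 1 1 (real_of_int a - 2) (real_of_int a - 1)"
    and "t = T2 \<Longrightarrow> real_incidence_matrix (tau t a) = mat2 (- 1) (- 1) (real_of_int a + 2) (real_of_int a + 1)"
    and "t = T4 \<Longrightarrow> real_incidence_matrix (tau t a) = mat2 0 (- 1) (- 1) (real_of_int a)"
    using incidence_mat2[of "tau t a"] * by (simp_all del: tau.simps)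
qed

lemma incidence_delta:
  "real_incidence_matrix (delta T1) = mat2 (- 1) 0 1 1"
  "real_incidence_matrix (delta T2) = mat2 1 0 (- 1) 1"
  "real_incidence_matrix (delta T4) = mat2 (- 1) 0 0 1"
  using incidence_mat2(2)[of "delta T1"] incidence_mat2(2)[of "delta T2"] incidence_mat2(2)[of "delta T4"]
  by (simp_all add: delta_words del: delta.simps)

lemma inverse_incidence_sigma:
  assumes "admissible t a" and "d = (if t = T4 then - 1 else 1)"
  shows "matrix_inv (incidence_matrix (sigma t a)) = mat2 (d * a) 1 (- d) 0"
  unfolding incidence_sigma[OF assms] using assms(2)
  by (intro matrix_inv_eqI) (auto simp: mat2_mult mat2_one)

lemma inverse_incidence_tau:
  assumes "admissible t a"
  shows "t = T1 \<Longrightarrow> matrix_inv (incidence_matrix (tau t a)) = mat2 (a - 1) (- 1) (2 - a) 1"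
    and "t = T2 \<Longrightarrow> matrix_inv (incidence_matrix (tau t a)) = mat2 (a + 1) 1 (- a - 2) (- 1)"
    and "t = T4 \<Longrightarrow> matrix_inv (incidence_matrix (tau t a)) = mat2 (- a) (- 1) (- 1) 0"
  using incidence_tau(1-3)[OF assms]
  by (auto intro!: matrix_inv_eqI simp: mat2_mult mat2_one algebra_simps simp del: tau.simps)

section \<open>Explicit tiling substitutions\<close>

lemma pt_eq_iff: "pt p q = pt p' q' \<longleftrightarrow> p = p' \<and> q = q'"
  by (auto simp: vec_eq_iff forall_2)

text \<open>The share of one image word in \<open>tiling_subst\<close>, separated so that it can be
  evaluated by recursion along the word.\<close>

definition contribution :: "int ^ 2 ^ 2 \<Rightarrow> int ^ 2 \<Rightarrow> 2 \<Rightarrow> 2 \<Rightarrow> word \<Rightarrow> chain" where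
  "contribution B x i j w =
     (\<Sum>k | k < length w \<and> w ! k = pos i. frag_of (B *v (x + abelianize (drop (Suc k) w)), j))
   - (\<Sum>k | k < length w \<and> w ! k = neg i. frag_of (B *v (x + abelianize (drop k w)), j))"

lemma tiling_subst_frag_of:
  "tiling_subst \<rho> (frag_of (x, i)) =
     contribution (matrix_inv (incidence_matrix \<rho>)) x i 1 (\<rho> [pos 1])
   + contribution (matrix_inv (incidence_matrix \<rho>)) x i 2 (\<rho> [pos 2])"
  by (simp add: tiling_subst_def contribution_def sum_2 Let_def)

lemma sum_positions_Cons:
  "(\<Sum>k | k < length (y # w) \<and> (y # w) ! k = z. f k) =
     (if y = z then f 0 else 0) + (\<Sum>k | k < length w \<and> w ! k = z. f (Suc k))"
proof -
  have "{k. k < length (y # w) \<and> (y # w) ! k = z} =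
      (if y = z then {0} else {}) \<union> Suc ` {k. k < length w \<and> w ! k = z}"
    by (auto simp: less_Suc_eq_0_disj)
  then show ?thesis
    by (auto simp: sum.insert sum.reindex image_iff)
qed

lemma contribution_Nil [simp]: "contribution B x i j [] = 0"
  by (simp add: contribution_def)

lemma contribution_Cons [simp]:
  "contribution B x i j ((l, s) # w) =
     (if l = i then if s then frag_of (B *v (x + abelianize w), j)
        else - frag_of (B *v (x + abelianize ((l, s) # w)), j) else 0) + contribution B x i j w"
  unfolding contribution_def sum_positions_Cons by simp

lemma contribution_replicate_other [simp]:
  "l \<noteq> i \<Longrightarrow> contribution B x i j (replicate n (l, s) @ w) = contribution B x i j w"
  "l \<noteq> i \<Longrightarrow> contribution B x i j (replicate n (l, s)) = 0"
  by (induction n) auto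

lemma contribution_replicate_pos [simp]:
  "contribution B x 2 j (replicate n (pos 2) @ w) =
     (\<Sum>k<n. frag_of (B *v (x + pt 0 (int k) + abelianize w), j)) + contribution B x 2 j w"
  by (induction n) (auto simp: abelianize_replicate add_ac simp del: pt_add)

lemma contribution_replicate_neg [simp]:
  "contribution B x 2 j (replicate n (neg 2)) = - (\<Sum>k<n. frag_of (B *v (x + pt 0 (- int k - 1)), j))"
proof (induction n)
  case (Suc n)
  have "abelianize ((2, False) # replicate n (neg 2)) = pt 0 (- int n - 1)"
    by (simp add: abelianize_replicate(2)[of _ _ "[]", simplified] pt_eq_iff)
  then show ?case
    using Suc by (simp del: abelianize_simps pt_add)
qed simp

lemma frag_of_pt_cong: "p = p' \<Longrightarrow> q = q' \<Longrightarrow> frag_of (pt p q, i) = frag_of (pt p' q', i)"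
  by simp

text \<open>A power of the letter \<open>2\<close> contributes a horizontal row of type-2 segments;
  the rows are kept as sums so that they can be telescoped.\<close>

lemma tiling_sigma:
  assumes "admissible t a"
  defines "S \<equiv> \<lambda>p q i. tiling_subst (sigma t a) (frag_of (pt p q, i))"
  shows "t = T1 \<Longrightarrow> S p q 1 = - frag_of (pt (a * p + q + 2 - a) (1 - p), 2)"
    and "t = T1 \<Longrightarrow> S p q 2 = frag_of (pt (a * p + q) (- p), 1) + frag_of (pt (a * p + q) (- p), 2)
      + frag_of (pt (a * p + q + 1) (- p), 2)
      + (\<Sum>k<nat (a - 2). frag_of (pt (a * p + q + 2 - a + int k) (1 - p), 2))"
    and "t = T2 \<Longrightarrow> S p q 1 = - frag_of (pt (a * p + q) (1 - p), 2)"
    and "t = T2 \<Longrightarrow> S p q 2 = frag_of (pt (a * p + q) (- p), 1)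
      - (\<Sum>k<nat (- a). frag_of (pt (a * p + q - 1 - int k) (- p), 2))"
    and "t = T4 \<Longrightarrow> S p q 1 = frag_of (pt (- a * p + q + a) p, 2)"
    and "t = T4 \<Longrightarrow> S p q 2 = frag_of (pt (- a * p + q) p, 1)
      - (\<Sum>k<nat (- a). frag_of (pt (- a * p + q - 1 - int k) p, 2))"
proof -
  note * = S_def tiling_subst_frag_of mat2_pt abelianize_replicate abelianize_replicate(2)[of _ _ "[]", simplified]
  have sw: "sigma t a [pos 1] = [pos 2]" by (rule sigma_words(1)[OF assms(1)])
  { assume t: "t = T1"
    have a: "a \<ge> 3" using assms(1) t by simp
    note ** = * sw sigma_words(2)[OF assms(1) t] inverse_incidence_sigma[OF assms(1) refl]
    show "S p q 1 = - frag_of (pt (a * p + q + 2 - a) (1 - p), 2)"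
      "S p q 2 = frag_of (pt (a * p + q) (- p), 1) + frag_of (pt (a * p + q) (- p), 2)
      + frag_of (pt (a * p + q + 1) (- p), 2)
      + (\<Sum>k<nat (a - 2). frag_of (pt (a * p + q + 2 - a + int k) (1 - p), 2))"
      unfolding ** by (simp_all add: * t algebra_simps) }
  { assume t: "t = T2"
    have a: "a \<le> -3" using assms(1) t by simp
    note ** = * sw sigma_words(3)[OF assms(1) t] inverse_incidence_sigma[OF assms(1) refl]
    show "S p q 1 = - frag_of (pt (a * p + q) (1 - p), 2)"
      "S p q 2 = frag_of (pt (a * p + q) (- p), 1)
      - (\<Sum>k<nat (- a). frag_of (pt (a * p + q - 1 - int k) (- p), 2))"
      unfolding ** using a by (simp_all add: * t algebra_simps) }
  { assume t: "t = T4"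
    have a: "a \<le> -1" using assms(1) t by simp
    note ** = * sw sigma_words(4)[OF assms(1) t] inverse_incidence_sigma[OF assms(1) refl]
    show "S p q 1 = frag_of (pt (- a * p + q + a) p, 2)"
      "S p q 2 = frag_of (pt (- a * p + q) p, 1)
      - (\<Sum>k<nat (- a). frag_of (pt (- a * p + q - 1 - int k) p, 2))"
      unfolding ** using a by (simp_all add: * t algebra_simps) }
qed

text \<open>The inverse of \<open>A_tau\<close> sends \<open>e2\<close> to \<open>(-1, 1)\<close>
  for \<open>T1\<close>, \<open>(1, -1)\<close> for \<open>T2\<close> and \<open>(-1, 0)\<close> for
  \<open>T4\<close>; powers of \<open>2\<close> therefore produce diagonal families in the first two
  cases and a horizontal row in the third.\<close>

lemma tiling_tau:
  assumes "admissible t a"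
  defines "S \<equiv> \<lambda>p q i. tiling_subst (tau t a) (frag_of (pt p q, i))"
  shows "t = T1 \<Longrightarrow> S p q 1 = frag_of (pt ((a - 1) * p - q - 1) ((2 - a) * p + q + 1), 1)
      + frag_of (pt ((a - 1) * p - q - 1) ((2 - a) * p + q + 1), 2)"
    and "t = T1 \<Longrightarrow> S p q 2 = frag_of (pt ((a - 1) * p - q) ((2 - a) * p + q), 1)
      + frag_of (pt ((a - 1) * p - q) ((2 - a) * p + q), 2)
      + (\<Sum>k<nat (a - 3). frag_of (pt ((a - 1) * p - q + a - 2 - int k) ((2 - a) * p + q + 3 - a + int k), 1))
      + (\<Sum>k<nat (a - 2). frag_of (pt ((a - 1) * p - q + a - 2 - int k) ((2 - a) * p + q + 3 - a + int k), 2))"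
    and "t = T2 \<Longrightarrow> S p q 1 = - frag_of (pt ((a + 1) * p + q + 1) ((- a - 2) * p - q), 1)
      - frag_of (pt ((a + 1) * p + q) ((- a - 2) * p - q + 1), 2)"
    and "t = T2 \<Longrightarrow> S p q 2 =
      - (\<Sum>k<nat (- a - 2). frag_of (pt ((a + 1) * p + q - 1 - int k) ((- a - 2) * p - q + 1 + int k), 1))
      - (\<Sum>k<nat (- a - 1). frag_of (pt ((a + 1) * p + q - 1 - int k) ((- a - 2) * p - q + 1 + int k), 2))"
    and "t = T4 \<Longrightarrow> S p q 1 = - frag_of (pt (- a * p - q) (1 - p), 2)"
    and "t = T4 \<Longrightarrow> S p q 2 = - frag_of (pt (- a * p - q + 1) (- p), 1)
      - (\<Sum>k<nat (- a). frag_of (pt (- a * p - q + 1 + int k) (- p), 2))"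
proof -
  note * = S_def tiling_subst_frag_of mat2_pt abelianize_replicate abelianize_replicate(2)[of _ _ "[]", simplified]
  { assume t: "t = T1"
    have a: "a \<ge> 3" using assms(1) t by simp
    note ** = * tau_words(1,2)[OF assms(1) t] inverse_incidence_tau(1)[OF assms(1) t]
    show "S p q 1 = frag_of (pt ((a - 1) * p - q - 1) ((2 - a) * p + q + 1), 1)
      + frag_of (pt ((a - 1) * p - q - 1) ((2 - a) * p + q + 1), 2)"
     "S p q 2 = frag_of (pt ((a - 1) * p - q) ((2 - a) * p + q), 1)
      + frag_of (pt ((a - 1) * p - q) ((2 - a) * p + q), 2)
      + (\<Sum>k<nat (a - 3). frag_of (pt ((a - 1) * p - q + a - 2 - int k) ((2 - a) * p + q + 3 - a + int k), 1))
      + (\<Sum>k<nat (a - 2). frag_of (pt ((a - 1) * p - q + a - 2 - int k) ((2 - a) * p + q + 3 - a + int k), 2))"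
      unfolding ** using a by (simp_all add: * t algebra_simps) }
  { assume t: "t = T2"
    have a: "a \<le> -3" using assms(1) t by simp
    note ** = * tau_words(3,4)[OF assms(1) t] inverse_incidence_tau(2)[OF assms(1) t]
    show "S p q 1 = - frag_of (pt ((a + 1) * p + q + 1) ((- a - 2) * p - q), 1)
      - frag_of (pt ((a + 1) * p + q) ((- a - 2) * p - q + 1), 2)"
     "S p q 2 =
      - (\<Sum>k<nat (- a - 2). frag_of (pt ((a + 1) * p + q - 1 - int k) ((- a - 2) * p - q + 1 + int k), 1))
      - (\<Sum>k<nat (- a - 1). frag_of (pt ((a + 1) * p + q - 1 - int k) ((- a - 2) * p - q + 1 + int k), 2))"
      unfolding ** using a by (simp_all add: * t algebra_simps) (rule frag_of_pt_cong; simp) }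
  { assume t: "t = T4"
    have a: "a \<le> -1" using assms(1) t by simp
    note ** = * tau_words(5,6)[OF assms(1) t] inverse_incidence_tau(3)[OF assms(1) t]
    show "S p q 1 = - frag_of (pt (- a * p - q) (1 - p), 2)"
     "S p q 2 = - frag_of (pt (- a * p - q + 1) (- p), 1)
      - (\<Sum>k<nat (- a). frag_of (pt (- a * p - q + 1 + int k) (- p), 2))"
      unfolding ** using a by (simp_all add: * t algebra_simps) (rule frag_of_pt_cong; simp) }
qed

text \<open>
  A segment is oriented from \<open>tail\<close> to \<open>head\<close>. With this orientation \<open>\<sigma>\<^sup>*\<close> carries a path to the path
  between the images of its end points under an affine map (\<open>sigma_shift\<close>, \<open>tau_shift\<close> below), up to
  the sign \<open>det A\<^sub>\<sigma>\<close>. The flux of a chain through a potential \<open>h\<close> expresses this without mentioning paths.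
\<close>

fun head :: "(int ^ 2) \<times> 2 \<Rightarrow> int ^ 2" where
  "head (x, i) = (if i = 1 then x else x + pt 1 0)"

fun tail :: "(int ^ 2) \<times> 2 \<Rightarrow> int ^ 2" where
  "tail (x, i) = (if i = 1 then x + pt 0 1 else x)"

text \<open>The pairing of \<open>h\<close> with the boundary of a chain. It is read off as the
  coefficient of the only generator of the free abelian group on \<open>unit\<close>, so that
  additivity is inherited from \<open>frag_extend\<close>.\<close>

definition flux :: "(int ^ 2 \<Rightarrow> int) \<Rightarrow> chain \<Rightarrow> int" where
  "flux h c = Poly_Mapping.lookup (frag_extend (\<lambda>s. frag_cmul (h (head s) - h (tail s)) (frag_of ())) c) ()"

lemma flux_simps [simp]:
  "flux h (frag_of s) = h (head s) - h (tail s)"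
  "flux h (c + c') = flux h c + flux h c'"
  "flux h (c - c') = flux h c - flux h c'"
  "flux h (- c) = - flux h c"
  "flux h 0 = 0"
  by (simp_all add: flux_def frag_extend_add frag_extend_diff frag_extend_minus lookup_add lookup_minus)

lemma flux_sum [simp]: "flux h (\<Sum>k\<in>A. c k) = (\<Sum>k\<in>A. flux h (c k))"
  by (induction A rule: infinite_finite_induct) simp_all

lemma flux_nonzero:
  assumes "flux h c \<noteq> 0"
  obtains s where "s \<in> Poly_Mapping.keys c" "h (head s) \<noteq> h (tail s)"
proof -
  have "flux h c = (\<Sum>s\<in>Poly_Mapping.keys c. Poly_Mapping.lookup c s * (h (head s) - h (tail s)))"
    by (simp add: flux_def frag_extend_def lookup_sum)
  moreover have "\<dots> = 0" if "\<forall>s\<in>Poly_Mapping.keys c. h (head s) = h (tail s)"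
    using that by (intro sum.neutral) simp
  ultimately have "\<not> (\<forall>s\<in>Poly_Mapping.keys c. h (head s) = h (tail s))"
    using assms by metis
  then show thesis using that by auto
qed

lemma tiling_subst_linear:
  "tiling_subst \<rho> 0 = 0" "tiling_subst \<rho> (c - c') = tiling_subst \<rho> c - tiling_subst \<rho> c'"
  "tiling_subst \<rho> (c + c') = tiling_subst \<rho> c + tiling_subst \<rho> c'"
  by (simp_all add: tiling_subst_def frag_extend_diff frag_extend_add)

definition supported :: "((int ^ 2) \<times> 2 \<Rightarrow> bool) \<Rightarrow> chain \<Rightarrow> bool" where
  "supported P c \<longleftrightarrow> (\<forall>s\<in>Poly_Mapping.keys c. P s)"

lemma supported_intros:
  "P s \<Longrightarrow> supported P (frag_of s)"
  "supported P c \<Longrightarrow> supported P (- c)"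
  "supported P c \<Longrightarrow> supported P c' \<Longrightarrow> supported P (c + c')"
  "supported P c \<Longrightarrow> supported P c' \<Longrightarrow> supported P (c - c')"
  using keys_add[of c c'] keys_diff[of c c'] by (auto simp: supported_def)

lemma supported_sum: "(\<And>k. k \<in> A \<Longrightarrow> supported P (f k)) \<Longrightarrow> supported P (\<Sum>k\<in>A. f k)"
  by (induction A rule: infinite_finite_induct) (simp_all add: supported_intros, simp_all add: supported_def)

lemma supported_frag_extend:
  assumes "\<And>s. P s \<Longrightarrow> supported Q (f s)" "supported P c"
  shows "supported Q (frag_extend f c)"
  using assms keys_frag_extend[of f c] unfolding supported_def by blast

definition phi :: "(2 \<Rightarrow> real) \<Rightarrow> int ^ 2 \<Rightarrow> real" where
  "phi f x = f 1 * x $ 1 + f 2 * x $ 2"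

lemma phi_pt: "phi f (pt p q) = f 1 * p + f 2 * q"
  by (simp add: phi_def)

definition spans :: "(2 \<Rightarrow> real) \<Rightarrow> real \<Rightarrow> real \<Rightarrow> (int ^ 2) \<times> 2 \<Rightarrow> bool" where
  "spans f u v s \<longleftrightarrow> phi f (head s) \<in> closed_segment u v \<and> phi f (tail s) \<in> closed_segment u v"

text \<open>The linear part is the inverse incidence matrix. The constant is the one for which head
  and tail go to the end points of the image path, with the two roles swapped when the determinant
  is \<open>-1\<close>.\<close>

fun sigma_shift :: "family \<Rightarrow> int \<Rightarrow> int ^ 2 \<Rightarrow> int ^ 2" where
  "sigma_shift T1 a x = pt (a * x $ 1 + x $ 2 + 2 - a) (1 - x $ 1)"
| "sigma_shift T2 a x = pt (a * x $ 1 + x $ 2) (1 - x $ 1)"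
| "sigma_shift T4 a x = pt (- a * x $ 1 + x $ 2 + a) (x $ 1)"

fun tau_shift :: "family \<Rightarrow> int \<Rightarrow> int ^ 2 \<Rightarrow> int ^ 2" where
  "tau_shift T1 a x = pt ((a - 1) * x $ 1 - x $ 2) ((2 - a) * x $ 1 + x $ 2 + 1)"
| "tau_shift T2 a x = pt ((a + 1) * x $ 1 + x $ 2) ((- a - 2) * x $ 1 - x $ 2 + 1)"
| "tau_shift T4 a x = pt (- a * x $ 1 - x $ 2 + 1) (1 - x $ 1)"

section \<open>Image paths: their end points and projections\<close>

lemma telescope_up:
  "(\<Sum>k<n. h (pt (x + int k + 1) y) - h (pt (x + int k) y)) = h (pt (x + int n) y) - (h (pt x y) :: int)"
  by (induction n) (auto simp: algebra_simps)

lemma telescope_down: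
  "(\<Sum>k<n. h (pt (x - int k) y) - h (pt (x - int k - 1) y)) = h (pt x y) - (h (pt (x - int n) y) :: int)"
  by (induction n) (auto simp: algebra_simps)

text \<open>A staircase of alternating vertical and horizontal unit segments; the two sums telescope
  only together.\<close>

lemma telescope_diagonal:
  "(\<Sum>k<n. h (pt (x - int k) (y + int k)) - h (pt (x - int k) (y + int k + 1)))
   + (\<Sum>k<n. h (pt (x - int k + 1) (y + int k)) - h (pt (x - int k) (y + int k)))
   = h (pt (x + 1) y) - (h (pt (x + 1 - int n) (y + int n)) :: int)"
  by (induction n) (auto simp: algebra_simps)

text \<open>The segments in the image of one symbol form a path, so inner vertices drop out by
  telescoping; the factor is the determinant of the incidence matrix.\<close>

lemma flux_sigma_generator:
  assumes "admissible t a"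
  shows "flux h (tiling_subst (sigma t a) (frag_of s)) =
    (if t = T4 then - 1 else 1) * flux (h \<circ> sigma_shift t a) (frag_of s)"
proof -
  obtain x i where s: "s = (x, i)" by (cases s)
  obtain p q where x: "x = pt p q" by (rule pt_cases)
  show ?thesis
  proof (cases t)
    case T1
    have a: "int (nat (a - 2)) = a - 2" using assms T1 by simp
    show ?thesis
    proof (cases "i = 1")
      case True
      then show ?thesis
        unfolding s x T1 True tiling_sigma(1)[OF assms T1, unfolded T1] by (simp add: algebra_simps)
    next
      case False
      then have i: "i = 2" using exhaust_2 by auto
      show ?thesis
        using telescope_up[of h "a * p + q + 2 - a" "1 - p" "nat (a - 2)", unfolded a]
        unfolding s x T1 i tiling_sigma(2)[OF assms T1, unfolded T1] by (simp add: algebra_simps)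
    qed
  next
    case T2
    have a: "int (nat (- a)) = - a" using assms T2 by simp
    show ?thesis
    proof (cases "i = 1")
      case True
      then show ?thesis
        unfolding s x T2 True tiling_sigma(3)[OF assms T2, unfolded T2] by (simp add: algebra_simps)
    next
      case False
      then have i: "i = 2" using exhaust_2 by auto
      show ?thesis
        using telescope_down[of h "a * p + q" "- p" "nat (- a)", unfolded a]
        unfolding s x T2 i tiling_sigma(4)[OF assms T2, unfolded T2] by (simp add: algebra_simps)
    qed
  next
    case T4
    have a: "int (nat (- a)) = - a" using assms T4 by simp
    show ?thesis
    proof (cases "i = 1")
      case True
      then show ?thesis
        unfolding s x T4 True tiling_sigma(5)[OF assms T4, unfolded T4] by (simp add: algebra_simps)
    next
      case False
      then have i: "i = 2" using exhaust_2 by auto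
      show ?thesis
        using telescope_down[of h "- a * p + q" p "nat (- a)", unfolded a]
        unfolding s x T4 i tiling_sigma(6)[OF assms T4, unfolded T4] by (simp add: algebra_simps)
    qed
  qed
qed

lemma flux_tau_generator:
  assumes "admissible t a"
  shows "flux h (tiling_subst (tau t a) (frag_of s)) =
    (if t = T4 then - 1 else 1) * flux (h \<circ> tau_shift t a) (frag_of s)"
proof -
  obtain x i where s: "s = (x, i)" by (cases s)
  obtain p q where x: "x = pt p q" by (rule pt_cases)
  show ?thesis
  proof (cases t)
    case T1
    have a: "int (nat (a - 3)) = a - 3" "nat (a - 2) = Suc (nat (a - 3))" "3 \<le> a" using assms T1 by auto
    show ?thesis
    proof (cases "i = 1")
      case True
      then show ?thesis
        unfolding s x T1 True tiling_tau(1)[OF assms T1, unfolded T1] by (simp add: algebra_simps)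
    next
      case False
      then have i: "i = 2" using exhaust_2 by auto
      show ?thesis
        using telescope_diagonal[of h "(a - 1) * p - q + a - 2" "(2 - a) * p + q + 3 - a" "nat (a - 3)", unfolded a(1)]
        unfolding s x T1 i tiling_tau(2)[OF assms T1, unfolded T1] a(2) by (simp add: a algebra_simps)
    qed
  next
    case T2
    have a: "int (nat (- a - 2)) = - a - 2" "nat (- a - 1) = Suc (nat (- a - 2))" "2 \<le> - a" using assms T2 by auto
    show ?thesis
    proof (cases "i = 1")
      case True
      then show ?thesis
        unfolding s x T2 True tiling_tau(3)[OF assms T2, unfolded T2] by (simp add: algebra_simps) (rule arg_cong[of _ _ h], simp add: pt_eq_iff)
    next
      case False
      then have i: "i = 2" using exhaust_2 by auto
      show ?thesis
        using telescope_diagonal[of h "(a + 1) * p + q - 1" "(- a - 2) * p - q + 1" "nat (- a - 2)", unfolded a(1)]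
        unfolding s x T2 i tiling_tau(4)[OF assms T2, unfolded T2] a(2) by (simp add: a algebra_simps)
    qed
  next
    case T4
    have a: "int (nat (- a)) = - a" using assms T4 by simp
    show ?thesis
    proof (cases "i = 1")
      case True
      then show ?thesis
        unfolding s x T4 True tiling_tau(5)[OF assms T4, unfolded T4] by (simp add: algebra_simps) (rule arg_cong[of _ _ h], simp add: pt_eq_iff)
    next
      case False
      then have i: "i = 2" using exhaust_2 by auto
      show ?thesis
        using telescope_up[of h "- a * p - q + 1" "- p" "nat (- a)", unfolded a]
        unfolding s x T4 i tiling_tau(6)[OF assms T4, unfolded T4] by (simp add: algebra_simps)
    qed
  qed
qed

lemma flux_linear_extension:
  assumes "\<And>s. flux h (tiling_subst \<rho> (frag_of s)) = d * flux h' (frag_of s)"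
  shows "flux h (tiling_subst \<rho> c) = d * flux h' c"
  using subset_UNIV[of "Poly_Mapping.keys c"]
proof (induction c rule: frag_induction)
  case (diff a b)
  then show ?case by (simp add: tiling_subst_linear algebra_simps)
qed (use assms in \<open>simp_all add: tiling_subst_linear\<close>)

lemma phi_add: "phi f (x + y) = phi f x + phi f y"
  by (simp add: phi_def algebra_simps)

lemma spansI_le:
  assumes "u \<le> phi f (head s)" "phi f (head s) \<le> v" "u \<le> phi f (tail s)" "phi f (tail s) \<le> v"
  shows "spans f u v s"
  using assms by (auto simp: spans_def closed_segment_eq_real_ivl)

lemma spansI_ge:
  assumes "v \<le> phi f (head s)" "phi f (head s) \<le> u" "v \<le> phi f (tail s)" "phi f (tail s) \<le> u"
  shows "spans f u v s"
  using assms by (auto simp: spans_def closed_segment_eq_real_ivl)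

definition unit_steps :: "real \<Rightarrow> 2 \<Rightarrow> real" where
  "unit_steps l i = (if i = 1 then 1 else l)"

lemma unit_steps_simps [simp]: "unit_steps l 1 = 1" "unit_steps l 2 = l"
  by (simp_all add: unit_steps_def)

context
  fixes t :: family and a :: int and l :: real
  assumes adm: "admissible t a" and root: "contracting_root t a l"
begin

text \<open>For \<open>T1\<close> the image path of a type-2 symbol backtracks by \<open>l\<close>,
  but within the interval, because \<open>a - 2 >= 1 > l\<close>. For \<open>T2\<close> containment
  fails: with \<open>l < 0\<close> the vertical segment in the image of a type-2 symbol projects
  beyond the end points.\<close>

lemma sigma_spans:
  assumes "t \<noteq> T2"
  shows "supported (spans (unit_steps l) (phi (unit_steps l) (sigma_shift t a (head s))) (phi (unit_steps l) (sigma_shift t a (tail s))))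
    (tiling_subst (sigma t a) (frag_of s))"
proof -
  obtain x i where s: "s = (x, i)" by (cases s)
  obtain p q where x: "x = pt p q" by (rule pt_cases)
  have i: "i = 1 \<or> i = 2" using exhaust_2 by auto
  show ?thesis
  proof (cases t)
    case T1
    have a: "a \<ge> 3" and l: "0 < l" "l < 1" using adm root T1 by auto
    have k: "0 \<le> real k \<and> real k + 3 \<le> a" if "k < nat (a - 2)" for k
      using that a by linarith
    from i show ?thesis
    proof (elim disjE)
      assume i: "i = 1"
      show ?thesis
        unfolding s x T1 i tiling_sigma(1)[OF adm T1, unfolded T1]
        by (intro supported_intros supported_sum spansI_le) (use l in \<open>simp_all add: phi_pt algebra_simps\<close>)
    next
      assume i: "i = 2"
      show ?thesis
        unfolding s x T1 i tiling_sigma(2)[OF adm T1, unfolded T1]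
        by (intro supported_intros supported_sum spansI_ge; (drule k[OF iffD1[OF lessThan_iff]])?)
           (use a l in \<open>simp_all add: phi_pt algebra_simps\<close>)
    qed
  next
    case T2 with assms show ?thesis by simp
  next
    case T4
    have a: "a \<le> - 1" and l: "0 < l" "l < 1" using adm root T4 by auto
    have k: "0 \<le> real k \<and> real k + 1 \<le> - a" if "k < nat (- a)" for k
      using that a by linarith
    from i show ?thesis
    proof (elim disjE)
      assume i: "i = 1"
      show ?thesis
        unfolding s x T4 i tiling_sigma(5)[OF adm T4, unfolded T4]
        by (intro supported_intros supported_sum spansI_le) (use l in \<open>simp_all add: phi_pt algebra_simps\<close>)
    next
      assume i: "i = 2"
      show ?thesis
        unfolding s x T4 i tiling_sigma(6)[OF adm T4, unfolded T4]
        by (intro supported_intros supported_sum spansI_ge; (drule k[OF iffD1[OF lessThan_iff]])?)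
           (use a l in \<open>simp_all add: phi_pt algebra_simps\<close>)
    qed
  qed
qed

text \<open>The letters in the words of \<open>tau\<close> all have one sign and the two
  translations are opposite, so every segment of the image path projects in the same direction: the
  path is monotone.\<close>

lemma tau_spans:
  "supported (spans (tau_steps t l) (phi (tau_steps t l) (tau_shift t a (head s))) (phi (tau_steps t l) (tau_shift t a (tail s))))
    (tiling_subst (tau t a) (frag_of s))"
proof -
  obtain x i where s: "s = (x, i)" by (cases s)
  obtain p q where x: "x = pt p q" by (rule pt_cases)
  have i: "i = 1 \<or> i = 2" using exhaust_2 by auto
  show ?thesis
  proof (cases t)
    case T1
    have a: "a \<ge> 3" and l: "0 < l" "l < 1" using adm root T1 by auto
    have k: "0 \<le> real k \<and> real k + 3 \<le> a" if "k < nat (a - 2)" for k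
      using that a by linarith
    have k': "0 \<le> real k \<and> real k + 4 \<le> a" if "k < nat (a - 3)" for k
      using that a by linarith
    from i show ?thesis
    proof (elim disjE)
      assume i: "i = 1"
      show ?thesis
        unfolding s x T1 i tiling_tau(1)[OF adm T1, unfolded T1]
        by (intro supported_intros supported_sum spansI_le) (use l in \<open>simp_all add: phi_pt algebra_simps\<close>)
    next
      assume i: "i = 2"
      show ?thesis
        unfolding s x T1 i tiling_tau(2)[OF adm T1, unfolded T1]
        by (intro supported_intros supported_sum spansI_le; (drule k[OF iffD1[OF lessThan_iff]] k'[OF iffD1[OF lessThan_iff]])?)
           (use a l in \<open>simp_all add: phi_pt algebra_simps\<close>)
    qed
  next
    case T2
    have a: "a \<le> - 3" and l: "- 1 < l" "l < 0" using adm root T2 by auto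
    have k: "0 \<le> real k \<and> real k + 2 \<le> - a" if "k < nat (- a - 1)" for k
      using that a by linarith
    have k': "0 \<le> real k \<and> real k + 3 \<le> - a" if "k < nat (- a - 2)" for k
      using that a by linarith
    from i show ?thesis
    proof (elim disjE)
      assume i: "i = 1"
      show ?thesis
        unfolding s x T2 i tiling_tau(3)[OF adm T2, unfolded T2]
        by (intro supported_intros supported_sum spansI_le) (use l in \<open>simp_all add: phi_pt algebra_simps\<close>)
    next
      assume i: "i = 2"
      show ?thesis
        unfolding s x T2 i tiling_tau(4)[OF adm T2, unfolded T2]
        by (intro supported_intros supported_sum spansI_le; (drule k[OF iffD1[OF lessThan_iff]] k'[OF iffD1[OF lessThan_iff]])?)
           (use a l in \<open>simp_all add: phi_pt algebra_simps\<close>)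
    qed
  next
    case T4
    have a: "a \<le> - 1" and l: "0 < l" "l < 1" using adm root T4 by auto
    have k: "0 \<le> real k \<and> real k + 1 \<le> - a" if "k < nat (- a)" for k
      using that a by linarith
    from i show ?thesis
    proof (elim disjE)
      assume i: "i = 1"
      show ?thesis
        unfolding s x T4 i tiling_tau(5)[OF adm T4, unfolded T4]
        by (intro supported_intros supported_sum spansI_le) (use l in \<open>simp_all add: phi_pt algebra_simps\<close>)
    next
      assume i: "i = 2"
      show ?thesis
        unfolding s x T4 i tiling_tau(6)[OF adm T4, unfolded T4]
        by (intro supported_intros supported_sum spansI_le; (drule k[OF iffD1[OF lessThan_iff]])?)
           (use a l in \<open>simp_all add: phi_pt algebra_simps\<close>)
    qed
  qed
qed

text \<open>As \<open>(1, l)\<close> is a left eigenvector, the inverse matrix divides the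
  coordinate by \<open>l\<close>; the summand is \<open>l\<close> times the coordinate of the
  constant in \<open>sigma_shift\<close>.\<close>

lemma phi_sigma_shift:
  "l * phi (unit_steps l) (sigma_shift t a x) = phi (unit_steps l) x +
     (case t of T1 \<Rightarrow> 2 * l - 1 | T2 \<Rightarrow> l * l | T4 \<Rightarrow> l * a)"
proof -
  obtain p q where x: "x = pt p q" by (rule pt_cases)
  show ?thesis
  proof (cases t)
    case T1
    then have "l * l = a * l - 1" using root by simp
    then have *: "l * (a * P + Q + 2 - a + l * (1 - P)) = P + l * Q + (2 * l - 1)" for P Q :: real by algebra
    from this[where P = p and Q = q] show ?thesis by (simp add: T1 x phi_pt)
  next
    case T2
    then have "l * l = a * l - 1" using root by simp
    then have *: "l * (a * P + Q + l * (1 - P)) = P + l * Q + l * l" for P Q :: real by algebra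
    from this[where P = p and Q = q] show ?thesis by (simp add: T2 x phi_pt)
  next
    case T4
    then have "l * l = a * l + 1" using root by simp
    then have *: "l * (Q - a * P + a + l * P) = P + l * Q + l * a" for P Q :: real by algebra
    from this[where P = p and Q = q] show ?thesis by (simp add: T4 x phi_pt)
  qed
qed

lemma phi_tau_shift:
  "l * phi (tau_steps t l) (tau_shift t a x) = phi (tau_steps t l) x +
     (case t of T1 \<Rightarrow> l * l | T2 \<Rightarrow> l * l | T4 \<Rightarrow> l * (l - 1))"
proof -
  obtain p q where x: "x = pt p q" by (rule pt_cases)
  show ?thesis
  proof (cases t)
    case T1
    then have "l * l = a * l - 1" using root by simp
    then have *: "l * ((l - 1) * ((real_of_int a - 1) * P - Q) + l * ((2 - real_of_int a) * P + Q + 1)) = (l - 1) * P + l * Q + l * l" for P Q :: real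
      by algebra
    from this[where P = p and Q = q] show ?thesis by (simp add: T1 x phi_pt)
  next
    case T2
    then have "l * l = a * l - 1" using root by simp
    then have *: "l * ((l + 1) * ((real_of_int a + 1) * P + Q) + l * ((- real_of_int a - 2) * P - Q + 1)) = (l + 1) * P + l * Q + l * l" for P Q :: real
      by algebra
    from this[where P = p and Q = q] show ?thesis by (simp add: T2 x phi_pt)
  next
    case T4
    then have "l * l = a * l + 1" using root by simp
    then have *: "l * (- 1 * (- real_of_int a * P - Q + 1) + l * (1 - P)) = - 1 * P + l * Q + l * (l - 1)" for P Q :: real by algebra
    from this[where P = p and Q = q] show ?thesis by (simp add: T4 x phi_pt)
  qed
qed

end

section \<open>Eigenlines and renormalised limits\<close>

definition phi_real :: "(2 \<Rightarrow> real) \<Rightarrow> real ^ 2 \<Rightarrow> real" where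
  "phi_real f v = f 1 * v $ 1 + f 2 * v $ 2"

lemma linear_phi_real: "linear (phi_real f)"
  by (rule linearI) (simp_all add: phi_real_def algebra_simps)

lemma phi_real_vec: "phi_real f (real_vec x) = phi f x"
  by (simp add: phi_real_def real_vec_def phi_def)

definition shadow :: "(2 \<Rightarrow> real) \<Rightarrow> chain \<Rightarrow> real set" where
  "shadow f c = (\<Union>s\<in>Poly_Mapping.keys c. closed_segment (phi f (head s)) (phi f (tail s)))"

lemma phi_real_segment: "phi_real f ` segment s = closed_segment (phi f (head s)) (phi f (tail s))"
proof -
  obtain x i where s: "s = (x, i)" by (cases s)
  have i: "i = 1 \<or> i = 2" using exhaust_2 by auto
  have "phi_real f ` segment s = closed_segment (phi f x) (phi f x + phi_real f (axis (if i = 1 then 2 else 1) 1))"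
    unfolding s segment.simps closed_segment_linear_image[OF linear_phi_real, symmetric]
    by (simp add: phi_real_vec linear_add[OF linear_phi_real])
  also have "\<dots> = closed_segment (phi f (head s)) (phi f (tail s))"
    using i by (auto simp: s phi_real_def axis_def phi_add phi_pt closed_segment_commute)
  finally show ?thesis .
qed

lemma phi_real_geometric: "phi_real f ` geometric c = shadow f c"
  by (simp add: geometric_def shadow_def image_UN phi_real_segment)

text \<open>\<open>f\<close> is a left eigenvector for \<open>l\<close>, so the kernel of its
  functional is the eigenline of the other eigenvalue \<open>L\<close>, which enters through the
  trace.\<close>

locale eigenline =
  fixes A :: "real ^ 2 ^ 2" and p q r s l L :: real and f :: "2 \<Rightarrow> real"
  assumes A: "A = mat2 p q r s" and f1: "f 1 \<noteq> 0"
    and left: "f 1 * p + f 2 * r = l * f 1" "f 1 * q + f 2 * s = l * f 2"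
    and trace: "p + s = l + L" and contracting: "\<bar>l\<bar> < 1" and expanding: "1 < \<bar>L\<bar>"
begin

text \<open>The first column of \<open>A - L\<close> is an eigenvector for \<open>l\<close> by
  Cayley-Hamilton. The factor normalises it to \<open>phi_real f dir = 1\<close>, so that a point of
  the contracting line is its coordinate times \<open>dir\<close>.\<close>

definition dir :: "real ^ 2" where
  "dir = (1 / ((l - L) * f 1)) *\<^sub>R (\<chi> i. if i = 1 then p - L else r)"

lemma matrix_apply: "A *v v = (\<chi> i. if i = 1 then p * v $ 1 + q * v $ 2 else r * v $ 1 + s * v $ 2)"
  by (simp add: A vec_eq_iff forall_2 matrix_vector_mult_def sum_2)

lemma lL: "l - L \<noteq> 0" using contracting expanding by auto

lemma phi_dir: "phi_real f dir = 1"
proof -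
  have "f 1 * (p - L) + f 2 * r = (l - L) * f 1" using left by (simp add: algebra_simps)
  moreover have "phi_real f dir = 1 / ((l - L) * f 1) * (f 1 * (p - L) + f 2 * r)"
    by (simp add: phi_real_def dir_def algebra_simps add_divide_distrib diff_divide_distrib)
  ultimately show ?thesis using lL f1 by simp
qed

lemma apply_dir: "A *v dir = l *\<^sub>R dir"
proof -
  \<comment> \<open>A nonzero left null vector of \<open>A - l\<close> forces the determinant of
    \<open>A - l\<close> to vanish.\<close>
  have "f 1 * ((p - l) * (s - l) - q * r) = 0" using left by algebra
  then have det: "(p - l) * (s - l) = q * r" using f1 by simp
  have s: "s = l + L - p" using trace by simp
  have "p * (p - L) + q * r = l * (p - L)" "r * (p - L) + s * r = l * r"
    unfolding det[symmetric] s by (simp_all add: algebra_simps)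
  then have "A *v (\<chi> i. if i = 1 then p - L else r) = l *\<^sub>R (\<chi> i. if i = 1 then p - L else r)"
    by (simp add: matrix_apply vec_eq_iff forall_2)
  then show ?thesis by (simp add: dir_def matrix_vector_mult_scaleR)
qed

lemma phi_apply: "phi_real f (A *v v) = l * phi_real f v"
proof -
  have "phi_real f (A *v v) = (f 1 * p + f 2 * r) * v $ 1 + (f 1 * q + f 2 * s) * v $ 2"
    by (simp add: phi_real_def matrix_apply algebra_simps)
  then show ?thesis unfolding left by (simp add: phi_real_def algebra_simps)
qed

lemma apply_kernel:
  assumes "phi_real f v = 0" shows "A *v v = L *\<^sub>R v"
proof -
  have v: "v $ 1 = - f 2 * (v $ 2 / f 1)" "v $ 2 = f 1 * (v $ 2 / f 1)"
    using assms f1 by (auto simp: phi_real_def field_simps)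
  have "p * - f 2 + q * f 1 = L * - f 2" "r * - f 2 + s * f 1 = L * f 1"
  proof -
    have p: "p = l + L - s" and s: "s = l + L - p" using trace by simp_all
    show "p * - f 2 + q * f 1 = L * - f 2" unfolding p using left(2) by (simp add: algebra_simps)
    show "r * - f 2 + s * f 1 = L * f 1" unfolding s using left(1) by (simp add: algebra_simps)
  qed
  note * = this
  have "p * (- f 2 * k) + q * (f 1 * k) = L * (- f 2 * k)" "r * (- f 2 * k) + s * (f 1 * k) = L * (f 1 * k)" for k
    using arg_cong[OF *(1), of "\<lambda>x. x * k"] arg_cong[OF *(2), of "\<lambda>x. x * k"] by (simp_all add: algebra_simps)
  from this[of "v $ 2 / f 1"] show ?thesis
    unfolding v(1)[symmetric] v(2)[symmetric] by (simp add: matrix_apply vec_eq_iff forall_2)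
qed

lemma apply_contracting: "A *v v = l *\<^sub>R v \<longleftrightarrow> v = phi_real f v *\<^sub>R dir"
proof
  assume v: "A *v v = l *\<^sub>R v"
  define w where "w = v - phi_real f v *\<^sub>R dir"
  have "phi_real f w = 0"
    by (simp add: w_def linear_diff[OF linear_phi_real] linear_cmul[OF linear_phi_real] phi_dir)
  then have "A *v w = L *\<^sub>R w" by (rule apply_kernel)
  moreover have "A *v w = l *\<^sub>R w"
    by (simp add: w_def v matrix_vector_mult_diff_distrib matrix_vector_mult_scaleR apply_dir algebra_simps)
  ultimately have "(l - L) *\<^sub>R w = 0" by (simp add: algebra_simps)
  then show "v = phi_real f v *\<^sub>R dir" using lL by (simp add: w_def)
next
  assume "v = phi_real f v *\<^sub>R dir"
  then show "A *v v = l *\<^sub>R v"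
    by (metis apply_dir matrix_vector_mult_scaleR scaleR_left_commute)
qed

lemma apply_expanding: "A *v v = L *\<^sub>R v \<longleftrightarrow> phi_real f v = 0"
proof
  assume "A *v v = L *\<^sub>R v"
  then have "l * phi_real f v = L * phi_real f v"
    using phi_apply[of v] by (auto simp: linear_cmul[OF linear_phi_real])
  then have "(l - L) * phi_real f v = 0" by (auto simp: left_diff_distrib)
  then show "phi_real f v = 0" using lL by simp
qed (rule apply_kernel)

lemma is_eigenvalue_iff: "is_eigenvalue A x \<longleftrightarrow> x = l \<or> x = L"
proof
  assume "is_eigenvalue A x"
  then obtain v where v: "v \<noteq> 0" "A *v v = x *\<^sub>R v" by (auto simp: is_eigenvalue_def)
  show "x = l \<or> x = L"
  proof (cases "phi_real f v = 0")
    case True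
    then have "x *\<^sub>R v = L *\<^sub>R v" using apply_kernel v by simp
    then show ?thesis using v by simp
  next
    case False
    have "x * phi_real f v = l * phi_real f v"
      using phi_apply[of v] v by (simp add: linear_cmul[OF linear_phi_real])
    then show ?thesis using False by simp
  qed
next
  have "dir \<noteq> 0" using phi_dir linear_0[OF linear_phi_real, of f] by auto
  moreover have "(\<chi> i. if i = 1 then - f 2 else f 1) \<noteq> (0 :: real ^ 2)"
    using f1 by (auto simp: vec_eq_iff forall_2)
  moreover have "phi_real f (\<chi> i. if i = 1 then - f 2 else f 1) = 0" by (simp add: phi_real_def)
  moreover assume "x = l \<or> x = L"
  ultimately show "is_eigenvalue A x"
    using apply_dir apply_kernel unfolding is_eigenvalue_def by blast
qed

lemma contracting_line_eq: "contracting_line A = range (\<lambda>x. x *\<^sub>R dir)"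
proof -
  have "(THE x. is_eigenvalue A x \<and> \<bar>x\<bar> < 1) = l"
    using contracting expanding by (intro the_equality) (auto simp: is_eigenvalue_iff)
  then have "contracting_line A = {v. v = phi_real f v *\<^sub>R dir}"
    by (simp add: contracting_line_def eigenspace_def apply_contracting)
  also have "\<dots> = range (\<lambda>x. x *\<^sub>R dir)"
  proof (intro equalityI subsetI)
    fix v assume "v \<in> {v. v = phi_real f v *\<^sub>R dir}"
    then show "v \<in> range (\<lambda>x. x *\<^sub>R dir)" by blast
  next
    fix v assume "v \<in> range (\<lambda>x. x *\<^sub>R dir)"
    then show "v \<in> {v. v = phi_real f v *\<^sub>R dir}"
      by (auto simp: linear_cmul[OF linear_phi_real] phi_dir)
  qed
  finally show ?thesis .
qed

lemma expanding_line_eq: "expanding_line A = {v. phi_real f v = 0}"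
proof -
  have "(THE x. is_eigenvalue A x \<and> \<bar>x\<bar> > 1) = L"
    using contracting expanding by (intro the_equality) (auto simp: is_eigenvalue_iff)
  then show ?thesis by (simp add: expanding_line_def eigenspace_def apply_expanding)
qed

lemma eigenprojection_eq: "eigenprojection A v = phi_real f v *\<^sub>R dir"
  unfolding eigenprojection_def contracting_line_eq expanding_line_eq
  by (rule the_equality)
    (auto simp: linear_diff[OF linear_phi_real] linear_cmul[OF linear_phi_real] phi_dir)

lemma funpow_apply: "((*v) A ^^ n) (x *\<^sub>R dir) = (l ^ n * x) *\<^sub>R dir"
  by (induction n) (simp_all add: matrix_vector_mult_scaleR apply_dir)

lemma dir_nonzero: "dir \<noteq> 0"
  using phi_dir linear_0[OF linear_phi_real, of f] by auto

text \<open>With \<open>dir\<close> as unit, renormalisation is multiplication of the shadow by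
  \<open>l ^ n\<close>, and the limit becomes a question about subsets of the real line.\<close>

lemma scaled_geometric:
  "((*v) A ^^ n) ` eigenprojection A ` geometric c = (\<lambda>x. x *\<^sub>R dir) ` (\<lambda>x. l ^ n * x) ` shadow f c"
  unfolding phi_real_geometric[symmetric] image_image eigenprojection_eq funpow_apply ..

end

section \<open>Hausdorff limits of renormalised sets\<close>

lemma hausdorff_dist_le:
  assumes "A \<noteq> {}" "B \<noteq> {}" "\<And>x. x \<in> A \<Longrightarrow> infdist x B \<le> e" "\<And>y. y \<in> B \<Longrightarrow> infdist y A \<le> e"
  shows "hausdorff_dist A B \<le> e" "0 \<le> hausdorff_dist A B"
proof -
  show "hausdorff_dist A B \<le> e"
    unfolding hausdorff_dist_def using assms by (auto intro: cSUP_least)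
  obtain x where "x \<in> A" using assms(1) by auto
  then have "infdist x B \<le> (SUP x\<in>A. infdist x B)"
    using assms(3) by (intro cSUP_upper bdd_aboveI2[where M = e])
  then show "0 \<le> hausdorff_dist A B"
    unfolding hausdorff_dist_def using infdist_nonneg[of x B] by linarith
qed

text \<open>Compactness bounds the distances, so that the \<open>SUP\<close> in the definition is a
  genuine upper bound.\<close>

lemma infdist_le_hausdorff_dist:
  assumes "compact A"
  shows "x \<in> A \<Longrightarrow> infdist x B \<le> hausdorff_dist A B" "x \<in> A \<Longrightarrow> infdist x B \<le> hausdorff_dist B A"
proof -
  have "bdd_above ((\<lambda>x. infdist x B) ` A)"
    using assms by (intro bounded_imp_bdd_above compact_imp_bounded compact_continuous_image continuous_intros)
  then have *: "x \<in> A \<Longrightarrow> infdist x B \<le> (SUP x\<in>A. infdist x B)" by (rule cSUP_upper[rotated])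
  show "x \<in> A \<Longrightarrow> infdist x B \<le> hausdorff_dist A B" "x \<in> A \<Longrightarrow> infdist x B \<le> hausdorff_dist B A"
    using * unfolding hausdorff_dist_def by linarith+
qed

text \<open>Triangle inequality through a nearest point of \<open>S n\<close>. Applied both ways it
  gives uniqueness of limits, needed because \<open>hausdorff_lim\<close> is a definite
  description.\<close>

lemma hausdorff_limit_subset:
  fixes S :: "nat \<Rightarrow> 'a::heine_borel set"
  assumes S: "\<And>n. compact (S n)" "\<And>n. S n \<noteq> {}" and K: "compact K" "K \<noteq> {}" "compact K'" "K' \<noteq> {}"
    and lim: "(\<lambda>n. hausdorff_dist (S n) K) \<longlonglongrightarrow> 0" "(\<lambda>n. hausdorff_dist (S n) K') \<longlonglongrightarrow> 0"
  shows "K \<subseteq> K'"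
proof
  fix x assume x: "x \<in> K"
  have "infdist x K' \<le> hausdorff_dist (S n) K + hausdorff_dist (S n) K'" for n
  proof -
    obtain y where y: "y \<in> S n" "infdist x (S n) = dist x y"
      using infdist_attains_inf[of "S n" x] S compact_imp_closed by metis
    have "infdist x K' \<le> infdist y K' + dist x y" by (rule infdist_triangle)
    moreover have "infdist y K' \<le> hausdorff_dist (S n) K'"
      by (rule infdist_le_hausdorff_dist(1)[OF S(1) y(1)])
    moreover have "dist x y \<le> hausdorff_dist (S n) K"
      using infdist_le_hausdorff_dist(2)[OF K(1) x, of "S n"] y(2) by simp
    ultimately show ?thesis by linarith
  qed
  moreover have "(\<lambda>n. hausdorff_dist (S n) K + hausdorff_dist (S n) K') \<longlonglongrightarrow> 0 + 0"
    by (intro tendsto_add lim)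
  ultimately have "infdist x K' \<le> 0 + 0" by (intro LIMSEQ_le_const) auto
  then have "infdist x K' = 0" using infdist_nonneg[of x K'] by simp
  then show "x \<in> K'"
    using in_closed_iff_infdist_zero[of K' x] K compact_imp_closed by auto
qed

lemma hausdorff_limI:
  fixes S :: "nat \<Rightarrow> 'a::heine_borel set"
  assumes S: "\<And>n. compact (S n)" "\<And>n. S n \<noteq> {}" and K: "compact K" "K \<noteq> {}"
    and e: "e \<longlonglongrightarrow> 0" "\<And>n x. x \<in> S n \<Longrightarrow> infdist x K \<le> e n" "\<And>n y. y \<in> K \<Longrightarrow> infdist y (S n) \<le> e n"
  shows "hausdorff_lim S = K"
proof -
  have lim: "(\<lambda>n. hausdorff_dist (S n) K) \<longlonglongrightarrow> 0"
    using hausdorff_dist_le[OF S(2) K(2) e(2,3)]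
    by (intro tendsto_sandwich[OF _ _ tendsto_const e(1)]) auto
  show ?thesis
    unfolding hausdorff_lim_def
  proof (rule the_equality)
    show "compact K \<and> K \<noteq> {} \<and> (\<lambda>n. hausdorff_dist (S n) K) \<longlonglongrightarrow> 0" using K lim by simp
  next
    fix K' assume K': "compact K' \<and> K' \<noteq> {} \<and> (\<lambda>n. hausdorff_dist (S n) K') \<longlonglongrightarrow> 0"
    then show "K' = K"
      using hausdorff_limit_subset[of S K K'] hausdorff_limit_subset[of S K' K] S K lim by auto
  qed
qed

lemma funpow_affine:
  fixes g :: "real \<Rightarrow> real"
  assumes "\<And>x. l * g x = x + k" "\<bar>l\<bar> < 1"
  shows "l ^ n * (g ^^ n) x = x + k * (1 - l ^ n) / (1 - l)"
proof (induction n)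
  case (Suc n)
  have "l ^ Suc n * (g ^^ Suc n) x = l ^ n * (l * g ((g ^^ n) x))" by simp
  also have "\<dots> = l ^ n * (g ^^ n) x + l ^ n * k" unfolding assms(1) by (simp add: algebra_simps)
  also have "\<dots> = x + (k * (1 - l ^ n) / (1 - l) + l ^ n * k)" unfolding Suc by simp
  also have "k * (1 - l ^ n) / (1 - l) + l ^ n * k = k * (1 - l ^ Suc n) / (1 - l)"
    using assms(2) by (simp add: field_simps)
  finally show ?case .
qed simp

text \<open>The fixed point of \<open>g\<close> is \<open>- k / (1 - l)\<close>, hence
  \<open>l ^ n * (g ^^ n) x\<close> tends to \<open>x + k / (1 - l)\<close>. The slack
  \<open>M\<close> is the same for all \<open>n\<close>, so its multiple by \<open>|l| ^ n\<close>
  vanishes in the limit.\<close>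

lemma (in eigenline) rauzy_limit_eq:
  assumes \<rho>: "A = real_incidence_matrix \<rho>" and l0: "l \<noteq> 0"
    and g: "\<And>x. l * g x = x + k"
    and lower: "\<And>n x. x \<in> closed_segment u v \<Longrightarrow> (g ^^ n) x \<in> shadow f ((tiling_subst \<rho> ^^ n) c)"
    and upper: "\<And>n y. y \<in> shadow f ((tiling_subst \<rho> ^^ n) c) \<Longrightarrow> \<exists>x\<in>closed_segment u v. \<bar>y - (g ^^ n) x\<bar> \<le> M"
  shows "rauzy_limit \<rho> c = (\<lambda>x. x *\<^sub>R dir) ` closed_segment (u + k / (1 - l)) (v + k / (1 - l))"
proof -
  define \<kappa> where "\<kappa> = k / (1 - l)"
  define S where "S n = (\<lambda>x. l ^ n * x) ` shadow f ((tiling_subst \<rho> ^^ n) c)" for n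
  \<comment> \<open>The slack of the containment plus the part of the drift not yet accumulated,
    both of order \<open>|l| ^ n\<close>.\<close>
  define e where "e n = (\<bar>l\<bar> ^ n * M + \<bar>l\<bar> ^ n * \<bar>\<kappa>\<bar>) * norm dir" for n
  have K: "closed_segment (u + \<kappa>) (v + \<kappa>) = (\<lambda>x. x + \<kappa>) ` closed_segment u v"
    using closed_segment_translation[of \<kappa> u v] by (simp add: add.commute)
  have lim: "e \<longlonglongrightarrow> 0"
    unfolding e_def using contracting by (auto intro!: tendsto_eq_intros LIMSEQ_power_zero)
  have scale: "l ^ n * (g ^^ n) x = x + \<kappa> - l ^ n * \<kappa>" for n x
    unfolding funpow_affine[OF g contracting] by (simp add: \<kappa>_def algebra_simps diff_divide_distrib)
  have S_sub: "\<exists>z\<in>closed_segment (u + \<kappa>) (v + \<kappa>). dist (y *\<^sub>R dir) (z *\<^sub>R dir) \<le> e n" if yS: "y \<in> S n" for y n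
  proof -
    obtain y' where y': "y' \<in> shadow f ((tiling_subst \<rho> ^^ n) c)" "y = l ^ n * y'"
      using yS by (auto simp: S_def)
    obtain x where x: "x \<in> closed_segment u v" "\<bar>y' - (g ^^ n) x\<bar> \<le> M" using upper[OF y'(1)] by auto
    have "y - (x + \<kappa>) = l ^ n * (y' - (g ^^ n) x) - l ^ n * \<kappa>"
      using scale[of n x] by (simp add: y' algebra_simps)
    then have "\<bar>y - (x + \<kappa>)\<bar> \<le> \<bar>l\<bar> ^ n * \<bar>y' - (g ^^ n) x\<bar> + \<bar>l\<bar> ^ n * \<bar>\<kappa>\<bar>"
      using abs_triangle_ineq4[of "l ^ n * (y' - (g ^^ n) x)" "l ^ n * \<kappa>"] by (simp add: abs_mult power_abs)
    also have "\<dots> \<le> \<bar>l\<bar> ^ n * M + \<bar>l\<bar> ^ n * \<bar>\<kappa>\<bar>" using x(2) by (simp add: mult_left_mono)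
    finally have "\<bar>y - (x + \<kappa>)\<bar> * norm dir \<le> e n" unfolding e_def by (simp add: mult_right_mono)
    then have "dist (y *\<^sub>R dir) ((x + \<kappa>) *\<^sub>R dir) \<le> e n"
      by (simp add: dist_norm scaleR_diff_left[symmetric])
    then show ?thesis using x(1) unfolding K by blast
  qed
  have K_sub: "\<exists>z\<in>S n. dist (y *\<^sub>R dir) (z *\<^sub>R dir) \<le> e n" if yK: "y \<in> closed_segment (u + \<kappa>) (v + \<kappa>)" for y n
  proof -
    obtain x where x: "x \<in> closed_segment u v" "y = x + \<kappa>" using yK unfolding K by auto
    have "0 \<le> M"
      using upper[OF lower[OF x(1), of 0]] by (meson abs_ge_zero order_trans)
    have "x + \<kappa> - l ^ n * \<kappa> \<in> S n"
      using lower[OF x(1), of n] scale[of n x] unfolding S_def by (metis image_eqI)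
    moreover have "dist (y *\<^sub>R dir) ((x + \<kappa> - l ^ n * \<kappa>) *\<^sub>R dir) \<le> e n"
    proof -
      have "dist (y *\<^sub>R dir) ((x + \<kappa> - l ^ n * \<kappa>) *\<^sub>R dir) = \<bar>l\<bar> ^ n * \<bar>\<kappa>\<bar> * norm dir"
        by (simp add: dist_norm scaleR_diff_left[symmetric] x abs_mult power_abs)
      also have "\<dots> \<le> e n" using \<open>0 \<le> M\<close> by (simp add: e_def distrib_right)
      finally show ?thesis .
    qed
    ultimately show ?thesis by blast
  qed
  have comp: "compact (shadow f c)" for c
    unfolding shadow_def by (intro compact_UN) auto
  have ne: "closed_segment (u + \<kappa>) (v + \<kappa>) \<noteq> {}" by simp
  have "hausdorff_lim (\<lambda>n. (\<lambda>x. x *\<^sub>R dir) ` S n) = (\<lambda>x. x *\<^sub>R dir) ` closed_segment (u + \<kappa>) (v + \<kappa>)"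
  proof (rule hausdorff_limI[OF _ _ _ _ lim])
    fix n
    show "compact ((\<lambda>x. x *\<^sub>R dir) ` S n)"
      unfolding S_def by (intro compact_continuous_image continuous_intros comp)
    show "(\<lambda>x. x *\<^sub>R dir) ` S n \<noteq> {}"
      using K_sub ends_in_segment(1)[of "u + \<kappa>" "v + \<kappa>"] by blast
  next
    fix n x assume "x \<in> (\<lambda>x. x *\<^sub>R dir) ` S n"
    then obtain y where y: "y \<in> S n" "x = y *\<^sub>R dir" by auto
    from S_sub[OF y(1)] y(2) show "infdist x ((\<lambda>x. x *\<^sub>R dir) ` closed_segment (u + \<kappa>) (v + \<kappa>)) \<le> e n"
      by (auto intro: infdist_le2)
  next
    fix n x assume "x \<in> (\<lambda>x. x *\<^sub>R dir) ` closed_segment (u + \<kappa>) (v + \<kappa>)"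
    then obtain y where y: "y \<in> closed_segment (u + \<kappa>) (v + \<kappa>)" "x = y *\<^sub>R dir" by auto
    from K_sub[OF y(1), of n] y(2) show "infdist x ((\<lambda>x. x *\<^sub>R dir) ` S n) \<le> e n"
      by (auto intro: infdist_le2)
  next
    show "compact ((\<lambda>x. x *\<^sub>R dir) ` closed_segment (u + \<kappa>) (v + \<kappa>))"
      by (intro compact_continuous_image continuous_intros) auto
  qed simp
  then show ?thesis
    unfolding rauzy_limit_def Let_def \<rho>[symmetric] scaled_geometric S_def \<kappa>_def by simp
qed

section \<open>Crossing a level and staying in the hull under iteration\<close>

definition threshold :: "(2 \<Rightarrow> real) \<Rightarrow> (real \<Rightarrow> bool) \<Rightarrow> int ^ 2 \<Rightarrow> int" where
  "threshold f P x = (if P (phi f x) then 1 else 0)"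

text \<open>Both half-lines are needed: a negative \<open>l\<close> exchanges strict and weak
  inequality, and at an end point of a single segment only one of the two detects the
  segment.\<close>

definition crosses :: "(2 \<Rightarrow> real) \<Rightarrow> real \<Rightarrow> chain \<Rightarrow> bool" where
  "crosses f x c \<longleftrightarrow> flux (threshold f (\<lambda>y. x \<le> y)) c \<noteq> 0 \<or> flux (threshold f (\<lambda>y. x < y)) c \<noteq> 0"

text \<open>A nonzero sum has a nonzero term, that is, a segment surviving in the chain whose
  projected ends are separated by \<open>x\<close>.\<close>

lemma crosses_mem_shadow:
  assumes "crosses f x c"
  shows "x \<in> shadow f c"
proof -
  obtain s where s: "s \<in> Poly_Mapping.keys c"
    "phi f (head s) \<le> x \<and> x \<le> phi f (tail s) \<or> phi f (tail s) \<le> x \<and> x \<le> phi f (head s)"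
    using assms unfolding crosses_def
  proof
    assume "flux (threshold f (\<lambda>y. x \<le> y)) c \<noteq> 0"
    then show thesis by (rule flux_nonzero) (auto simp: threshold_def split: if_splits intro!: that)
  next
    assume "flux (threshold f (\<lambda>y. x < y)) c \<noteq> 0"
    then show thesis by (rule flux_nonzero) (auto simp: threshold_def split: if_splits intro!: that)
  qed
  then have "x \<in> closed_segment (phi f (head s)) (phi f (tail s))"
    by (auto simp: closed_segment_eq_real_ivl)
  with s(1) show ?thesis by (auto simp: shadow_def)
qed

lemma crosses_step:
  assumes flux: "\<And>h s. flux h (tiling_subst \<rho> (frag_of s)) = d * flux (h \<circ> G) (frag_of s)" and d: "d \<noteq> 0"
    and G: "\<And>x. phi f (G x) = g (phi f x)" and g: "\<And>x. l * g x = x + k" and l: "l \<noteq> 0"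
    and c: "crosses f x c"
  shows "crosses f (g x) (tiling_subst \<rho> c)"
proof -
  have flux_image: "flux h (tiling_subst \<rho> c) = d * flux (h \<circ> G) c" for h
    by (rule flux_linear_extension) (rule flux)
  have g': "g y = (y + k) / l" for y using g[of y] l by (simp add: field_simps)
  show ?thesis
  proof (cases "l > 0")
    case True
    then have "g x \<le> g y \<longleftrightarrow> x \<le> y" "g x < g y \<longleftrightarrow> x < y" for y
      using True by (auto simp: g' divide_le_cancel divide_less_cancel)
    then have "threshold f (\<lambda>y. g x \<le> y) \<circ> G = threshold f (\<lambda>y. x \<le> y)"
      "threshold f (\<lambda>y. g x < y) \<circ> G = threshold f (\<lambda>y. x < y)"
      by (auto simp: threshold_def G fun_eq_iff)
    then show ?thesis using c d by (auto simp: crosses_def flux_image)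
  next
    case False
    then have "l < 0" using l by simp
    then have "g x \<le> g y \<longleftrightarrow> \<not> x < y" "g x < g y \<longleftrightarrow> \<not> x \<le> y" for y
      using \<open>l < 0\<close> by (auto simp: g' divide_le_cancel divide_less_cancel)
    \<comment> \<open>An order-reversing \<open>g\<close> turns a threshold into the complement of
      the other one, and complementing only changes the sign of the flux.\<close>
    then have eq: "threshold f (\<lambda>y. g x \<le> y) \<circ> G = (\<lambda>z. 1 - threshold f (\<lambda>y. x < y) z)"
      "threshold f (\<lambda>y. g x < y) \<circ> G = (\<lambda>z. 1 - threshold f (\<lambda>y. x \<le> y) z)"
      by (auto simp: threshold_def G fun_eq_iff)
    have compl: "flux (\<lambda>z. 1 - h z) c = - flux h c" for h
    proof -
      have "flux (\<lambda>z. 1 - h z) c = (\<Sum>s\<in>Poly_Mapping.keys c. Poly_Mapping.lookup c s * ((1 - h (head s)) - (1 - h (tail s))))"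
        "flux h c = (\<Sum>s\<in>Poly_Mapping.keys c. Poly_Mapping.lookup c s * (h (head s) - h (tail s)))"
        by (simp_all add: flux_def frag_extend_def lookup_sum)
      then show ?thesis by (simp add: sum_negf[symmetric] algebra_simps)
    qed
    show ?thesis using c d by (auto simp: crosses_def flux_image eq compl)
  qed
qed

lemma crosses_funpow:
  assumes flux: "\<And>h s. flux h (tiling_subst \<rho> (frag_of s)) = d * flux (h \<circ> G) (frag_of s)" and d: "d \<noteq> 0"
    and G: "\<And>x. phi f (G x) = g (phi f x)" and g: "\<And>x. l * g x = x + k" and l: "l \<noteq> 0"
    and c: "crosses f x c"
  shows "crosses f ((g ^^ n) x) ((tiling_subst \<rho> ^^ n) c)"
proof (induction n)
  case (Suc n)
  then show ?case using crosses_step[OF flux d G g l Suc] by simp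
qed (use c in simp)

lemma image_closed_segment_affine:
  fixes g :: "real \<Rightarrow> real"
  assumes "\<And>x. l * g x = x + k" "l \<noteq> 0"
  shows "g ` closed_segment u v = closed_segment (g u) (g v)"
proof -
  have g: "g x = x / l + k / l" for x
    using assms(1)[of x] assms(2) by (simp add: field_simps)
  have "linear (\<lambda>x. x / l)" by (rule linearI) (simp_all add: add_divide_distrib)
  from closed_segment_linear_image[OF this, of u v]
  have "closed_segment (u / l) (v / l) = (\<lambda>x. x / l) ` closed_segment u v" .
  moreover have "closed_segment (k / l + u / l) (k / l + v / l) = (+) (k / l) ` closed_segment (u / l) (v / l)"
    by (rule closed_segment_translation)
  ultimately show ?thesis unfolding g by (simp add: image_image add.commute)
qed

lemma spans_step:
  assumes spans: "\<And>s. supported (spans f (phi f (G (head s))) (phi f (G (tail s)))) (tiling_subst \<rho> (frag_of s))"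
    and G: "\<And>x. phi f (G x) = g (phi f x)" and g: "\<And>x. l * g x = x + k" and l: "l \<noteq> 0"
    and c: "supported (spans f u v) c"
  shows "supported (spans f (g u) (g v)) (tiling_subst \<rho> c)"
proof -
  define F where "F = (\<lambda>s. tiling_subst \<rho> (frag_of s))"
  have "tiling_subst \<rho> c = frag_extend F c"
    unfolding F_def tiling_subst_def by (simp add: case_prod_unfold)
  moreover have "supported (spans f (g u) (g v)) (F s)" if "spans f u v s" for s
  proof -
    have "phi f (G (head s)) \<in> closed_segment (g u) (g v)" "phi f (G (tail s)) \<in> closed_segment (g u) (g v)"
      using that unfolding spans_def G image_closed_segment_affine[OF g l, symmetric] by auto
    then have "closed_segment (phi f (G (head s))) (phi f (G (tail s))) \<subseteq> closed_segment (g u) (g v)"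
      by (simp add: closed_segment_subset)
    then show ?thesis using spans[of s] unfolding F_def supported_def spans_def by blast
  qed
  ultimately show ?thesis using supported_frag_extend[OF _ c] by metis
qed

lemma spans_funpow:
  assumes spans: "\<And>s. supported (spans f (phi f (G (head s))) (phi f (G (tail s)))) (tiling_subst \<rho> (frag_of s))"
    and G: "\<And>x. phi f (G x) = g (phi f x)" and g: "\<And>x. l * g x = x + k" and l: "l \<noteq> 0"
    and c: "supported (spans f u v) c"
  shows "supported (spans f ((g ^^ n) u) ((g ^^ n) v)) ((tiling_subst \<rho> ^^ n) c)"
proof (induction n)
  case (Suc n)
  then show ?case using spans_step[OF spans G g l Suc] by simp
qed (use c in simp)

lemma spans_shadow:
  assumes "supported (spans f u v) c" "y \<in> shadow f c"
  shows "y \<in> closed_segment u v"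
proof -
  obtain s where "s \<in> Poly_Mapping.keys c" "y \<in> closed_segment (phi f (head s)) (phi f (tail s))"
    using assms(2) by (auto simp: shadow_def)
  then show ?thesis
    using assms(1) closed_segment_subset[of "phi f (head s)" "closed_segment u v" "phi f (tail s)"]
    by (auto simp: supported_def spans_def)
qed

lemma closed_segment_funpow:
  fixes g :: "real \<Rightarrow> real"
  assumes "\<And>x. l * g x = x + k" "l \<noteq> 0"
  shows "(g ^^ n) ` closed_segment u v = closed_segment ((g ^^ n) u) ((g ^^ n) v)"
proof (induction n)
  case (Suc n)
  have "(g ^^ Suc n) ` closed_segment u v = g ` (g ^^ n) ` closed_segment u v" by (simp add: image_comp)
  then show ?case unfolding Suc image_closed_segment_affine[OF assms] by simp
qed simp

text \<open>The tiling substitution of \<open>delta T2\<close>, written out. Dualising reverses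
  products, so \<open>delta sigma = tau delta\<close> makes it intertwine the tiling substitutions
  of \<open>tau\<close> and \<open>sigma\<close>.\<close>

definition delta_dual :: "chain \<Rightarrow> chain" where
  "delta_dual = frag_extend (\<lambda>(x, i). let y = pt (x $ 1) (x $ 1 + x $ 2) in
     if i = 1 then frag_of (y, 1) else frag_of (y, 2) - frag_of (y + pt 1 0, 1))"

lemma delta_dual_simps:
  "delta_dual (frag_of (pt p q, 1)) = frag_of (pt p (p + q), 1)"
  "delta_dual (frag_of (pt p q, 2)) = frag_of (pt p (p + q), 2) - frag_of (pt (p + 1) (p + q), 1)"
  "delta_dual 0 = 0" "delta_dual (c + c') = delta_dual c + delta_dual c'"
  "delta_dual (c - c') = delta_dual c - delta_dual c'" "delta_dual (- c) = - delta_dual c"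
  by (simp_all add: delta_dual_def Let_def frag_extend_add frag_extend_diff frag_extend_minus)

lemma delta_dual_sum: "delta_dual (\<Sum>k\<in>A. c k) = (\<Sum>k\<in>A. delta_dual (c k))"
  by (induction A rule: infinite_finite_induct) (simp_all add: delta_dual_simps)

text \<open>For \<open>\<sigma>\<^sub>2\<close> the segments of \<open>\<sigma>\<^sup>*\<^sup>n c\<close> partly cancel, which is why they are controlled through \<open>\<tau>\<^sub>2\<close>.\<close>

lemma sigma_delta_dual_generator:
  assumes adm: "admissible T2 a"
  shows "tiling_subst (sigma T2 a) (delta_dual (frag_of s)) = delta_dual (tiling_subst (tau T2 a) (frag_of s))"
proof -
  obtain x i where s: "s = (x, i)" by (cases s)
  obtain p q where x: "x = pt p q" by (rule pt_cases)
  have i: "i = 1 \<or> i = 2" using exhaust_2 by auto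
  define n where "n = nat (- a - 2)"
  have n: "nat (- a) = Suc (Suc n)" "nat (- a - 1) = Suc n" "nat (- a - 2) = n" and a: "a = - int n - 2"
    using adm by (auto simp: n_def)
  note tiling = tiling_sigma(3,4)[OF adm refl] tiling_tau(3,4)[OF adm refl]
  show ?thesis
    using i unfolding s x
  proof (elim disjE)
    assume i: "i = 1"
    show "tiling_subst (sigma T2 a) (delta_dual (frag_of (pt p q, i))) = delta_dual (tiling_subst (tau T2 a) (frag_of (pt p q, i)))"
      unfolding i delta_dual_simps tiling
      by (simp add: delta_dual_simps algebra_simps del: sigma.simps tau.simps)
  next
    assume i: "i = 2"
    define z where "z = (a + 1) * p + q"
    define w where "w k = (frag_of (pt (z - int k) (- p), 1) :: chain)" for k
    \<comment> \<open>On the right-hand side below, vertical segments arise from both sums over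
      \<open>tau\<close>; the two families are shifted copies with opposite signs, and all but
      \<open>w 0\<close> cancel.\<close>
    have tel: "(\<Sum>k<Suc n. w k) - (\<Sum>k<n. w (Suc k)) = w 0"
      by (subst sum.lessThan_Suc_shift) simp
    have lhs: "tiling_subst (sigma T2 a) (delta_dual (frag_of (pt p q, 2))) =
        frag_of (pt z (- p), 1) - (\<Sum>k<Suc n. frag_of (pt (z - 1 - int k) (- p), 2))"
      unfolding delta_dual_simps tiling_subst_linear tiling n
      by (simp add: z_def a algebra_simps)
    have rhs: "delta_dual (tiling_subst (tau T2 a) (frag_of (pt p q, 2))) = 
        - (\<Sum>k<n. w (Suc k)) - (\<Sum>k<Suc n. frag_of (pt (z - 1 - int k) (- p), 2) - w k)"
      unfolding tiling n delta_dual_simps delta_dual_sum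
      by (intro arg_cong2[of _ _ _ _ "(-)"] arg_cong[of _ _ uminus] sum.cong refl)
         (auto simp: w_def z_def algebra_simps pt_eq_iff)
    have "frag_of (pt z (- p), 1) = (\<Sum>k<Suc n. w k) - (\<Sum>k<n. w (Suc k))"
      unfolding tel by (simp add: w_def)
    then show "tiling_subst (sigma T2 a) (delta_dual (frag_of (pt p q, i))) = delta_dual (tiling_subst (tau T2 a) (frag_of (pt p q, i)))"
      unfolding i lhs rhs sum_subtractf by simp
  qed
qed

lemma sigma_delta_dual:
  assumes adm: "admissible T2 a"
  shows "(tiling_subst (sigma T2 a) ^^ n) (delta_dual c) = delta_dual ((tiling_subst (tau T2 a) ^^ n) c)"
proof (induction n)
  case (Suc n)
  have "tiling_subst (sigma T2 a) (delta_dual c) = delta_dual (tiling_subst (tau T2 a) c)" for c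
    using subset_UNIV[of "Poly_Mapping.keys c"]
  proof (induction c rule: frag_induction)
    case (one x) show ?case by (rule sigma_delta_dual_generator[OF adm])
  qed (simp_all add: tiling_subst_linear delta_dual_simps del: sigma.simps tau.simps)
  then show ?case by (simp add: Suc del: sigma.simps tau.simps)
qed simp

section \<open>The fractals as intervals\<close>

lemma contracting_root_exists:
  assumes "admissible t a"
  obtains l where "contracting_root t a l"
proof (cases t)
  case T1
  define S where "S = sqrt (real_of_int a ^ 2 - 4)"
  have a: "3 \<le> real_of_int a" using assms T1 by simp
  have "3 ^ 2 \<le> real_of_int a ^ 2" using a by (intro power_mono) auto
  then have S2: "S * S = real_of_int a ^ 2 - 4" and "0 \<le> S" by (simp_all add: S_def)
  have "S < a" using a unfolding S_def by (intro real_less_lsqrt) auto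
  moreover have "a - 2 < S" using a unfolding S_def
    by (intro real_less_rsqrt) (simp add: power2_eq_square algebra_simps)
  ultimately show thesis
    using S2 T1 by (intro that[of "(a - S) / 2"]) (auto simp: field_simps power2_eq_square)
next
  case T2
  define S where "S = sqrt (real_of_int a ^ 2 - 4)"
  have a: "real_of_int a \<le> - 3" using assms T2 by simp
  have "3 ^ 2 \<le> (- real_of_int a) ^ 2" using a by (intro power_mono) auto
  then have S2: "S * S = real_of_int a ^ 2 - 4" and "0 \<le> S" by (simp_all add: S_def)
  have "S < - a" using a unfolding S_def by (intro real_less_lsqrt) auto
  moreover have "- a - 2 < S" using a unfolding S_def
    by (intro real_less_rsqrt) (simp add: power2_eq_square algebra_simps)
  ultimately show thesis
    using S2 T2 by (intro that[of "(a + S) / 2"]) (auto simp: field_simps power2_eq_square)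
next
  case T4
  define S where "S = sqrt (real_of_int a ^ 2 + 4)"
  have a: "real_of_int a \<le> - 1" using assms T4 by simp
  have S2: "S * S = real_of_int a ^ 2 + 4" and "0 \<le> S" by (simp_all add: S_def)
  have "S < 2 - a" using a unfolding S_def
    by (intro real_less_lsqrt) (simp_all add: power2_eq_square algebra_simps)
  moreover have "- a < S" using a unfolding S_def by (intro real_less_rsqrt) simp
  ultimately show thesis
    using S2 T4 by (intro that[of "(a + S) / 2"]) (auto simp: field_simps power2_eq_square)
qed

lemma crosses_frag_of:
  assumes "x \<in> closed_segment (phi f (head s)) (phi f (tail s))" "phi f (head s) \<noteq> phi f (tail s)"
  shows "crosses f x (frag_of s)"
  using assms by (auto simp: crosses_def threshold_def closed_segment_eq_real_ivl split: if_splits)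

text \<open>A type-2 segment with projected tail \<open>z\<close> goes to one segment over
  \<open>[z, z + 1]\<close> and one over \<open>[z + 1 + l, z + 1]\<close>, both within
  \<open>1\<close> of \<open>z\<close>; a type-1 segment keeps its projection. The bound is uniform
  in the chain, as the limit requires.\<close>

lemma supported_delta_dual_shadow:
  assumes l: "- 1 < l" "l < 0" and c: "supported (spans (tau_steps T2 l) u v) c"
    and y: "y \<in> shadow (unit_steps l) (delta_dual c)"
  shows "\<exists>x\<in>closed_segment u v. \<bar>y - x\<bar> \<le> 1"
proof -
  let ?P = "\<lambda>s. \<forall>y\<in>closed_segment (phi (unit_steps l) (head s)) (phi (unit_steps l) (tail s)).
    \<exists>x\<in>closed_segment u v. \<bar>y - x\<bar> \<le> 1"
  have gen: "supported ?P (delta_dual (frag_of s))" if s: "spans (tau_steps T2 l) u v s" for s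
  proof -
    obtain x i where si: "s = (x, i)" by (cases s)
    obtain p q where x: "x = pt p q" by (rule pt_cases)
    have "i = 1 \<or> i = 2" using exhaust_2 by auto
    then show ?thesis
    proof
      assume i: "i = 1"
      have eq: "phi (unit_steps l) (head (pt p (p + q), 1)) = phi (tau_steps T2 l) (head s)"
        "phi (unit_steps l) (tail (pt p (p + q), 1)) = phi (tau_steps T2 l) (tail s)"
        by (simp_all add: si x i phi_pt algebra_simps)
      have "closed_segment (phi (tau_steps T2 l) (head s)) (phi (tau_steps T2 l) (tail s)) \<subseteq> closed_segment u v"
        using s by (simp add: spans_def closed_segment_subset)
      then have "?P (pt p (p + q), 1)" unfolding eq by force
      then show ?thesis unfolding si x i delta_dual_simps by (rule supported_intros)
    next
      assume i: "i = 2"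
      define z where "z = phi (tau_steps T2 l) (tail s)"
      have z: "z \<in> closed_segment u v" using s by (simp add: spans_def z_def)
      have eq: "phi (unit_steps l) (head (pt p (p + q), 2)) = z + 1" "phi (unit_steps l) (tail (pt p (p + q), 2)) = z"
        "phi (unit_steps l) (head (pt (p + 1) (p + q), 1)) = z + 1"
        "phi (unit_steps l) (tail (pt (p + 1) (p + q), 1)) = z + 1 + l"
        by (simp_all add: z_def si x i phi_pt algebra_simps)
      have "?P (pt p (p + q), 2)" "?P (pt (p + 1) (p + q), 1)"
        unfolding eq using l by (intro ballI bexI[OF _ z]; auto simp: closed_segment_eq_real_ivl)+
      then show ?thesis unfolding si x i delta_dual_simps by (intro supported_intros)
    qed
  qed
  have "delta_dual c = frag_extend (\<lambda>s. delta_dual (frag_of s)) c"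
    unfolding delta_dual_def by (simp add: case_prod_unfold)
  moreover have "supported ?P (frag_extend (\<lambda>s. delta_dual (frag_of s)) c)"
    by (rule supported_frag_extend[OF gen c])
  ultimately have "supported ?P (delta_dual c)" by (simp only:)
  then show ?thesis using y by (auto simp: supported_def shadow_def)
qed

lemma delta_inverse:
  "matrix_inv (real_incidence_matrix (delta T1)) = mat2 (- 1) 0 1 1"
  "matrix_inv (real_incidence_matrix (delta T2)) = mat2 1 0 1 1"
  "matrix_inv (real_incidence_matrix (delta T4)) = mat2 (- 1) 0 0 1"
  unfolding incidence_delta by (auto intro!: matrix_inv_eqI simp: mat2_mult mat2_one)

lemma piece_scale: "(\<lambda>x. r * x) ` piece c v i = piece (r * c) (\<lambda>i. r * v i) i"
proof -
  have "linear (\<lambda>x. r * x)" by (rule linearI) (simp_all add: algebra_simps)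
  from closed_segment_linear_image[OF this, of c "c - v (flip i)"]
  show ?thesis by (simp add: piece_def algebra_simps)
qed

text \<open>For \<open>\<sigma>\<^sub>2\<close> the chain is pulled back along \<open>\<delta>\<^sub>2\<^sup>*\<close>, since \<open>\<sigma>\<^sub>2\<^sup>*\<close> itself does not stay within the hull.\<close>

definition sigma_supported :: "family \<Rightarrow> real \<Rightarrow> real \<Rightarrow> real \<Rightarrow> chain \<Rightarrow> bool" where
  "sigma_supported t l u v c \<longleftrightarrow> (if t = T2 then \<exists>c'. c = delta_dual c' \<and> supported (spans (tau_steps T2 l) u v) c'
     else supported (spans (unit_steps l) u v) c)"

definition sigma_offset :: "family \<Rightarrow> int \<Rightarrow> real \<Rightarrow> real" where
  "sigma_offset t a l = (case t of T1 \<Rightarrow> 2 * l - 1 | T2 \<Rightarrow> l * l | T4 \<Rightarrow> l * a) / (1 - l)"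

context
  fixes t :: family and a :: int and l :: real
  assumes adm: "admissible t a" and root: "contracting_root t a l"
begin

lemma root_bounds: "l \<noteq> 0" "\<bar>l\<bar> < 1" "1 < \<bar>a - l\<bar>"
proof -
  show l: "l \<noteq> 0" "\<bar>l\<bar> < 1" using contracting_root_norm[OF root] by auto
  have "l * (a - l) = 1 \<or> l * (a - l) = - 1"
    using root by (cases t) (auto simp: algebra_simps)
  then have "\<bar>l\<bar> * \<bar>a - l\<bar> = 1" by (metis abs_minus_cancel abs_mult abs_one)
  then have "\<bar>a - l\<bar> = 1 / \<bar>l\<bar>" using l(1) by (simp add: field_simps)
  then show "1 < \<bar>a - l\<bar>" using l by simp
qed

lemma eigenline_sigma:
  "eigenline (real_incidence_matrix (sigma t a)) 0 (- of_int (if t = T4 then - 1 else 1)) 1 a l (a - l) (unit_steps l)"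
proof
  show "real_incidence_matrix (sigma t a) = mat2 0 (- of_int (if t = T4 then - 1 else 1)) 1 a"
    by (rule incidence_sigma(2)[OF adm refl])
  show "unit_steps l 1 * - of_int (if t = T4 then - 1 else 1) + unit_steps l 2 * a = l * unit_steps l 2"
    using root by (cases t) (auto simp: algebra_simps)
qed (use root_bounds in auto)

lemma eigenline_tau:
  obtains p q r s where "eigenline (real_incidence_matrix (tau t a)) p q r s l (a - l) (tau_steps t l)"
proof (cases t)
  case T1
  then have ll: "l * l = a * l - 1" and "l < 1" using root by auto
  then have "eigenline (real_incidence_matrix (tau t a)) 1 1 (real_of_int a - 2) (real_of_int a - 1) l (a - l) (tau_steps t l)"
    using incidence_tau(4)[OF adm T1] root_bounds
    by unfold_locales (simp_all add: T1 algebra_simps del: tau.simps)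
  then show thesis by (rule that)
next
  case T2
  then have ll: "l * l = a * l - 1" and "- 1 < l" using root by auto
  then have "eigenline (real_incidence_matrix (tau t a)) (- 1) (- 1) (real_of_int a + 2) (real_of_int a + 1) l (a - l) (tau_steps t l)"
    using incidence_tau(5)[OF adm T2] root_bounds
    by unfold_locales (simp_all add: T2 algebra_simps del: tau.simps)
  then show thesis by (rule that)
next
  case T4
  then have ll: "l * l = a * l + 1" using root by auto
  then have "eigenline (real_incidence_matrix (tau t a)) 0 (- 1) (- 1) (real_of_int a) l (a - l) (tau_steps t l)"
    using incidence_tau(6)[OF adm T4] root_bounds
    by unfold_locales (simp_all add: T4 algebra_simps del: tau.simps)
  then show thesis by (rule that)
qed

text \<open>Since the image paths of \<open>tau\<close> are monotone, the iterates stay exactly in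
  the interval between the moving end points, so covering and containment meet with slack
  \<open>0\<close>.\<close>

lemma rauzy_limit_tau:
  assumes "eigenline (real_incidence_matrix (tau t a)) p q r s l (a - l) (tau_steps t l)"
  shows "X_tau t a i = (\<lambda>x. x *\<^sub>R eigenline.dir p r l (a - l) (tau_steps t l)) ` piece (tau_cut t l) (tau_steps t l) i"
proof -
  interpret eigenline "real_incidence_matrix (tau t a)" p q r s l "a - l" "tau_steps t l" by (rule assms)
  define k where "k = (case t of T1 \<Rightarrow> l * l | T2 \<Rightarrow> l * l | T4 \<Rightarrow> l * (l - 1))"
  define g where "g x = (x + k) / l" for x
  have g: "l * g x = x + k" for x using root_bounds by (simp add: g_def)
  have G: "phi (tau_steps t l) (tau_shift t a x) = g (phi (tau_steps t l) x)" for x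
    using phi_tau_shift[OF adm root, of x] root_bounds by (simp add: g_def k_def field_simps)
  define s0 where "s0 = ((axis i 1 :: int ^ 2), i)"
  define u v where "u = phi (tau_steps t l) (head s0)" and "v = phi (tau_steps t l) (tail s0)"
  have "i = 1 \<or> i = 2" using exhaust_2 by auto
  \<comment> \<open>The vertex \<open>e1 + e2\<close> is the tail of the symbol for
    \<open>i = 1\<close> and the head of the one for \<open>i = 2\<close>; its coordinate plus the
    drift is the cut.\<close>
  then have uv: "u + k / (1 - l) = (if i = 1 then tau_cut t l - tau_steps t l 2 else tau_cut t l)"
    "v + k / (1 - l) = (if i = 1 then tau_cut t l else tau_cut t l - tau_steps t l 1)" and ne: "u \<noteq> v"
  proof -
    have "l - 1 \<noteq> 0" "1 - l \<noteq> 0" "l + 1 \<noteq> 0" using root_bounds by auto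
    moreover have "- 1 = l - 1 + l * (l - 1) / (1 - l)" using root_bounds by (simp add: field_simps)
    ultimately show "u + k / (1 - l) = (if i = 1 then tau_cut t l - tau_steps t l 2 else tau_cut t l)"
      "v + k / (1 - l) = (if i = 1 then tau_cut t l else tau_cut t l - tau_steps t l 1)" "u \<noteq> v"
      using \<open>i = 1 \<or> i = 2\<close> root_bounds
      by (cases t; auto simp: u_def v_def s0_def k_def axis_pt phi_pt)+
  qed
  have "rauzy_limit (tau t a) (frag_of s0) = (\<lambda>x. x *\<^sub>R dir) ` closed_segment (u + k / (1 - l)) (v + k / (1 - l))"
  proof (rule rauzy_limit_eq[OF refl root_bounds(1) g])
    fix n x assume "x \<in> closed_segment u v"
    then have "crosses (tau_steps t l) x (frag_of s0)"
      using ne unfolding u_def v_def by (rule crosses_frag_of)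
    then show "(g ^^ n) x \<in> shadow (tau_steps t l) ((tiling_subst (tau t a) ^^ n) (frag_of s0))"
      by (intro crosses_mem_shadow crosses_funpow[OF flux_tau_generator[OF adm] _ G g root_bounds(1)]) auto
  next
    fix n y assume y: "y \<in> shadow (tau_steps t l) ((tiling_subst (tau t a) ^^ n) (frag_of s0))"
    have "supported (spans (tau_steps t l) u v) (frag_of s0)"
      by (intro supported_intros) (simp add: spans_def u_def v_def)
    then have "y \<in> (g ^^ n) ` closed_segment u v"
      using spans_shadow[OF spans_funpow[OF tau_spans[OF adm root] G g root_bounds(1)] y]
      unfolding closed_segment_funpow[OF g root_bounds(1)] by simp
    then show "\<exists>x\<in>closed_segment u v. \<bar>y - (g ^^ n) x\<bar> \<le> 0" by auto
  qed
  moreover have "closed_segment (u + k / (1 - l)) (v + k / (1 - l)) = piece (tau_cut t l) (tau_steps t l) i"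
    using \<open>i = 1 \<or> i = 2\<close> unfolding uv piece_def by (auto simp: closed_segment_commute)
  ultimately show ?thesis by (simp add: X_tau_def s0_def)
qed

text \<open>Stated for any chain crossing every level of the interval, so as to apply both to single
  symbols and to their sum. The slack \<open>1\<close> comes from
  \<open>supported_delta_dual_shadow\<close>.\<close>

lemma rauzy_limit_sigma:
  assumes c: "sigma_supported t l u v c" "\<And>x. x \<in> closed_segment u v \<Longrightarrow> crosses (unit_steps l) x c"
  shows "rauzy_limit (sigma t a) c =
    (\<lambda>x. x *\<^sub>R eigenline.dir 0 1 l (a - l) (unit_steps l)) ` closed_segment (u + sigma_offset t a l) (v + sigma_offset t a l)"
proof -
  interpret eigenline "real_incidence_matrix (sigma t a)" 0 "- of_int (if t = T4 then - 1 else 1)" 1 a l "a - l" "unit_steps l"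
    by (rule eigenline_sigma)
  define k where "k = (case t of T1 \<Rightarrow> 2 * l - 1 | T2 \<Rightarrow> l * l | T4 \<Rightarrow> l * a)"
  define g where "g x = (x + k) / l" for x
  have g: "l * g x = x + k" for x using root_bounds by (simp add: g_def)
  have G: "phi (unit_steps l) (sigma_shift t a x) = g (phi (unit_steps l) x)" for x
    using phi_sigma_shift[OF adm root, of x] root_bounds by (simp add: g_def k_def field_simps)
  have "rauzy_limit (sigma t a) c = (\<lambda>x. x *\<^sub>R dir) ` closed_segment (u + k / (1 - l)) (v + k / (1 - l))"
  proof (rule rauzy_limit_eq[OF refl root_bounds(1) g])
    fix n x assume "x \<in> closed_segment u v"
    then show "(g ^^ n) x \<in> shadow (unit_steps l) ((tiling_subst (sigma t a) ^^ n) c)"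
      by (intro crosses_mem_shadow crosses_funpow[OF flux_sigma_generator[OF adm] _ G g root_bounds(1)] c) auto
  next
    fix n y assume y: "y \<in> shadow (unit_steps l) ((tiling_subst (sigma t a) ^^ n) c)"
    show "\<exists>x\<in>closed_segment u v. \<bar>y - (g ^^ n) x\<bar> \<le> 1"
    proof (cases "t = T2")
      case True
      then obtain c' where c': "c = delta_dual c'" "supported (spans (tau_steps T2 l) u v) c'"
        using c(1) by (auto simp: sigma_supported_def)
      \<comment> \<open>For \<open>T2\<close> the affine maps of \<open>sigma\<close> and
        \<open>tau\<close> have the same constant \<open>l * l\<close> in coordinates, so one
        \<open>g\<close> serves both.\<close>
      have G': "phi (tau_steps T2 l) (tau_shift T2 a x) = g (phi (tau_steps T2 l) x)" for x
        using phi_tau_shift[OF adm root, of x] root_bounds True by (simp add: g_def k_def field_simps)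
      have "supported (spans (tau_steps T2 l) ((g ^^ n) u) ((g ^^ n) v)) ((tiling_subst (tau T2 a) ^^ n) c')"
        using spans_funpow[OF tau_spans[OF adm root, unfolded True] G' g root_bounds(1) c'(2)] .
      moreover have "y \<in> shadow (unit_steps l) (delta_dual ((tiling_subst (tau T2 a) ^^ n) c'))"
        using y adm unfolding True c'(1) by (simp only: sigma_delta_dual)
      ultimately have "\<exists>x\<in>(g ^^ n) ` closed_segment u v. \<bar>y - x\<bar> \<le> 1"
        using root True unfolding closed_segment_funpow[OF g root_bounds(1)]
        by (intro supported_delta_dual_shadow) auto
      then show ?thesis by auto
    next
      case False
      then have "supported (spans (unit_steps l) u v) c" using c(1) by (simp add: sigma_supported_def)
      then have "y \<in> (g ^^ n) ` closed_segment u v"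
        using spans_shadow[OF spans_funpow[OF sigma_spans[OF adm root False] G g root_bounds(1)] y]
        unfolding closed_segment_funpow[OF g root_bounds(1)] by simp
      then show ?thesis by force
    qed
  qed
  then show ?thesis by (simp add: sigma_offset_def k_def)
qed

lemma sigma_supported_frag_of:
  "sigma_supported t l (phi (unit_steps l) (head s)) (phi (unit_steps l) (tail s)) (frag_of s)"
proof (cases "t = T2")
  case True
  obtain x i where s: "s = (x, i)" by (cases s)
  obtain p q where x: "x = pt p q" by (rule pt_cases)
  have l: "- 1 < l" "l < 0" using root True by auto
  have "i = 1 \<or> i = 2" using exhaust_2 by auto
  then have "\<exists>c'. frag_of s = delta_dual c' \<and>
    supported (spans (tau_steps T2 l) (phi (unit_steps l) (head s)) (phi (unit_steps l) (tail s))) c'"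
  proof
    assume i: "i = 1"
    show ?thesis unfolding s x i
      by (intro exI[of _ "frag_of (pt p (q - p), 1)"] conjI supported_intros spansI_ge)
        (use l in \<open>simp_all add: delta_dual_simps phi_pt algebra_simps\<close>)
  next
    assume i: "i = 2"
    \<comment> \<open>The witness inverts \<open>delta_dual\<close>: the image of its second summand
      cancels the extra vertical segment.\<close>
    show ?thesis unfolding s x i
      by (intro exI[of _ "frag_of (pt p (q - p), 2) + frag_of (pt (p + 1) (q - p - 1), 1)"] conjI supported_intros spansI_ge)
        (use l in \<open>simp_all add: delta_dual_simps phi_pt algebra_simps\<close>)
  qed
  with True show ?thesis unfolding sigma_supported_def by simp
next
  case False
  then show ?thesis by (auto simp: sigma_supported_def spans_def intro: supported_intros)
qed

lemma X_sigma_part_eq: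
  "X_sigma_part t a (signed_letter t i) =
    (\<lambda>x. x *\<^sub>R eigenline.dir 0 1 l (a - l) (unit_steps l)) ` piece (sigma_cut t l) (sigma_steps t l) i"
proof -
  define s0 where "s0 = ((if t = T2 \<or> i = 2 then axis i 1 else 0 :: int ^ 2), i)"
  define u v where "u = phi (unit_steps l) (head s0)" and "v = phi (unit_steps l) (tail s0)"
  have i: "i = 1 \<or> i = 2" using exhaust_2 by auto
  have ne: "u \<noteq> v" using i root_bounds by (auto simp: u_def v_def s0_def axis_pt phi_pt split: if_splits)
  have "rauzy_limit (sigma t a) (frag_of s0) =
    (\<lambda>x. x *\<^sub>R eigenline.dir 0 1 l (a - l) (unit_steps l)) ` closed_segment (u + sigma_offset t a l) (v + sigma_offset t a l)"
    using ne unfolding u_def v_def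
    by (intro rauzy_limit_sigma sigma_supported_frag_of crosses_frag_of) auto
  moreover have "closed_segment (u + sigma_offset t a l) (v + sigma_offset t a l) = piece (sigma_cut t l) (sigma_steps t l) i"
  proof -
    have T4: "l + l * a / (1 - l) = - 1" if "t = T4"
      using root that root_bounds by (auto simp: field_simps)
    have "{u + sigma_offset t a l, v + sigma_offset t a l} = {sigma_cut t l, sigma_cut t l - sigma_steps t l (flip i)}"
      using i T4 by (cases t) (auto simp: u_def v_def s0_def axis_pt phi_pt sigma_offset_def)
    then show ?thesis unfolding piece_def by (auto simp: doubleton_eq_iff closed_segment_commute)
  qed
  moreover have "X_sigma_part t a (signed_letter t i) = rauzy_limit (sigma t a) (frag_of s0)"
    by (simp add: X_sigma_part_def base_symbol_def signed_letter_def s0_def)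
  ultimately show ?thesis by simp
qed

text \<open>Segments of the two iterates might cancel, so the limit of a sum is not a priori the
  union of the limits. The argument for one symbol is therefore repeated for the two-segment chain,
  and the resulting intervals are compared.\<close>

lemma X_sigma_eq: "X_sigma t a = (\<Union>i. X_sigma_part t a (signed_letter t i))"
proof -
  define c where "c = base_symbol (signed_letter t 1) + base_symbol (signed_letter t 2)"
  define u v :: real where "u = (if t = T2 then 1 else 0)" and "v = (if t = T2 then l else 1 + l)"
  have l: "if t = T2 then - 1 < l \<and> l < 0 else 0 < l \<and> l < 1" using root by (cases t) auto
  have "sigma_supported t l u v c"
  proof (cases "t = T2")
    case True
    have "c = delta_dual (frag_of (pt 1 (- 1), 1) + (frag_of (pt 0 1, 2) + frag_of (pt 1 0, 1)))"
      by (simp add: c_def True base_symbol_def signed_letter_def axis_pt delta_dual_simps)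
    moreover have "supported (spans (tau_steps T2 l) u v)
        (frag_of (pt 1 (- 1), 1) + (frag_of (pt 0 1, 2) + frag_of (pt 1 0, 1)))"
      by (intro supported_intros spansI_ge) (use l True in \<open>simp_all add: u_def v_def phi_pt\<close>)
    ultimately show ?thesis using True by (auto simp: sigma_supported_def)
  next
    case False
    have "supported (spans (unit_steps l) u v) (frag_of (pt 0 0, 1) + frag_of (pt 0 1, 2))"
      by (intro supported_intros spansI_le) (use l False in \<open>simp_all add: u_def v_def phi_pt\<close>)
    then show ?thesis
      using False by (simp add: sigma_supported_def c_def base_symbol_def signed_letter_def axis_pt)
  qed
  moreover have "crosses (unit_steps l) x c" if x: "x \<in> closed_segment u v" for x
  proof (cases "t = T2")
    case True
    have "flux h c = h (pt 1 0) - h (pt 0 1)" for h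
      by (simp add: c_def True base_symbol_def signed_letter_def axis_pt)
    then show ?thesis using x l True
      by (auto simp: crosses_def threshold_def u_def v_def phi_pt closed_segment_eq_real_ivl split: if_splits)
  next
    case False
    \<comment> \<open>Both segments leave \<open>e2\<close>, so they do not form a coherently
      oriented path; still, at each level of the interval one of the two fluxes is \<open>1\<close>
      or \<open>-1\<close>.\<close>
    have "flux h c = h (pt 0 0) - h (pt 0 1) + (h (pt 1 1) - h (pt 0 1))" for h
      using False by (simp add: c_def base_symbol_def signed_letter_def axis_pt)
    then show ?thesis using x l False
      by (auto simp: crosses_def threshold_def u_def v_def phi_pt closed_segment_eq_real_ivl split: if_splits)
  qed
  ultimately have "X_sigma t a = (\<lambda>x. x *\<^sub>R eigenline.dir 0 1 l (a - l) (unit_steps l)) `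
      closed_segment (u + sigma_offset t a l) (v + sigma_offset t a l)"
    unfolding X_sigma_def sum_2 c_def[symmetric] by (rule rauzy_limit_sigma)
  moreover have "closed_segment (u + sigma_offset t a l) (v + sigma_offset t a l) =
      piece (sigma_cut t l) (sigma_steps t l) 1 \<union> piece (sigma_cut t l) (sigma_steps t l) 2"
  proof -
    have T4: "- 1 = l + l * a / (1 - l)" if "t = T4"
      using root that root_bounds by (auto simp: field_simps)
    show ?thesis
      using l T4
      by (cases t) (auto simp: u_def v_def piece_def sigma_offset_def closed_segment_eq_real_ivl)
  qed
  ultimately show ?thesis by (simp add: X_sigma_part_eq UNIV_2 image_Un)
qed

text \<open>The inverse of \<open>A_delta\<close> intertwines \<open>A_tau\<close> with
  \<open>A_sigma\<close> and pulls the functional of \<open>sigma\<close> back to that of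
  \<open>tau\<close>; so it maps one \<open>dir\<close> to the other and preserves
  coordinates.\<close>

lemma delta_inverse_tau_piece:
  "(*v) (matrix_inv (real_incidence_matrix (delta t))) ` ((*v) (real_incidence_matrix (tau t a)) ^^ m) ` X_tau t a i =
    (\<lambda>x. x *\<^sub>R eigenline.dir 0 1 l (a - l) (unit_steps l)) ` piece (l ^ m * tau_cut t l) (\<lambda>i. l ^ m * tau_steps t l i) i"
proof -
  let ?D = "matrix_inv (real_incidence_matrix (delta t))"
  let ?S = "real_incidence_matrix (sigma t a)" and ?T = "real_incidence_matrix (tau t a)"
  obtain p q r s where eig: "eigenline ?T p q r s l (a - l) (tau_steps t l)" by (rule eigenline_tau)
  interpret T: eigenline ?T p q r s l "a - l" "tau_steps t l" by (rule eig)
  interpret S: eigenline ?S 0 "- of_int (if t = T4 then - 1 else 1)" 1 a l "a - l" "unit_steps l"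
    by (rule eigenline_sigma)
  have conj: "?S ** ?D = ?D ** ?T"
    using incidence_tau(4-6)[OF adm] incidence_sigma(2)[OF adm refl]
    by (cases t) (simp_all add: delta_inverse mat2_mult algebra_simps del: sigma.simps tau.simps delta.simps)
  have phi: "phi_real (unit_steps l) (?D *v x) = phi_real (tau_steps t l) x" for x
    by (cases t) (simp_all add: delta_inverse phi_real_def mat2_def matrix_vector_mult_def sum_2 algebra_simps del: delta.simps)
  have "?S *v (?D *v T.dir) = l *\<^sub>R (?D *v T.dir)"
    by (simp add: matrix_vector_mul_assoc conj) (simp add: matrix_vector_mul_assoc[symmetric] T.apply_dir matrix_vector_mult_scaleR)
  then have D: "?D *v T.dir = S.dir"
    unfolding S.apply_contracting phi T.phi_dir by simp
  show ?thesis
    unfolding rauzy_limit_tau[OF eig] piece_scale[symmetric] image_image T.funpow_apply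
    by (simp add: matrix_vector_mult_scaleR D)
qed

end

section \<open>Lebesgue measure on the contracting line\<close>

lemma emeasure_Un_null_Int:
  assumes "A \<in> sets M" "B \<in> sets M" "A \<inter> B \<in> null_sets M"
  shows "emeasure M (A \<union> B) = emeasure M A + emeasure M B"
proof -
  have "emeasure M (B - A) = emeasure M (B - A \<inter> B)" by (rule arg_cong[of _ _ "emeasure M"]) auto
  then show ?thesis using assms by (simp add: emeasure_Un emeasure_Diff_null_set)
qed

lemma emeasure_lebesgue_translation:
  fixes S :: "real set"
  shows "emeasure lebesgue ((\<lambda>x. x + a) ` S) = emeasure lebesgue S"
  using emeasure_lebesgue_affine[of 1 a S] by simp

lemma null_lebesgue_finite: "finite (S :: real set) \<Longrightarrow> S \<in> null_sets lebesgue"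
  by (intro null_sets_completionI countable_imp_null_set_lborel countable_finite)

text \<open>\<open>w\<close> is the eigenvector in whose coordinate the exchange is explicit,
  \<open>e\<close> the unit vector chosen in the definition of the measure; they differ by a nonzero
  factor.\<close>

locale unit_line =
  fixes P :: "(real ^ 2) set" and w e :: "real ^ 2"
  assumes P: "P = range (\<lambda>x. x *\<^sub>R w)" and w: "w \<noteq> 0" and e: "e = (SOME u. u \<in> P \<and> norm u = 1)"
begin

lemma unit: "e \<in> P" "norm e = 1"
proof -
  have "(1 / norm w) *\<^sub>R w \<in> P \<and> norm ((1 / norm w) *\<^sub>R w) = 1" using w by (auto simp: P)
  then have "e \<in> P \<and> norm e = 1" unfolding e by (rule someI)
  then show "e \<in> P" "norm e = 1" by auto
qed

lemma w_eq: obtains r where "r \<noteq> 0" "w = r *\<^sub>R e"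
proof -
  obtain s where s: "e = s *\<^sub>R w" using unit(1) by (auto simp: P)
  then have "s \<noteq> 0" using unit(2) by auto
  then show thesis using s by (intro that[of "1 / s"]) auto
qed

lemma P_eq: "P = range (\<lambda>x. x *\<^sub>R e)"
proof -
  obtain r where r: "r \<noteq> 0" "w = r *\<^sub>R e" by (rule w_eq)
  have "x *\<^sub>R e \<in> P" for x
    using r unfolding P by (intro image_eqI[of _ _ "x / r"]) auto
  then show ?thesis using r by (auto simp: P)
qed

abbreviation "line \<equiv> \<lambda>x::real. x *\<^sub>R e"

lemma line_inj: "line x = line y \<longleftrightarrow> x = y"
  using unit(2) by auto

lemma inner_unit: "e \<bullet> e = 1"
  using unit(2) by (simp add: norm_eq_1)

abbreviation "L \<equiv> line_lebesgue P"

definition base :: "(real ^ 2) measure" where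
  "base = distr lborel (restrict_space borel P) line"

lemma L_eq: "L = completion base"
  unfolding line_lebesgue_def base_def e[symmetric] ..

lemma line_measurable: "line \<in> lborel \<rightarrow>\<^sub>M restrict_space borel P"
  by (intro measurable_restrict_space2) (auto simp: P_eq)

lemma space_L [simp]: "space L = P"
  by (simp add: L_eq base_def space_restrict_space)

text \<open>Completion is compatible with the push-forward along \<open>line\<close>, so measures on
  the contracting line can be computed with \<open>lebesgue\<close> on the reals.\<close>

lemma L_sets_imp:
  assumes "S \<in> sets L"
  shows "S \<subseteq> P" "line -` S \<in> sets lebesgue" "emeasure L S = emeasure lebesgue (line -` S)"
proof -
  show "S \<subseteq> P" using sets.sets_into_space[OF assms] by simp
  have m: "line \<in> lebesgue \<rightarrow>\<^sub>M base"
    using measurable_completion[OF line_measurable] by (simp add: base_def measurable_distr_eq2 cong: measurable_cong_sets)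
  have "distr lebesgue base line = distr lborel base line"
    by (intro distr_completion) (use line_measurable in \<open>simp add: base_def cong: measurable_cong_sets\<close>)
  also have "\<dots> = base" unfolding base_def
    by (rule measure_eqI) (use line_measurable in \<open>auto simp: emeasure_distr cong: measurable_cong_sets\<close>)
  finally have d: "distr lebesgue base line = base" .
  have comp: "completion base = distr lebesgue (completion base) line"
    using completion.completion_distr_eq[OF m] unfolding d by simp
  have m': "line \<in> lebesgue \<rightarrow>\<^sub>M completion base"
    using completion.measurable_completion2[OF m] unfolding d by simp
  show "line -` S \<in> sets lebesgue"
    using measurable_sets[OF m', of S] assms by (simp add: L_eq)
  show "emeasure L S = emeasure lebesgue (line -` S)"
    using assms unfolding L_eq by (subst comp) (simp add: emeasure_distr[OF m'])
qed

lemma line_image_borel: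
  assumes "B \<in> sets borel" shows "line ` B \<in> sets base"
proof -
  have "line ` B = P \<inter> (\<lambda>v. v \<bullet> e) -` B"
    by (auto simp: P_eq inner_unit)
  moreover have "(\<lambda>v. v \<bullet> e) -` B \<in> sets borel"
    using measurable_sets[of "\<lambda>v. v \<bullet> e" borel borel B] assms by simp
  ultimately show ?thesis by (auto simp: base_def sets_restrict_space)
qed

text \<open>A Lebesgue set is a Borel set together with a subset of a Borel null set; the injective
  map \<open>line\<close> transports both parts.\<close>

lemma L_setsI:
  assumes "S \<subseteq> P" "line -` S \<in> sets lebesgue"
  shows "S \<in> sets L"
proof -
  obtain B N N' where B: "line -` S = B \<union> N" "B \<in> sets lborel" "N' \<in> null_sets lborel" "N \<subseteq> N'"
    using assms(2) by (rule sets_completionE)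
  have "S = line ` (line -` S)" using assms(1) by (auto simp: P_eq)
  then have S: "S = line ` B \<union> line ` N" by (simp add: B(1) image_Un)
  have N': "N' \<in> sets borel" using B(3) by (simp add: null_sets_def)
  have "emeasure base (line ` N') = emeasure lborel (line -` line ` N')"
    using line_image_borel[OF N'] emeasure_distr[OF line_measurable, of "line ` N'"]
    by (simp add: base_def)
  also have "line -` line ` N' = N'" using line_inj by auto
  finally have "line ` N' \<in> null_sets base"
    using line_image_borel[OF N'] B(3) by (auto simp: null_sets_def)
  then show ?thesis
    unfolding L_eq S using line_image_borel[of B] B by (intro sets_completionI[OF refl]) auto
qed

lemma L_null_countable:
  assumes "countable S" "S \<subseteq> P"
  shows "S \<in> null_sets L"
proof -
  have "countable (line ` line -` S)"
    by (rule countable_subset[OF _ assms(1)]) auto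
  then have "countable (line -` S)"
    by (rule countable_image_inj_on) (auto simp: inj_on_def line_inj simp del: scaleR_cancel_right)
  then have "line -` S \<in> null_sets lebesgue"
    by (intro null_sets_completionI countable_imp_null_set_lborel)
  then show ?thesis
    using L_setsI[OF assms(2)] L_sets_imp(3)[of S] by (auto simp: null_sets_def)
qed

lemma L_compact: "compact S \<Longrightarrow> S \<subseteq> P \<Longrightarrow> S \<in> sets L"
proof -
  assume "compact S" "S \<subseteq> P"
  then have "S \<in> sets base"
    by (auto simp: base_def sets_restrict_space image_iff intro!: bexI[of _ S] borel_compact)
  then show ?thesis by (simp add: L_eq)
qed

text \<open>The translated pieces tile the same interval as the pieces, overlapping in at most one
  point, and Lebesgue measure is translation invariant. The version of \<open>T\<close> chosen at
  the cut changes preimages by one point at most.\<close>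

lemma measurable_dynamical_system_exchange:
  assumes opp: "opposite v" and X: "X = line ` (piece c v 1 \<union> piece c v 2)"
    and T: "\<And>x. x \<in> X \<Longrightarrow> \<exists>i. x \<in> line ` piece c v i \<and> T x = x - line (v i)"
  shows "measurable_dynamical_system (restrict_space L X) T"
proof -
  let ?M = "restrict_space L X"
  define J where "J = piece c v"
  define J' where "J' i = (\<lambda>x. x + - v i) ` J i" for i
  have XP: "X \<subseteq> P" by (auto simp: X P_eq)
  have "compact X" unfolding X piece_def by (intro compact_continuous_image continuous_intros compact_Un) auto
  then have XL: "X \<in> sets L" using XP by (rule L_compact)
  have setsM: "S \<in> sets ?M \<longleftrightarrow> S \<subseteq> X \<and> S \<in> sets L" for S
  proof -
    have "X \<inter> space L = X" using XP by auto
    then show ?thesis using XL by (subst sets_restrict_space_iff) auto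
  qed
  have J: "J 1 \<inter> J 2 \<subseteq> {c}" "J' 1 \<inter> J' 2 \<subseteq> {c - v 1 - v 2}" "J' 1 \<union> J' 2 = J 1 \<union> J 2"
  proof -
    show "J 1 \<inter> J 2 \<subseteq> {c}"
      using opp by (auto simp: J_def piece_def closed_segment_eq_real_ivl opposite_def split: if_splits)
    have J'seg: "J' i = closed_segment (c - v i) (c - v i - v (flip i))" for i
      using closed_segment_translation[of "- v i" c "c - v (flip i)"]
      by (simp add: J'_def J_def piece_def algebra_simps)
    show "J' 1 \<inter> J' 2 \<subseteq> {c - v 1 - v 2}" "J' 1 \<union> J' 2 = J 1 \<union> J 2"
      unfolding J'seg J_def piece_def using opp
      by (auto simp: closed_segment_eq_real_ivl opposite_def split: if_splits)
  qed
  have Jm: "J i \<in> sets lebesgue" for i by (simp add: J_def piece_def lmeasurable_compact fmeasurableD)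
  have Tline: "\<exists>i. x \<in> J i \<and> T (line x) = line (x - v i)" if "x \<in> J 1 \<union> J 2" for x
  proof -
    have "line x \<in> X" using that by (auto simp: X J_def)
    from T[OF this] obtain i where "line x \<in> line ` J i" "T (line x) = line x - line (v i)"
      by (auto simp: J_def)
    then show ?thesis by (auto simp: line_inj scaleR_diff_left simp del: scaleR_cancel_right)
  qed
  have TX: "T x \<in> X" if "x \<in> X" for x
  proof -
    obtain y where y: "y \<in> J 1 \<union> J 2" "x = line y" using \<open>x \<in> X\<close> by (auto simp: X J_def)
    obtain i where i: "y \<in> J i" "T x = line (y - v i)" using Tline[OF y(1)] y(2) by auto
    have "y - v i \<in> J' i" using i(1) by (force simp: J'_def)
    then have "y - v i \<in> J 1 \<union> J 2" using J(3) exhaust_2[of i] by auto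
    then show ?thesis unfolding i(2) X J_def by auto
  qed
  have key: "T -` S \<inter> X \<in> sets L \<and> emeasure L (T -` S \<inter> X) = emeasure L S" if S: "S \<subseteq> X" "S \<in> sets L" for S
  proof -
    define S' where "S' = line -` S"
    have S'm: "S' \<in> sets lebesgue" using L_sets_imp(2)[OF S(2)] by (simp add: S'_def)
    have S'J: "S' \<subseteq> J 1 \<union> J 2" using S(1) by (auto simp: S'_def X J_def line_inj simp del: scaleR_cancel_right)
    define R where "R i = (\<lambda>x. x + v i) ` (J' i \<inter> S')" for i
    have J'm: "J' i \<in> sets lebesgue" for i
      using lebesgue_sets_translation[OF Jm, of "- v i" i] by (simp add: J'_def add.commute)
    have Rm: "R i \<in> sets lebesgue" for i
      using lebesgue_sets_translation[of "J' i \<inter> S'" "v i"] J'm S'm by (simp add: R_def add.commute)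
    have R: "R i = {x \<in> J i. x - v i \<in> S'}" for i
      by (force simp: R_def J'_def)
    define Q where "Q = line -` (T -` S \<inter> X)"
    have Qx: "x \<in> Q \<longleftrightarrow> x \<in> J 1 \<union> J 2 \<and> T (line x) \<in> S" for x
      by (auto simp: Q_def X J_def line_inj simp del: scaleR_cancel_right)
    \<comment> \<open>Away from the cut the preimage is the union of the shifted parts
      \<open>R 1\<close> and \<open>R 2\<close>; whether \<open>c\<close> belongs to it depends on
      the version of \<open>T\<close>.\<close>
    have QR: "Q - {c} = (R 1 \<union> R 2) - {c}"
    proof (intro equalityI subsetI)
      fix x assume x: "x \<in> Q - {c}"
      then obtain i where i: "x \<in> J i" "T (line x) = line (x - v i)" using Tline Qx by blast
      have "T (line x) \<in> S" using x Qx by simp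
      then have "x - v i \<in> S'" unfolding S'_def i(2) by simp
      then have "x \<in> R i" using i(1) unfolding R by simp
      then show "x \<in> R 1 \<union> R 2 - {c}" using x exhaust_2[of i] by auto
    next
      fix x assume x: "x \<in> R 1 \<union> R 2 - {c}"
      then have xJ: "x \<in> J 1 \<union> J 2" by (auto simp: R)
      then obtain i where i: "x \<in> J i" "T (line x) = line (x - v i)" using Tline by blast
      have "x \<notin> J 1 \<inter> J 2" using x J(1) by blast
      then have "x \<in> R i" using x i(1) exhaust_2[of i] unfolding R by auto
      then have "line (x - v i) \<in> S" unfolding R S'_def by simp
      then have "T (line x) \<in> S" unfolding i(2) .
      then show "x \<in> Q - {c}" using x xJ Qx by blast
    qed
    have Qeq: "Q = (R 1 \<union> R 2) - {c} \<or> Q = insert c (R 1 \<union> R 2)"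
      using QR by auto
    have c0: "{c} \<in> null_sets lebesgue" by (rule null_lebesgue_finite) simp
    have Qm: "Q \<in> sets lebesgue" 
    proof -
      have "R 1 \<union> R 2 \<in> sets lebesgue" using Rm by simp
      moreover from this have "(R 1 \<union> R 2) - {c} \<in> sets lebesgue" "insert c (R 1 \<union> R 2) \<in> sets lebesgue"
        using null_setsD2[OF c0] by (auto intro: sets.insert_in_sets)
      ultimately show ?thesis using Qeq by metis
    qed
    have "emeasure lebesgue Q = emeasure lebesgue (R 1 \<union> R 2)"
      using Qeq
    proof
      assume "Q = insert c (R 1 \<union> R 2)"
      then have "Q = (R 1 \<union> R 2) \<union> {c}" by auto
      then show ?thesis using emeasure_Un_null_set[OF _ c0, of "R 1 \<union> R 2"] Rm by auto
    qed (use Rm c0 in \<open>simp add: emeasure_Diff_null_set\<close>)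
    also have "\<dots> = emeasure lebesgue (R 1) + emeasure lebesgue (R 2)"
    proof (rule emeasure_Un_null_Int[OF Rm Rm])
      have "R 1 \<inter> R 2 \<subseteq> {c}" using J(1) by (auto simp: R)
      then show "R 1 \<inter> R 2 \<in> null_sets lebesgue" by (intro null_lebesgue_finite) (auto intro: finite_subset)
    qed
    also have "\<dots> = emeasure lebesgue (J' 1 \<inter> S') + emeasure lebesgue (J' 2 \<inter> S')"
      by (simp add: R_def emeasure_lebesgue_translation)
    also have "\<dots> = emeasure lebesgue ((J' 1 \<inter> S') \<union> (J' 2 \<inter> S'))"
    proof (rule emeasure_Un_null_Int[symmetric])
      have "(J' 1 \<inter> S') \<inter> (J' 2 \<inter> S') \<subseteq> {c - v 1 - v 2}" using J(2) by auto
      then show "(J' 1 \<inter> S') \<inter> (J' 2 \<inter> S') \<in> null_sets lebesgue"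
        by (intro null_lebesgue_finite) (auto intro: finite_subset)
    qed (use J'm S'm in auto)
    also have "(J' 1 \<inter> S') \<union> (J' 2 \<inter> S') = S'" using J(3) S'J by auto
    finally have em: "emeasure lebesgue Q = emeasure lebesgue S'" .
    have "T -` S \<inter> X \<in> sets L" using Qm XP by (intro L_setsI) (auto simp: Q_def)
    then show ?thesis using em L_sets_imp(3)[of "T -` S \<inter> X"] L_sets_imp(3)[OF S(2)] by (simp add: Q_def S'_def)
  qed
  have spM: "space ?M = X" using XP by (auto simp: space_restrict_space)
  have Tm: "T \<in> measurable ?M ?M"
  proof (rule measurableI)
    show "T x \<in> space ?M" if "x \<in> space ?M" for x using that TX by (simp add: spM)
    show "T -` S \<inter> space ?M \<in> sets ?M" if "S \<in> sets ?M" for S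
      using that key[of S] by (auto simp: spM setsM)
  qed
  moreover have "distr ?M ?M T = ?M"
  proof (rule measure_eqI)
    fix S assume "S \<in> sets (distr ?M ?M T)"
    then have S: "S \<in> sets ?M" by simp
    then have S': "S \<subseteq> X" "S \<in> sets L" using setsM by auto
    have "emeasure (distr ?M ?M T) S = emeasure ?M (T -` S \<inter> X)"
      using emeasure_distr[OF Tm S] by (simp add: spM)
    also have "\<dots> = emeasure L (T -` S \<inter> X)" using XL by (intro emeasure_restrict_space) (auto simp: Int_absorb2[OF XP])
    also have "\<dots> = emeasure L S" using key[OF S'] by simp
    also have "\<dots> = emeasure ?M S" using XL S' by (intro emeasure_restrict_space[symmetric]) (auto simp: Int_absorb2[OF XP])
    finally show "emeasure (distr ?M ?M T) S = emeasure ?M S" .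
  qed simp
  ultimately show ?thesis by (simp add: measurable_dynamical_system_def)
qed

end

section \<open>From intervals to the domain exchange\<close>

lemma (in additive_set) exchange_inj:
  assumes c: "c \<in> K" "\<And>i. v i \<in> K" "opposite v"
    and x: "x \<in> (\<Union>i. generic_piece K c v i)" "y \<in> (\<Union>i. generic_piece K c v i)"
    and eq: "exchange c v x = exchange c v y"
  shows "x = y"
proof -
  obtain i j where ij: "x \<in> generic_piece K c v i" "y \<in> generic_piece K c v j" using x by blast
  then have "x - v i = y - v j" using eq exchange_generic[OF c] by metis
  then show ?thesis
    using ij exhaust_2[of i] exhaust_2[of j] c(3) unfolding mem_generic_piece[OF c(1,2)] opposite_def
    by (elim disjE) (simp_all, linarith+)
qed

text \<open>The countable set \<open>N\<close> of points of \<open>X\<close> with coordinate in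
  \<open>K\<close> is mapped into itself by every version of \<open>T\<close>, and outside it
  \<open>T\<close> acts as \<open>exchange\<close> in coordinates. All exceptional sets are subsets
  of \<open>N\<close>.\<close>

lemma has_theta_structure_exchange:
  fixes w :: "real ^ 2" and v :: "2 \<Rightarrow> real"
  defines "\<iota> \<equiv> (\<lambda>x::real. x *\<^sub>R w)"
  assumes add: "additive_set K" and countable: "countable K" and w: "w \<noteq> 0"
    and exch: "exchange_induces K c v \<theta> c' v'"
    and X: "X = \<iota> ` (piece c v 1 \<union> piece c v 2)"
    and T: "\<And>x. x \<in> X \<Longrightarrow> \<exists>i. x \<in> \<iota> ` piece c v i \<and> T x = x - \<iota> (v i)"
    and mds: "measurable_dynamical_system M T" and space: "space M = X"
    and null: "\<And>S. S \<subseteq> X \<Longrightarrow> countable S \<Longrightarrow> S \<in> null_sets M"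
    and sets: "\<And>S. compact S \<Longrightarrow> S \<subseteq> X \<Longrightarrow> S \<in> sets M"
    and XP: "\<And>i. XP (f i) = \<iota> ` piece c v i" and f: "inj f"
  shows "has_theta_structure M T (\<lambda>i. map f (\<theta> i)) (range f) XP (\<lambda>i. \<iota> ` piece c' v' i)"
proof -
  interpret additive_set K by (rule add)
  define E where "E = exchange c v"
  define G where "G = generic_piece K c v"
  define G' where "G' = generic_piece K c' v'"
  define A where "A i = \<iota> ` piece c' v' i" for i
  define N where "N = X \<inter> \<iota> ` K"
  have c: "c \<in> K" "\<And>i. v i \<in> K" "opposite v" "c' \<in> K" "\<And>i. v' i \<in> K" "opposite v'"
    and sub: "\<And>i. piece c' v' i \<subseteq> piece c v 1 \<union> piece c v 2"
    and ind: "induces E G \<theta> (exchange c' v') G'"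
    using exch unfolding exchange_induces_def E_def G_def G'_def by auto
  have \<iota>: "\<iota> x = \<iota> y \<longleftrightarrow> x = y" for x y using w by (simp add: \<iota>_def)
  have U: "(\<Union>i. F i) = F 1 \<union> F 2" for F :: "2 \<Rightarrow> 'b set" by (simp add: UNIV_2)
  have nullN: "S \<in> null_sets M" if "S \<subseteq> N" for S
    using that countable by (intro null) (auto simp: N_def intro: countable_subset)
  have EG: "E x = x - v i" "E x \<in> (\<Union>l. G l)" if "x \<in> G i" for x i
    using exchange_generic[OF c(1-3)] inducesD(5)[of E G "\<lambda>i. [i]" E G x i] exchange_induces_id[OF c(1-3)] that
    unfolding E_def G_def exchange_induces_def by auto
  have Einj: "x = y" if "x \<in> (\<Union>l. G l)" "y \<in> (\<Union>l. G l)" "E x = E y" for x y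
    using exchange_inj[OF c(1-3)] that unfolding E_def G_def by blast
  have TG: "T (\<iota> x) = \<iota> (E x)" if x: "x \<in> (\<Union>l. G l)" for x
  proof -
    have "\<iota> x \<in> X" using x by (auto simp: X G_def generic_piece_def U)
    then obtain i where i: "\<iota> x \<in> \<iota> ` piece c v i" "T (\<iota> x) = \<iota> x - \<iota> (v i)" using T by blast
    have "x \<in> G i" using i(1) x \<iota> by (auto simp: G_def generic_piece_def)
    then show ?thesis using EG(1) i(2) by (simp add: \<iota>_def scaleR_diff_left)
  qed
  have TkG: "(T ^^ k) (\<iota> x) = \<iota> ((E ^^ k) x) \<and> (E ^^ k) x \<in> (\<Union>l. G l)" if "x \<in> (\<Union>l. G l)" for x k
    using that
  proof (induction k)
    case (Suc k)
    then obtain l where "(E ^^ k) x \<in> G l" by blast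
    then have "E ((E ^^ k) x) \<in> (\<Union>l. G l)" by (rule EG(2))
    then show ?case using Suc TG by auto
  qed simp
  have GK: "x \<notin> K" if "x \<in> (\<Union>l. G l)" for x using that by (auto simp: G_def generic_piece_def)
  have TX: "T x \<in> X" if "x \<in> X" for x
    using measurable_space[of T M M x] mds that space by (auto simp: measurable_dynamical_system_def)
  have TN: "T x \<in> N" if "x \<in> N" for x
  proof -
    obtain y where y: "y \<in> K" "x = \<iota> y" "x \<in> X" using \<open>x \<in> N\<close> by (auto simp: N_def)
    obtain i where "T x = x - \<iota> (v i)" using T[OF y(3)] by blast
    then have "T x = \<iota> (y - v i)" by (simp add: y \<iota>_def scaleR_diff_left)
    then show ?thesis using TX[OF y(3)] diff_mem[OF y(1) c(2)] by (auto simp: N_def)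
  qed
  have TkN: "(T ^^ k) x \<in> N" if "x \<in> N" for x k
    using that by (induction k) (auto intro: TN)
  have AX: "A i \<subseteq> X" for i using sub[of i] by (auto simp: A_def X)
  have G'G: "G' i \<subseteq> (\<Union>l. G l)" for i by (rule inducesD(1)[OF ind])
  have A_cases: "y \<in> N \<or> (\<exists>x\<in>G' i. y = \<iota> x)" if "y \<in> A i" for y i
    using that AX[of i] by (auto simp: A_def N_def G'_def generic_piece_def)
  have Tk_cases: "(\<exists>x\<in>G' i. y = \<iota> ((E ^^ k) x) \<and> (E ^^ k) x \<in> (\<Union>l. G l))" if "y \<in> (T ^^ k) ` A i" "y \<notin> N" for y i k
  proof -
    obtain z where z: "z \<in> A i" "y = (T ^^ k) z" using \<open>y \<in> (T ^^ k) ` A i\<close> by auto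
    have "z \<notin> N" using TkN z(2) \<open>y \<notin> N\<close> by auto
    then obtain x where "x \<in> G' i" "z = \<iota> x" using A_cases[OF z(1)] by auto
    then show ?thesis using TkG[of x k] G'G[of i] z(2) by blast
  qed
  have TkX: "(T ^^ k) ` A i \<subseteq> X" for k i
  proof -
    have "x \<in> X \<Longrightarrow> (T ^^ k) x \<in> X" for x by (induction k) (auto intro: TX)
    then show ?thesis using AX by blast
  qed
  have G'A: "\<iota> x \<in> A i \<longleftrightarrow> x \<in> G' i" if "x \<notin> K" for x i
    using that \<iota> by (auto simp: A_def G'_def generic_piece_def)
  have GX: "\<iota> x \<in> XP (f l)" if "x \<in> G l" for x l
    using that by (auto simp: XP G_def generic_piece_def)
  have G_disj: "i = j" if "x \<in> G i" "x \<in> G j" for x i j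
    using generic_disjoint[OF c(1-3), of i j] that by (auto simp: G_def)
  have G'_disj: "i = j" if "x \<in> G' i" "x \<in> G' j" for x i j
    using generic_disjoint[OF c(4-6), of i j] that by (auto simp: G'_def)
  have comp: "compact (\<iota> ` piece c v i)" "compact (A i)" for c v i
    unfolding \<iota>_def A_def piece_def by (intro compact_continuous_image continuous_intros; simp)+
  have XPX: "XP (f i) \<subseteq> X" for i using exhaust_2[of i] by (auto simp: XP X)
  have UXP: "(\<Union>i. XP (f i)) = X" by (simp add: XP X U image_Un)
  \<comment> \<open>Disjointness of tower levels is no clause of \<open>induces\<close>; it follows
    from injectivity of the exchange on generic points: cancelling the smaller number of steps
    leaves a premature return to the base, or a point in two base pieces.\<close>
  have towers: "(T ^^ k) ` A i \<inter> (T ^^ m) ` A j \<subseteq> N"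
    if km: "k < length (\<theta> i)" "m < length (\<theta> j)" "(i, k) \<noteq> (j, m)" for i j k m
  proof (rule ccontr)
    assume "\<not> (T ^^ k) ` A i \<inter> (T ^^ m) ` A j \<subseteq> N"
    then obtain y where y: "y \<in> (T ^^ k) ` A i" "y \<in> (T ^^ m) ` A j" "y \<notin> N" by blast
    obtain x where x: "x \<in> G' i" "y = \<iota> ((E ^^ k) x)" using Tk_cases[OF y(1,3)] by blast
    obtain z where z: "z \<in> G' j" "y = \<iota> ((E ^^ m) z)" using Tk_cases[OF y(2,3)] by blast
    have Ekm: "(E ^^ k) x = (E ^^ m) z" using x z \<iota> by simp
    have no: False if "k \<le> m" "x \<in> G' i" "z \<in> G' j" "(E ^^ k) x = (E ^^ m) z" "m < length (\<theta> j)" "(i, k) \<noteq> (j, m)"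
      for i j k m x z
    proof -
      have "(E ^^ n) x = (E ^^ n) z' \<Longrightarrow> x \<in> (\<Union>l. G l) \<Longrightarrow> z' \<in> (\<Union>l. G l) \<Longrightarrow> x = z'" for n z'
      proof (induction n)
        case (Suc n)
        then show ?case using Einj[of "(E ^^ n) x" "(E ^^ n) z'"] TkG[of x n] TkG[of z' n] by simp
      qed simp
      note cancel = this
      have xG: "x \<in> (\<Union>l. G l)" and zG: "z \<in> (\<Union>l. G l)" using that G'G by blast+
      have "(E ^^ m) z = (E ^^ k) ((E ^^ (m - k)) z)"
        using \<open>k \<le> m\<close> by (metis comp_apply funpow_add le_add_diff_inverse)
      then have "x = (E ^^ (m - k)) z"
        using cancel[of k "(E ^^ (m - k)) z"] TkG[OF zG, of "m - k"] xG that(4) by simp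
      then have *: "(E ^^ (m - k)) z \<in> (\<Union>l. G' l)" "(E ^^ (m - k)) z \<in> G' i" using that(2) by auto
      show False
      proof (cases "k = m")
        case True
        then show False using *(2) that G'_disj by auto
      next
        case False
        then show False using inducesD(3)[OF ind that(3), of "m - k"] * that by auto
      qed
    qed
    show False
    proof (cases "k \<le> m")
      case True
      show False by (rule no[OF True x(1) z(1) Ekm km(2,3)])
    next
      case False
      then show False using no[of m k z j x i] x z Ekm km by auto
    qed
  qed
  show ?thesis
    unfolding has_theta_structure_def A_def[symmetric] length_map
  proof (intro conjI allI impI)
    show "measurable_dynamical_system M T" by (rule mds)
    show "set (map f (\<theta> i)) \<subseteq> range f" for i by auto
    show "measurable_partition M (space M) (range f) XP"
      unfolding measurable_partition_def
    proof (intro conjI ballI impI)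
      fix x assume "x \<in> range f"
      then show "XP x \<in> sets M" using XPX sets comp(1) XP by auto
    next
      fix x y assume "x \<in> range f" "y \<in> range f" "x \<noteq> y"
      then obtain i j where ij: "x = f i" "y = f j" "i \<noteq> j" by auto
      have "XP x \<inter> XP y \<subseteq> N"
      proof
        fix z assume z: "z \<in> XP x \<inter> XP y"
        then obtain s where s: "z = \<iota> s" "s \<in> piece c v i" "s \<in> piece c v j" using \<iota> by (auto simp: ij XP)
        have "s \<in> K" using s(2,3) G_disj[of s i j] ij(3) by (auto simp: G_def generic_piece_def)
        then show "z \<in> N" using z XPX[of i] s(1) ij by (auto simp: N_def)
      qed
      then show "XP x \<inter> XP y \<in> null_sets M" by (rule nullN)
    qed (simp_all add: space UXP)
    show "measurable_partition M (\<Union>i. A i) UNIV A"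
      unfolding measurable_partition_def
    proof (intro conjI ballI impI)
      fix i show "A i \<in> sets M" by (rule sets[OF comp(2) AX])
    next
      fix i j :: 2 assume "i \<noteq> j"
      have "A i \<inter> A j \<subseteq> N"
      proof (rule subsetI, rule ccontr)
        fix y assume y: "y \<in> A i \<inter> A j" "y \<notin> N"
        obtain x where x: "x \<in> G' i" "y = \<iota> x" using A_cases[of y i] y by blast
        obtain z where z: "z \<in> G' j" "y = \<iota> z" using A_cases[of y j] y by blast
        have "x = z" using x z \<iota> by simp
        then show False using G'_disj[of x i j] x z \<open>i \<noteq> j\<close> by simp
      qed
      then show "A i \<inter> A j \<in> null_sets M" by (rule nullN)
    qed simp_all
    fix i k assume k: "k < length (\<theta> i)"
    have "(T ^^ k) ` A i - XP (f (\<theta> i ! k)) \<subseteq> N"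
    proof (rule subsetI, rule ccontr)
      fix y assume y: "y \<in> (T ^^ k) ` A i - XP (f (\<theta> i ! k))" "y \<notin> N"
      then have "y \<in> (T ^^ k) ` A i" by simp
      from Tk_cases[OF this y(2)] obtain x where x: "x \<in> G' i" "y = \<iota> ((E ^^ k) x)" by blast
      show False using GX[OF inducesD(2)[OF ind x(1) k]] x(2) y(1) by simp
    qed
    then show "(T ^^ k) ` A i - XP (map f (\<theta> i) ! k) \<in> null_sets M" using k by (simp add: nullN)
  next
    fix i k assume k: "0 < k \<and> k < length (\<theta> i)"
    have "(T ^^ k) ` A i \<inter> (\<Union>j. A j) \<subseteq> N"
    proof (rule subsetI, rule ccontr)
      fix y assume y: "y \<in> (T ^^ k) ` A i \<inter> (\<Union>j. A j)" "y \<notin> N"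
      then have "y \<in> (T ^^ k) ` A i" by simp
      from Tk_cases[OF this y(2)] obtain x
        where x: "x \<in> G' i" "y = \<iota> ((E ^^ k) x)" "(E ^^ k) x \<in> (\<Union>l. G l)" by blast
      obtain j where "y \<in> A j" using y(1) by blast
      then have "(E ^^ k) x \<in> G' j" using G'A[OF GK[OF x(3)]] x(2) by simp
      then show False using inducesD(3)[OF ind x(1), of k] k by blast
    qed
    then show "(T ^^ k) ` A i \<inter> (\<Union>j. A j) \<in> null_sets M" by (rule nullN)
  next
    fix i
    have "(T ^^ length (\<theta> i)) ` A i - (\<Union>j. A j) \<subseteq> N"
    proof (rule subsetI, rule ccontr)
      fix y assume y: "y \<in> (T ^^ length (\<theta> i)) ` A i - (\<Union>j. A j)" "y \<notin> N"
      then have "y \<in> (T ^^ length (\<theta> i)) ` A i" by simp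
      from Tk_cases[OF this y(2)] obtain x
        where x: "x \<in> G' i" "y = \<iota> ((E ^^ length (\<theta> i)) x)" "(E ^^ length (\<theta> i)) x \<in> (\<Union>l. G l)" by blast
      have "(E ^^ length (\<theta> i)) x \<in> (\<Union>j. G' j)" using inducesD(4,5)[OF ind x(1)] by simp
      then obtain j where "(E ^^ length (\<theta> i)) x \<in> G' j" by blast
      then have "y \<in> A j" using G'A[OF GK[OF x(3)]] x(2) by simp
      then show False using y(1) by blast
    qed
    then show "(T ^^ length (\<theta> i)) ` A i - (\<Union>j. A j) \<in> null_sets M" by (rule nullN)
  next
    have "X - (\<Union>i. \<Union>k<length (\<theta> i). (T ^^ k) ` A i) \<subseteq> N"
    proof (rule subsetI, rule ccontr)
      fix y assume y: "y \<in> X - (\<Union>i. \<Union>k<length (\<theta> i). (T ^^ k) ` A i)" "y \<notin> N"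
      then obtain s where s: "y = \<iota> s" "s \<in> piece c v 1 \<union> piece c v 2" "s \<notin> K" by (auto simp: X N_def)
      then obtain l where "s \<in> G l" by (auto simp: G_def generic_piece_def)
      from inducesD(6)[OF ind this] obtain i x k where x: "x \<in> G' i" "k < length (\<theta> i)" "s = (E ^^ k) x"
        by blast
      have "\<iota> x \<in> A i" using x(1) by (auto simp: A_def G'_def generic_piece_def)
      moreover have "x \<in> (\<Union>l. G l)" using G'G x(1) by (rule subsetD)
      from TkG[OF this, of k] have "y = (T ^^ k) (\<iota> x)" using x(3) s(1) by simp
      ultimately show False using y(1) x(2) by blast
    qed
    then show "space M - (\<Union>i. \<Union>k<length (\<theta> i). (T ^^ k) ` A i) \<in> null_sets M"
      unfolding space by (rule nullN)
  next
    fix i j k m assume "k < length (\<theta> i) \<and> m < length (\<theta> j) \<and> (i, k) \<noteq> (j, m)"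
    then show "(T ^^ k) ` A i \<inter> (T ^^ m) ` A j \<in> null_sets M" using towers by (intro nullN) auto
  qed
qed

section \<open>Words of the iterated substitutions\<close>

lemma endo_positive:
  assumes "\<And>i. g i = map (\<lambda>j. (j, s j)) (\<eta> i)"
  shows "endo g (map pos xs) = map (\<lambda>j. (j, s j)) (concat (map \<eta> xs))"
proof -
  have "concat (map (\<lambda>(i, s). if s then g i else inv_word (g i)) (map pos xs)) = map (\<lambda>j. (j, s j)) (concat (map \<eta> xs))"
    by (induction xs) (simp_all add: assms)
  moreover have "reduced (map (\<lambda>j. (j, s j)) (concat (map \<eta> xs)))"
    by (rule reduced_uniform[of _ s]) auto
  ultimately show ?thesis by (simp add: endo_def reduce_reduced)
qed

text \<open>Inverting a word of inverse letters makes it positive and reverses it. Preceded by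
  \<open>endo_positive\<close> with all signs negative, this computes the square on positive
  words.\<close>

lemma endo_negative:
  assumes "\<And>i. g i = map neg (\<zeta> i)"
  shows "endo g (map neg xs) = map pos (concat (map (\<lambda>i. rev (\<zeta> i)) xs))"
proof -
  have "inv_word (map neg ys) = map pos (rev ys)" for ys
    by (simp add: inv_word_def inv_letter_def rev_map)
  then have "concat (map (\<lambda>(i, s). if s then g i else inv_word (g i)) (map neg xs)) = map pos (concat (map (\<lambda>i. rev (\<zeta> i)) xs))"
    by (induction xs) (simp_all add: assms)
  moreover have "reduced (map pos (concat (map (\<lambda>i. rev (\<zeta> i)) xs)))"
    by (rule reduced_uniform[of _ "\<lambda>_. True"]) auto
  ultimately show ?thesis by (simp add: endo_def reduce_reduced)
qed

lemma concat_map_concat_replicate: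
  "concat (map f (concat (replicate n w))) = concat (replicate n (concat (map f w)))"
  by (induction n) simp_all

lemma tau_endo:
  assumes "admissible t a"
  shows "tau t a w = endo (\<lambda>i. tau t a [pos i]) w"
proof -
  have *: "subst u v = endo (\<lambda>i. subst u v [pos i])" if "reduced u" "reduced v" for u v
  proof -
    have "(\<lambda>i. if i = 1 then u else v) = (\<lambda>i. subst u v [pos i])"
    proof
      fix i :: 2 show "(if i = 1 then u else v) = subst u v [pos i]"
        using subst_generator[OF that] exhaust_2[of i] by auto
    qed
    then show ?thesis by (simp add: subst_def)
  qed
  have red: "reduced (letter_power 2 k @ [pos 1, pos 2])" if "k \<ge> 0" for k
    by (rule reduced_uniform[of _ "\<lambda>_. True"]) (use that in \<open>auto simp: letter_power_def\<close>)
  have red': "reduced (neg 1 # letter_power 2 k)" if "k < 0" for k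
    by (rule reduced_uniform[of _ "\<lambda>_. False"]) (use that in \<open>auto simp: letter_power_def\<close>)
  have red'': "reduced [neg 2]" by (simp add: reduced_def)
  show ?thesis
    using assms by (cases t) (simp_all, (rule fun_cong[OF *], (rule red red' red''; simp)+)+)
qed

lemma tau_list_word:
  assumes "admissible t a"
  shows "(tau t a ^^ tau_period t) (map pos xs) = map pos (concat (map (tau_list t a) xs))"
proof (cases t)
  case T1
  have a: "nat (a - 2) = Suc (nat (a - 3))" using assms T1 by simp
  have "tau T1 a [pos i] = map (\<lambda>j. (j, True)) (tau_list T1 a i)" for i
    using exhaust_2[of i] tau_words(1,2)[OF assms T1] T1 a
    by (auto simp: subst_lists_def inserts_def concat_map_concat_replicate simp del: tau.simps)
  then show ?thesis
    using endo_positive[of "\<lambda>i. tau T1 a [pos i]" "\<lambda>_. True" "tau_list T1 a"] tau_endo[OF assms] T1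
    by (simp del: tau.simps)
next
  case T2
  define n where "n = nat (- a - 2)"
  have n: "nat (- a - 1) = Suc n" using assms T2 by (simp add: n_def)
  \<comment> \<open>The words of \<open>tau\<close> with signs dropped; in the square, the second
    application reads them backwards.\<close>
  define \<zeta> where "\<zeta> i = (if i = (1::2) then 1 # replicate n 2 else 1 # replicate (Suc n) (2::2))" for i
  have *: "tau T2 a [pos i] = map neg (\<zeta> i)" for i
    using exhaust_2[of i] tau_words(3,4)[OF assms T2] T2 n
    by (auto simp: \<zeta>_def n_def simp del: tau.simps)
  have "tau_list T2 a i = concat (map (\<lambda>i. rev (\<zeta> i)) (\<zeta> i))" for i
    using exhaust_2[of i]
    by (auto simp: \<zeta>_def n_def[symmetric] subst_lists_def inserts_def concat_map_concat_replicate replicate_app_Cons_same)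
  then have "concat (map (\<lambda>i. rev (\<zeta> i)) (concat (map \<zeta> xs))) = concat (map (tau_list T2 a) xs)"
    by (induction xs) simp_all
  then show ?thesis
    using endo_positive[of "\<lambda>i. tau T2 a [pos i]" "\<lambda>_. False" \<zeta> xs] endo_negative[of "\<lambda>i. tau T2 a [pos i]" \<zeta>] * tau_endo[OF assms] T2
    by (simp add: numeral_2_eq_2 del: tau.simps tau_list.simps)
next
  case T4
  define n where "n = nat (- a)"
  define \<zeta> where "\<zeta> i = (if i = (1::2) then [2] else 1 # replicate n (2::2))" for i
  have *: "tau T4 a [pos i] = map neg (\<zeta> i)" for i
    using exhaust_2[of i] tau_words(5,6)[OF assms T4] T4
    by (auto simp: \<zeta>_def n_def simp del: tau.simps)
  have "tau_list T4 a i = concat (map (\<lambda>i. rev (\<zeta> i)) (\<zeta> i))" for i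
    using exhaust_2[of i]
    by (auto simp: \<zeta>_def n_def[symmetric] subst_lists_def inserts_def concat_map_concat_replicate)
  then have "concat (map (\<lambda>i. rev (\<zeta> i)) (concat (map \<zeta> xs))) = concat (map (tau_list T4 a) xs)"
    by (induction xs) simp_all
  then show ?thesis
    using endo_positive[of "\<lambda>i. tau T4 a [pos i]" "\<lambda>_. False" \<zeta> xs] endo_negative[of "\<lambda>i. tau T4 a [pos i]" \<zeta>] * tau_endo[OF assms] T4
    by (simp add: numeral_2_eq_2 del: tau.simps tau_list.simps)
qed

lemma tau_power_word:
  assumes "admissible t a"
  shows "(tau t a ^^ (n * tau_period t)) [pos i] = map pos ((subst_lists (tau_list t a) ^^ n) (\<lambda>i. [i]) i)"
proof (induction n)
  case (Suc n)
  have "(tau t a ^^ (Suc n * tau_period t)) [pos i] = (tau t a ^^ tau_period t) ((tau t a ^^ (n * tau_period t)) [pos i])"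
    by (simp add: funpow_add del: tau.simps)
  also have "\<dots> = map pos (concat (map (tau_list t a) ((subst_lists (tau_list t a) ^^ n) (\<lambda>i. [i]) i)))"
    unfolding Suc by (rule tau_list_word[OF assms])
  also have "concat (map (tau_list t a) ((subst_lists (tau_list t a) ^^ n) (\<lambda>i. [i]) i)) =
      (subst_lists (tau_list t a) ^^ Suc n) (\<lambda>i. [i]) i"
    unfolding funpow.simps comp_apply by (subst subst_lists_def) (rule refl)
  finally show ?case .
qed simp

lemma delta_inv_word: "delta_inv t (map pos xs) = map (signed_letter t) (concat (map (delta_list t) xs))"
proof -
  define s where "s i = (t = T2 \<or> i = 2)" for i :: 2
  have sl: "signed_letter t = (\<lambda>j. (j, s j))" by (auto simp: signed_letter_def s_def)
  define g where "g i = map (\<lambda>j. (j, s j)) (delta_list t i)" for i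
  have "delta_inv t = endo g"
    by (cases t) (auto simp: subst_def g_def s_def inserts_def fun_eq_iff forall_2 intro!: arg_cong2[of _ _ _ _ endo])
  then show ?thesis using endo_positive[of g s "delta_list t" xs] by (simp add: g_def sl)
qed

lemma theta_word:
  assumes "admissible t a"
  shows "(delta_inv t \<circ> (tau t a ^^ (n * tau_period t))) [pos i] =
    map (signed_letter t) (subst_lists (delta_list t) ((subst_lists (tau_list t a) ^^ n) (\<lambda>i. [i])) i)"
  unfolding comp_apply tau_power_word[OF assms] delta_inv_word subst_lists_def[of "delta_list t"] ..

lemma piece_shrink: "r \<noteq> 0 \<Longrightarrow> (\<lambda>x. x *\<^sub>R w) ` piece c v i =
    (\<lambda>x. x *\<^sub>R ((1 / r) *\<^sub>R w :: real ^ 2)) ` piece (r * c) (\<lambda>i. r * v i) i"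
  unfolding piece_scale[symmetric] image_image by simp

context
  fixes t :: family and a :: int and l :: real and T :: "real ^ 2 \<Rightarrow> real ^ 2"
  assumes adm: "admissible t a" and root: "contracting_root t a l" and dom: "is_domain_exchange t a T"
begin

text \<open>Admitting \<open>n = 0\<close> and exponents \<open>n * tau_period t\<close> covers all
  claims of the theorem at once.\<close>

lemma theta_structure:
  "sigma_has_structure t a T (delta_inv t \<circ> (tau t a ^^ (n * tau_period t)))
    (\<lambda>i. (*v) (matrix_inv (real_incidence_matrix (delta t))) `
      ((*v) (real_incidence_matrix (tau t a)) ^^ (n * tau_period t)) ` X_tau t a i)"
proof -
  interpret S: eigenline "real_incidence_matrix (sigma t a)" 0 "- of_int (if t = T4 then - 1 else 1)" 1 a l "a - l" "unit_steps l"
    by (rule eigenline_sigma[OF adm root])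
  define w where "w = S.dir"
  define \<iota> where "\<iota> = (\<lambda>x. x *\<^sub>R w)"
  define c v where "c = sigma_cut t l" and "v = sigma_steps t l"
  define X where "X = X_sigma t a"
  define P where "P = contracting_line (real_incidence_matrix (sigma t a))"
  define e where "e = (SOME u. u \<in> P \<and> norm u = 1)"
  have w0: "w \<noteq> 0" unfolding w_def by (rule S.dir_nonzero)
  have Pw: "P = range (\<lambda>x. x *\<^sub>R w)" unfolding P_def w_def by (rule S.contracting_line_eq)
  interpret unit_line P w e by unfold_locales (use Pw w0 in \<open>auto simp: e_def\<close>)
  obtain r where r: "r \<noteq> 0" "w = r *\<^sub>R e" by (rule w_eq)
  have part: "X_sigma_part t a (signed_letter t i) = \<iota> ` piece c v i" for i
    unfolding X_sigma_part_eq[OF adm root] \<iota>_def w_def c_def v_def ..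
  have Xeq: "X = \<iota> ` (piece c v 1 \<union> piece c v 2)"
    unfolding X_def X_sigma_eq[OF adm root] part by (simp add: UNIV_2 image_Un)
  have exch: "exchange_induces (root_span l) c v (subst_lists (delta_list t) ((subst_lists (tau_list t a) ^^ n) (\<lambda>i. [i])))
    (l ^ (n * tau_period t) * tau_cut t l) (\<lambda>i. l ^ (n * tau_period t) * tau_steps t l i)"
    unfolding c_def v_def by (rule exchange_induces_delta_tau[OF adm root])
  then have opp: "opposite v" by (simp add: exchange_induces_def)
  have Tx: "\<exists>i. x \<in> \<iota> ` piece c v i \<and> T x = x - \<iota> (v i)" if x: "x \<in> X" for x
  proof -
    have "x \<in> (\<Union>i. X_sigma_part t a (signed_letter t i))"
      using x unfolding X_def X_sigma_eq[OF adm root] .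
    then obtain i where i: "x \<in> \<iota> ` piece c v i"
      "T x = x - eigenprojection (real_incidence_matrix (sigma t a)) (real_vec (abelianize [signed_letter t i]))"
      using dom unfolding is_domain_exchange_def part by blast
    have "phi (unit_steps l) (abelianize [signed_letter t i]) = v i"
      using exhaust_2[of i] by (cases t) (auto simp: signed_letter_def phi_pt v_def)
    then have "eigenprojection (real_incidence_matrix (sigma t a)) (real_vec (abelianize [signed_letter t i])) = \<iota> (v i)"
      by (simp only: S.eigenprojection_eq phi_real_vec \<iota>_def w_def)
    then show ?thesis using i by auto
  qed
  have XP: "X \<subseteq> P" by (auto simp: Xeq Pw \<iota>_def)
  have "compact X" unfolding Xeq piece_def \<iota>_def by (intro compact_continuous_image continuous_intros compact_Un) auto
  then have XL: "X \<in> sets L" using XP by (rule L_compact)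
  have M: "X_sigma_measure t a = restrict_space L X"
    by (simp add: X_sigma_measure_def X_def P_def)
  \<comment> \<open>The measure is normalised by \<open>e\<close>, so the exchange is rescaled by
    \<open>r\<close> before measure preservation is applied.\<close>
  have line_piece: "\<iota> ` piece c v i = line ` piece (r * c) (\<lambda>i. r * v i) i" for i
    using piece_shrink[OF r(1), of w c v i] r by (simp add: \<iota>_def)
  have "has_theta_structure (X_sigma_measure t a) T
    (\<lambda>i. map (signed_letter t) (subst_lists (delta_list t) ((subst_lists (tau_list t a) ^^ n) (\<lambda>i. [i])) i))
    (range (signed_letter t)) (X_sigma_part t a)
    (\<lambda>i. (\<lambda>x. x *\<^sub>R w) ` piece (l ^ (n * tau_period t) * tau_cut t l) (\<lambda>i. l ^ (n * tau_period t) * tau_steps t l i) i)"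
  proof (rule has_theta_structure_exchange[OF additive_root_span countable_root_span w0 exch])
    show "X = (\<lambda>x. x *\<^sub>R w) ` (piece c v 1 \<union> piece c v 2)" using Xeq by (simp add: \<iota>_def)
    show "\<exists>i. x \<in> (\<lambda>x. x *\<^sub>R w) ` piece c v i \<and> T x = x - v i *\<^sub>R w" if "x \<in> X" for x
      using Tx[OF that] by (simp add: \<iota>_def)
    show "space (X_sigma_measure t a) = X" unfolding M using XL by simp
    show "S \<in> null_sets (X_sigma_measure t a)" if "S \<subseteq> X" "countable S" for S
      unfolding M null_sets_restrict_space[OF XL] using that XP L_null_countable by auto
    show "S \<in> sets (X_sigma_measure t a)" if "compact S" "S \<subseteq> X" for S
    proof -
      have "X \<inter> space L = X" using XP by auto
      then show ?thesis
        unfolding M using XL that XP L_compact[of S] by (subst sets_restrict_space_iff) auto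
    qed
    show "X_sigma_part t a (signed_letter t i) = (\<lambda>x. x *\<^sub>R w) ` piece c v i" for i
      using part by (simp add: \<iota>_def)
    show "inj (signed_letter t)" by (auto simp: inj_def signed_letter_def)
    show "measurable_dynamical_system (X_sigma_measure t a) T"
      unfolding M
    proof (rule measurable_dynamical_system_exchange[of "\<lambda>i. r * v i" X "r * c"])
      show "opposite (\<lambda>i. r * v i)"
        using opp r(1) by (cases "r > 0") (auto simp: opposite_def mult_less_0_iff zero_less_mult_iff)
      show "X = line ` (piece (r * c) (\<lambda>i. r * v i) 1 \<union> piece (r * c) (\<lambda>i. r * v i) 2)"
        unfolding Xeq image_Un line_piece ..
      show "\<exists>i. x \<in> line ` piece (r * c) (\<lambda>i. r * v i) i \<and> T x = x - line (r * v i)" if "x \<in> X" for x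
        using Tx[OF that] unfolding line_piece by (auto simp: \<iota>_def r(2) mult.commute)
    qed
  qed
  then show ?thesis
    unfolding sigma_has_structure_def theta_word[OF adm] delta_inverse_tau_piece[OF adm root] w_def .
qed

end

theorem theorem5:
  fixes t :: family and a :: int and T :: "real ^ 2 \<Rightarrow> real ^ 2"
  assumes "admissible t a"
    and "is_domain_exchange t a T"
  shows
    "sigma_has_structure t a T (delta_inv t)
       (\<lambda>i. (*v) (matrix_inv (real_incidence_matrix (delta t))) ` X_tau t a i)
     \<and> (\<forall>n::nat. n > 0 \<longrightarrow>
         (t = T1 \<longrightarrow>
            sigma_has_structure t a T (delta_inv t \<circ> (tau t a ^^ n))
              (\<lambda>i. (*v) (matrix_inv (real_incidence_matrix (delta t))) `
                 ((*v) (real_incidence_matrix (tau t a)) ^^ n) ` X_tau t a i))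
       \<and> (t = T2 \<or> t = T4 \<longrightarrow>
            sigma_has_structure t a T (delta_inv t \<circ> (tau t a ^^ (2 * n)))
              (\<lambda>i. (*v) (matrix_inv (real_incidence_matrix (delta t))) `
                 ((*v) (real_incidence_matrix (tau t a)) ^^ (2 * n)) ` X_tau t a i)))"
proof -
  obtain l where root: "contracting_root t a l" using contracting_root_exists[OF assms(1)] .
  note theta = theta_structure[OF assms(1) root assms(2)]
  have "sigma_has_structure t a T (delta_inv t)
       (\<lambda>i. (*v) (matrix_inv (real_incidence_matrix (delta t))) ` X_tau t a i)"
    using theta[of 0] by (simp del: tau.simps delta.simps delta_inv.simps)
  moreover have "sigma_has_structure t a T (delta_inv t \<circ> (tau t a ^^ n))
      (\<lambda>i. (*v) (matrix_inv (real_incidence_matrix (delta t))) `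
        ((*v) (real_incidence_matrix (tau t a)) ^^ n) ` X_tau t a i)" if "t = T1" for n
    using theta[of n] that by (simp del: tau.simps delta.simps delta_inv.simps)
  moreover have "sigma_has_structure t a T (delta_inv t \<circ> (tau t a ^^ (2 * n)))
      (\<lambda>i. (*v) (matrix_inv (real_incidence_matrix (delta t))) `
        ((*v) (real_incidence_matrix (tau t a)) ^^ (2 * n)) ` X_tau t a i)" if "t = T2 \<or> t = T4" for n
  proof -
    have "n * tau_period t = 2 * n" using that by auto
    then show ?thesis using theta[of n] by (simp only:)
  qed
  ultimately show ?thesis by blast
qed

end
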